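(* Let $d\in\mathbb{N}$, $0<p\le u<\infty$ and $0<q\le\infty$. Then $$\mathcal{E}^{\frac du}_{u,p,q}(\mathbb{R}^d)\hookrightarrow \mathcal{M}_{\frac up,\Phi_{p,1}}(\mathbb{R}^d),$$ where $\Phi_{p,1}(t)=t^p\exp(t)$, $t\ge0$.
   Context: Dyadic cubes: $\mathcal{Q}=\{Q_{j,k}=2^{-j}([0,1)^d+k): j\in\mathbb{Z},\ k\in\mathbb{Z}^d\}$; $|\cdot|$ is Lebesgue measure. Morrey space: for $0<p\le u<\infty$, $\mathcal{M}_{u,p}(\mathbb{R}^d)$ is the set of all $f\in L_p^{\mathrm{loc}}(\mathbb{R}^d)$ with $\|f|\mathcal{M}_{u,p}(\mathbb{R}^d)\|=\sup_{Q\in\mathcal{Q}}|Q|^{\frac1u-\frac1p}\left(\int_Q|f(y)|^p\,dy\right)^{1/p}<\infty$. Resolution of unity: $\varphi_0=\varphi\in\mathcal{S}(\mathbb{R}^d)$ with $\operatorname{supp}\varphi\subset\{|x|\le 2\}$ and $\varphi(x)=1$ for $|x|\le1$; $\varphi_j(x)=\varphi(2^{-j}x)-\varphi(2^{-j+1}x)$ for $j\in\mathbb{N}$. $\mathcal{F}$ is the Fourier transform on $\mathcal{S}'(\mathbb{R}^d)$. Triebel-Lizorkin-Morrey space: for $0<p\le u<\infty$, $0<q\le\infty$, $s\in\mathbb{R}$, $\mathcal{E}^s_{u,p,q}(\mathbb{R}^d)$ is the set of all $f\in\mathcal{S}'(\mathbb{R}^d)$ with $\|f|\mathcal{E}^s_{u,p,q}(\mathbb{R}^d)\|=\left\|\left(\sum_{j=0}^\infty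 2^{jsq}|\mathcal{F}^{-1}(\varphi_j\mathcal{F}f)(\cdot)|^q\right)^{1/q}\big|\mathcal{M}_{u,p}(\mathbb{R}^d)\right\|<\infty$ (usual modification if $q=\infty$). Orlicz-Morrey space: for $1\le r<\infty$, a function $\Phi:[0,\infty)\to[0,\infty)$ and a cube $Q$, put $\|f\|_{(r,\Phi);Q}=\inf\left\{\lambda>0:\ |Q|^{\frac1r-1}\int_Q\Phi\left(\frac{|f(x)|}{\lambda}\right)dx\le1\right\}$. Then $\mathcal{M}_{r,\Phi}(\mathbb{R}^d)$ is the set of all measurable $f$ with $\|f|\mathcal{M}_{r,\Phi}(\mathbb{R}^d)\|=\sup_{Q\in\mathcal{Q}}\|f\|_{(r,\Phi);Q}<\infty$. This is applied with $\Phi=\Phi_{p,1}$ for all $p>0$. $X\hookrightarrow Y$ means $X\subset Y$ and the natural embedding is continuous, i.e. $\|f|Y\|\le C\|f|X\|$ for all $f\in X$ with $C$ independent of $f$ (distributions given by locally integrable functions are identified with those functions). *)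

theory Defs
  imports "HOL-Analysis.Analysis"
begin

section \<open>Schwartz functions and tempered distributions\<close>

definition partial_deriv :: "'n::finite \<Rightarrow> (real^'n \<Rightarrow> complex) \<Rightarrow> real^'n \<Rightarrow> complex" where
  "partial_deriv i f x = vector_derivative (\<lambda>t::real. f (x + t *\<^sub>R axis i 1)) (at 0)"

text \<open>A multi-index is given as the list of the directions of differentiation.\<close>

definition iter_partial :: "'n::finite list \<Rightarrow> (real^'n \<Rightarrow> complex) \<Rightarrow> real^'n \<Rightarrow> complex" where
  "iter_partial \<alpha> f = foldr partial_deriv \<alpha> f"

text \<open>
  \<open>C\<^sup>\<infinity>\<close>: all iterated partial derivatives exist, are Frechet differentiable and hence continuous.
\<close>

definition smooth :: "(real^'n \<Rightarrow> complex) \<Rightarrow> bool" where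
  "smooth f \<longleftrightarrow> (\<forall>\<alpha>. iter_partial \<alpha> f differentiable_on UNIV)"

definition supp :: "(real^'n \<Rightarrow> complex) \<Rightarrow> (real^'n) set" where
  "supp f = closure {x. f x \<noteq> 0}"

definition test_functions :: "(real^'n \<Rightarrow> complex) set" where
  "test_functions = {\<psi>. smooth \<psi> \<and> compact (supp \<psi>)}"

definition schwartz :: "(real^'n \<Rightarrow> complex) set" where
  "schwartz = {\<psi>. smooth \<psi> \<and>
     (\<forall>k \<alpha>. bdd_above (range (\<lambda>x. (1 + norm x) ^ k * cmod (iter_partial \<alpha> \<psi> x))))}"

definition schwartz_seminorm :: "nat \<Rightarrow> 'n::finite list \<Rightarrow> (real^'n \<Rightarrow> complex) \<Rightarrow> real" where
  "schwartz_seminorm k \<alpha> \<psi> = (SUP x. (1 + norm x) ^ k * cmod (iter_partial \<alpha> \<psi> x))"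

definition schwartz_tendsto ::
    "(nat \<Rightarrow> real^'n \<Rightarrow> complex) \<Rightarrow> (real^'n \<Rightarrow> complex) \<Rightarrow> bool" where
  "schwartz_tendsto \<psi> \<eta> \<longleftrightarrow>
     (\<forall>k \<alpha>. (\<lambda>n. schwartz_seminorm k \<alpha> (\<lambda>x. \<psi> n x - \<eta> x)) \<longlonglongrightarrow> 0)"

type_synonym 'n functional = "(real^'n \<Rightarrow> complex) \<Rightarrow> complex"

text \<open>
  Continuous linear functionals on the Schwartz space; as its topology is metrizable,
  continuity is sequential continuity. Only the values on Schwartz functions are relevant.
\<close>

definition tempered_distributions :: "'n::finite functional set" where
  "tempered_distributions = {T.
     (\<forall>\<psi>\<in>schwartz. \<forall>\<eta>\<in>schwartz. \<forall>a b. T (\<lambda>x. a * \<psi> x + b * \<eta> x) = a * T \<psi> + b * T \<eta>) \<and>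
     (\<forall>\<psi> \<eta>. (\<forall>n. \<psi> n \<in> schwartz) \<longrightarrow> \<eta> \<in> schwartz \<longrightarrow> schwartz_tendsto \<psi> \<eta> \<longrightarrow>
        (\<lambda>n. T (\<psi> n)) \<longlonglongrightarrow> T \<eta>)}"

section \<open>Fourier transform\<close>

definition fourier :: "(real^'n \<Rightarrow> complex) \<Rightarrow> real^'n \<Rightarrow> complex" where
  "fourier \<psi> \<xi> = of_real ((2 * pi) powr (- real CARD('n) / 2)) *
     (\<integral>x. cis (- (x \<bullet> \<xi>)) * \<psi> x \<partial>lebesgue)"

definition inv_fourier :: "(real^'n \<Rightarrow> complex) \<Rightarrow> real^'n \<Rightarrow> complex" where
  "inv_fourier \<psi> x = of_real ((2 * pi) powr (- real CARD('n) / 2)) *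
     (\<integral>\<xi>. cis (x \<bullet> \<xi>) * \<psi> \<xi> \<partial>lebesgue)"

definition dist_fourier :: "'n::finite functional \<Rightarrow> 'n::finite functional" where
  "dist_fourier T = (\<lambda>\<psi>. T (fourier \<psi>))"

definition dist_inv_fourier :: "'n::finite functional \<Rightarrow> 'n::finite functional" where
  "dist_inv_fourier T = (\<lambda>\<psi>. T (inv_fourier \<psi>))"

definition dist_mult :: "(real^'n \<Rightarrow> complex) \<Rightarrow> 'n::finite functional \<Rightarrow> 'n::finite functional" where
  "dist_mult \<phi> T = (\<lambda>\<psi>. T (\<lambda>x. \<phi> x * \<psi> x))"

section \<open>Distributions given by functions\<close>

text \<open>
  The locally integrable function \<open>h\<close> and the distribution \<open>T\<close> are identified. Testing against
  \<open>C\<^sub>c\<^sup>\<infinity>\<close> only, so that no growth condition on \<open>h\<close> is needed; as \<open>C\<^sub>c\<^sup>\<infinity>\<close> is dense in the Schwartz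
  space, this determines a tempered \<open>T\<close>, and \<open>h\<close> is determined by \<open>T\<close> almost everywhere.
\<close>

definition represents :: "(real^'n \<Rightarrow> complex) \<Rightarrow> 'n::finite functional \<Rightarrow> bool" where
  "represents h T \<longleftrightarrow>
     (\<forall>K. compact K \<longrightarrow> h absolutely_integrable_on K) \<and>
     (\<forall>\<psi>\<in>test_functions. T \<psi> = (\<integral>x. h x * \<psi> x \<partial>lebesgue))"

text \<open>
  Used for distributions with compactly supported Fourier transform only: these are given by a
  (unique) continuous function, by the Paley--Wiener--Schwartz theorem.
\<close>

definition fun_of_dist :: "'n::finite functional \<Rightarrow> real^'n \<Rightarrow> complex" where
  "fun_of_dist T = (THE g. continuous_on UNIV g \<and> represents g T)"

section \<open>Morrey norm\<close>

definition dyadic_cube :: "int \<Rightarrow> int^'n \<Rightarrow> (real^'n) set" where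
  "dyadic_cube j k =
     (\<lambda>x. (2 powi (- j)) *\<^sub>R (x + (\<chi> i. of_int (k $ i)))) ` {x. \<forall>i. 0 \<le> x $ i \<and> x $ i < 1}"

definition dyadic_cubes :: "(real^'n) set set" where
  "dyadic_cubes = {dyadic_cube j k | j k. True}"

text \<open>Only used for exponents \<open>a > 0\<close>.\<close>

definition ennreal_powr :: "ennreal \<Rightarrow> real \<Rightarrow> ennreal" where
  "ennreal_powr x a = (if x = \<infinity> then \<infinity> else ennreal (enn2real x powr a))"

text \<open>
  The Morrey (quasi-)norm depends on the absolute value \<open>G\<close> of a function only. It is taken for
  \<open>[0,\<infinity>]\<close>-valued \<open>G\<close>, as the sums below may diverge at some points; finiteness of the norm
  of a measurable \<open>G\<close> entails that \<open>G\<close> is finite almost everywhere and locally in \<open>L\<^sub>p\<close>.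
\<close>

definition morrey_norm :: "real \<Rightarrow> real \<Rightarrow> (real^'n \<Rightarrow> ennreal) \<Rightarrow> ennreal" where
  "morrey_norm u p G = (SUP Q\<in>dyadic_cubes.
     ennreal (measure lebesgue Q powr (1 / u - 1 / p)) *
     ennreal_powr (\<integral>\<^sup>+y\<in>Q. ennreal_powr (G y) p \<partial>lebesgue) (1 / p))"

section \<open>Triebel--Lizorkin--Morrey spaces\<close>

definition resolution_generator :: "(real^'n \<Rightarrow> complex) \<Rightarrow> bool" where
  "resolution_generator \<phi> \<longleftrightarrow>
     \<phi> \<in> schwartz \<and> supp \<phi> \<subseteq> {x. norm x \<le> 2} \<and> (\<forall>x. norm x \<le> 1 \<longrightarrow> \<phi> x = 1)"

definition resolution :: "(real^'n \<Rightarrow> complex) \<Rightarrow> nat \<Rightarrow> real^'n \<Rightarrow> complex" where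
  "resolution \<phi> j = (if j = 0 then \<phi>
     else (\<lambda>x. \<phi> ((2 powi (- int j)) *\<^sub>R x) - \<phi> ((2 powi (- int j + 1)) *\<^sub>R x)))"

definition lp_piece :: "(real^'n \<Rightarrow> complex) \<Rightarrow> nat \<Rightarrow> 'n::finite functional \<Rightarrow> real^'n \<Rightarrow> complex" where
  "lp_piece \<phi> j f = fun_of_dist (dist_inv_fourier (dist_mult (resolution \<phi> j) (dist_fourier f)))"

definition tlm_lq_function ::
    "(real^'n \<Rightarrow> complex) \<Rightarrow> real \<Rightarrow> ennreal \<Rightarrow> 'n::finite functional \<Rightarrow> real^'n \<Rightarrow> ennreal" where
  "tlm_lq_function \<phi> s q f x =
     (if q = \<infinity> then (SUP j. ennreal (2 powr (real j * s) * cmod (lp_piece \<phi> j f x)))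
      else ennreal_powr
        (\<Sum>j. ennreal (2 powr (real j * s * enn2real q) * cmod (lp_piece \<phi> j f x) powr enn2real q))
        (1 / enn2real q))"

definition tlm_norm ::
    "(real^'n \<Rightarrow> complex) \<Rightarrow> real \<Rightarrow> real \<Rightarrow> real \<Rightarrow> ennreal \<Rightarrow> 'n::finite functional \<Rightarrow> ennreal" where
  "tlm_norm \<phi> s u p q f = morrey_norm u p (tlm_lq_function \<phi> s q f)"

definition tlm_space ::
    "(real^'n \<Rightarrow> complex) \<Rightarrow> real \<Rightarrow> real \<Rightarrow> real \<Rightarrow> ennreal \<Rightarrow> 'n::finite functional set" where
  "tlm_space \<phi> s u p q = {f \<in> tempered_distributions. tlm_norm \<phi> s u p q f < \<infinity>}"

section \<open>Orlicz--Morrey spaces\<close>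

definition orlicz_cube_norm ::
    "real \<Rightarrow> (real \<Rightarrow> real) \<Rightarrow> (real^'n) set \<Rightarrow> (real^'n \<Rightarrow> complex) \<Rightarrow> ennreal" where
  "orlicz_cube_norm r \<Phi> Q f = (INF l\<in>{l::real. l > 0 \<and>
     ennreal (measure lebesgue Q powr (1 / r - 1)) *
       (\<integral>\<^sup>+x\<in>Q. ennreal (\<Phi> (cmod (f x) / l)) \<partial>lebesgue) \<le> 1}. ennreal l)"

definition orlicz_morrey_norm ::
    "real \<Rightarrow> (real \<Rightarrow> real) \<Rightarrow> (real^'n \<Rightarrow> complex) \<Rightarrow> ennreal" where
  "orlicz_morrey_norm r \<Phi> f = (SUP Q\<in>dyadic_cubes. orlicz_cube_norm r \<Phi> Q f)"

definition orlicz_morrey_space ::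
    "real \<Rightarrow> (real \<Rightarrow> real) \<Rightarrow> (real^'n \<Rightarrow> complex) set" where
  "orlicz_morrey_space r \<Phi> =
     {f \<in> borel_measurable lebesgue. orlicz_morrey_norm r \<Phi> f < \<infinity>}"

definition Phi_p1 :: "real \<Rightarrow> real \<Rightarrow> real" where
  "Phi_p1 p t = t powr p * exp t"

section \<open>Continuous embeddings\<close>

text \<open>
  \<open>X\<close> is a space of distributions and \<open>Y\<close> a space of functions (with (quasi-)norms \<open>nX\<close>, \<open>nY\<close>),
  distributions being identified with the functions that represent them.
\<close>

definition continuously_embedded ::
    "'n::finite functional set \<Rightarrow> ('n::finite functional \<Rightarrow> ennreal) \<Rightarrow>
     (real^'n \<Rightarrow> complex) set \<Rightarrow> ((real^'n \<Rightarrow> complex) \<Rightarrow> ennreal) \<Rightarrow> bool" where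
  "continuously_embedded X nX Y nY \<longleftrightarrow>
     (\<exists>C::real. C > 0 \<and> (\<forall>f\<in>X. \<exists>h\<in>Y. represents h f \<and> nY h \<le> ennreal C * nX f))"

end

theory Submission
  imports Defs
begin

text \<open>
  The Littlewood--Paley pieces \<open>f\<^sub>j\<close> of \<open>f\<close> satisfy \<open>\<bar>f\<^sub>j\<bar> \<le> 2\<^bsup>-jd/u\<^esup> G\<close>, where the Morrey norm of
  \<open>G = sup\<^sub>j 2\<^bsup>jd/u\<^esup> \<bar>f\<^sub>j\<bar>\<close> is at most the norm \<open>N\<close> of \<open>f\<close>, and by a Nikolskii type inequality also
  \<open>\<bar>f\<^sub>j\<bar> \<le> C N\<close> uniformly in \<open>j\<close>. Hence \<open>\<Sum>\<bar>f\<^sub>j\<bar>\<close> is dominated by a truncated geometric series, which grows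
  like \<open>G\<close> where \<open>G \<le> N\<close> and like \<open>N log (G / N)\<close> elsewhere; this gives the pointwise bound
  \<open>\<Phi> (\<bar>f\<bar> / (K N)) \<le> (G / N)\<^sup>p\<close>, which is integrated over dyadic cubes.
\<close>

section \<open>Rapidly decreasing functions\<close>

text \<open>For \<open>p < 1\<close> the Morrey bound does not make \<open>G\<close> locally
  integrable, so it is not evident that the series of the pieces converges to a locally integrable
  function. The limit comes from the same logarithmic gain as the Orlicz estimate: the sum of the
  absolute values of the pieces is at most a multiple of \<open>N * (1 + (G / N) powr p)\<close>,
  and \<open>G powr p\<close> is integrable against the weight
  \<open>1 / (1 + norm x) ^ (d + 1)\<close>. Dominated convergence against test functions then shows
  that the sum represents \<open>f\<close>. The pieces are given by a description operator applied
  to functionals. They are made concrete as \<open>y \<mapsto> f (k (\<cdot> - y))\<close> with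
  Schwartz kernels \<open>k\<close>; this requires moving a sequentially continuous functional under
  a convolution integral. No constant of Fourier inversion is computed. One nonzero factor
  \<open>\<gamma>\<close> occurs both in the limit of the partial sums and in the reproducing
  formula for the pieces, and it is divided out. The index \<open>q\<close> enters only because the
  \<open>q\<close>-norm of a sequence dominates its supremum.\<close>

lemma weight_le:
  fixes x y :: "'a::real_normed_vector"
  shows "1 + norm x \<le> (1 + norm y) * (1 + norm (x - y))"
proof -
  have "norm x \<le> norm y + norm (x - y)"
    using norm_triangle_ineq[of y "x - y"] by simp
  moreover have "0 \<le> norm y * norm (x - y)" by simp
  moreover have "(1 + norm y) * (1 + norm (x - y)) = 1 + norm y + norm (x - y) + norm y * norm (x - y)"
    by (simp only: distrib_left distrib_right mult_1_left mult_1_right add_ac)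
  ultimately show ?thesis by linarith
qed

text \<open>Peetre's inequality: the weight is submultiplicative along
  \<open>x = y + (x - y)\<close>. Transfers of decay between a function and its translates or
  convolutions rest on it.\<close>

lemma weight_power_le:
  fixes x y :: "'a::real_normed_vector"
  shows "(1 + norm x) ^ k \<le> (1 + norm y) ^ k * (1 + norm (x - y)) ^ k"
  using power_mono[OF weight_le[of x y], of k] by (simp add: power_mult_distrib)

text \<open>On the shell where \<open>1 + norm x\<close> lies between \<open>2 ^ j\<close> and
  \<open>2 ^ Suc j\<close> the weight is at most \<open>(1/2) ^ (j * (d + 1))\<close>, while the
  ball containing the shell has volume of order \<open>2 ^ (j * d)\<close>. The one extra power
  leaves a geometric series of ratio 1/2.\<close>

lemma integrable_weight:
  "integrable lborel (\<lambda>x::'a::euclidean_space. 1 / (1 + norm x) ^ (DIM('a) + 1))"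
proof -
  let ?d = "DIM('a)"
  let ?V = "measure lborel (ball (0::'a) 1)"
  define a where "a j = ennreal ((1/2) ^ (j * (?d + 1)))" for j
  have pt: "ennreal (1 / (1 + norm x) ^ (?d + 1)) \<le> (\<Sum>j. a j * indicator (ball 0 (2 ^ Suc j)) x)" for x :: 'a
  proof -
    obtain n where n: "1 + norm x < 2 ^ n"
      using real_arch_pow[of 2 "1 + norm x"] by auto
    define m where "m = (LEAST n. 1 + norm x < 2 ^ n)"
    have m: "1 + norm x < 2 ^ m" unfolding m_def by (rule LeastI[of _ n]) (rule n)
    have "m \<noteq> 0" using m norm_ge_zero[of x] by (intro notI) (simp del: norm_ge_zero)
    then obtain j where j: "m = Suc j" using not0_implies_Suc by blast
    have low: "2 ^ j \<le> 1 + norm x"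
      using not_less_Least[of j "\<lambda>n. 1 + norm x < 2 ^ n"] j m_def by auto
    have "1 / (1 + norm x) ^ (?d + 1) \<le> 1 / (2 ^ j) ^ (?d + 1)"
      by (intro divide_left_mono power_mono low mult_pos_pos zero_less_power) (auto intro: add_pos_nonneg)
    also have "\<dots> = (1/2) ^ (j * (?d + 1))"
      by (simp only: power_mult power_one_over)
    finally have "ennreal (1 / (1 + norm x) ^ (?d + 1)) \<le> a j * indicator (ball 0 (2 ^ Suc j)) x"
      using m j by (auto simp: a_def indicator_def intro!: ennreal_leI)
    also have "\<dots> = (\<Sum>i\<in>{j}. a i * indicator (ball 0 (2 ^ Suc i)) x)"
      by (subst sum.insert) auto
    also have "\<dots> \<le> (\<Sum>i. a i * indicator (ball 0 (2 ^ Suc i)) x)"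
      by (rule sum_le_suminf) (auto simp: summableI)
    finally show ?thesis .
  qed
  have "(\<integral>\<^sup>+(x::'a). ennreal (1 / (1 + norm x) ^ (?d + 1)) \<partial>lborel)
      \<le> (\<integral>\<^sup>+(x::'a). (\<Sum>j. a j * indicator (ball 0 (2 ^ Suc j)) x) \<partial>lborel)"
    by (intro nn_integral_mono pt)
  also have "\<dots> = (\<Sum>j. \<integral>\<^sup>+(x::'a). a j * indicator (ball 0 (2 ^ Suc j)) x \<partial>lborel)"
    by (intro nn_integral_suminf borel_measurable_times_ennreal borel_measurable_const borel_measurable_indicator) simp
  also have "\<dots> = (\<Sum>j. ennreal (2 ^ ?d * ?V * (1/2) ^ j))"
  proof (rule suminf_cong)
    fix j
    have e: "emeasure lborel (ball (0::'a) (2 ^ Suc j)) = ennreal ((2 ^ Suc j) ^ ?d * ?V)"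
    proof -
      have "emeasure lborel (ball (0::'a) (2 ^ Suc j)) = ennreal (measure lborel (ball (0::'a) (2 ^ Suc j)))"
        by (intro emeasure_eq_ennreal_measure) (use emeasure_bounded_finite[of "ball (0::'a) (2 ^ Suc j)"] in auto)
      also have "measure lborel (ball (0::'a) (2 ^ Suc j)) = (2 ^ Suc j) ^ ?d * ?V"
        using content_ball_conv_unit_ball[of "2 ^ Suc j" "0::'a"] by simp
      finally show ?thesis .
    qed
    have "(\<integral>\<^sup>+(x::'a). a j * indicator (ball 0 (2 ^ Suc j)) x \<partial>lborel) = a j * emeasure lborel (ball (0::'a) (2 ^ Suc j))"
      by (rule nn_integral_cmult_indicator) auto
    also have "\<dots> = ennreal ((1/2) ^ (j * (?d + 1)) * ((2 ^ Suc j) ^ ?d * ?V))"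
      unfolding e a_def by (rule ennreal_mult[symmetric]) auto
    also have "(1/2) ^ (j * (?d + 1)) * ((2 ^ Suc j) ^ ?d * ?V) = 2 ^ ?d * ?V * (1/2) ^ j"
    proof -
      have "(1/2::real) ^ (j * (?d + 1)) = (1/2) ^ j * (1/2) ^ (j * ?d)"
        by (simp add: power_add algebra_simps)
      moreover have "((2::real) ^ Suc j) ^ ?d = 2 ^ ?d * 2 ^ (j * ?d)"
        by (simp only: power_mult power_Suc power_mult_distrib)
      moreover have "(1/2::real) ^ (j * ?d) * 2 ^ (j * ?d) = 1"
        by (simp flip: power_mult_distrib)
      ultimately have "(1/2) ^ (j * (?d + 1)) * ((2 ^ Suc j) ^ ?d * ?V)
          = (1/2) ^ j * 2 ^ ?d * ?V * ((1/2::real) ^ (j * ?d) * 2 ^ (j * ?d))"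
        by (simp only: mult_ac)
      also have "\<dots> = 2 ^ ?d * ?V * (1/2) ^ j"
        unfolding \<open>(1/2::real) ^ (j * ?d) * 2 ^ (j * ?d) = 1\<close> by simp
      finally show ?thesis .
    qed
    finally show "(\<integral>\<^sup>+(x::'a). a j * indicator (ball 0 (2 ^ Suc j)) x \<partial>lborel) = ennreal (2 ^ ?d * ?V * (1/2) ^ j)" .
  qed
  also have "\<dots> < \<infinity>"
  proof -
    have "summable (\<lambda>j. 2 ^ ?d * ?V * (1/2) ^ j)"
      by (intro summable_mult summable_geometric) auto
    then have "(\<Sum>j. ennreal (2 ^ ?d * ?V * (1/2) ^ j)) = ennreal (\<Sum>j. 2 ^ ?d * ?V * (1/2) ^ j)"
      by (intro suminf_ennreal2) auto
    then show ?thesis by simp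
  qed
  finally show ?thesis
    by (intro integrableI_nonneg) (auto intro!: divide_nonneg_nonneg)
qed

text \<open>The decay half of the Schwartz condition, at derivatives of order zero. Kept apart from
  smoothness, it also serves functions that are merely measurable.\<close>

definition rapid :: "('a::real_normed_vector \<Rightarrow> 'b::real_normed_vector) \<Rightarrow> bool" where
  "rapid f \<longleftrightarrow> (\<forall>k. \<exists>B. \<forall>x. (1 + norm x) ^ k * norm (f x) \<le> B)"

lemma rapidE:
  assumes "rapid f"
  obtains B where "B \<ge> 0" "\<And>x. (1 + norm x) ^ k * norm (f x) \<le> B"
proof -
  obtain B where B: "\<And>x. (1 + norm x) ^ k * norm (f x) \<le> B"
    using assms unfolding rapid_def by meson
  have "0 \<le> (1 + norm (0::'a)) ^ k * norm (f 0)" by simp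
  then have "B \<ge> 0" using B[of 0] by linarith
  with B show thesis using that by blast
qed

lemma rapid_bounded:
  assumes "rapid f"
  obtains B where "\<And>x. norm (f x) \<le> B"
  using rapidE[OF assms, of 0] by (metis mult_1 power_0)

lemma rapid_divide:
  assumes "rapid f"
  obtains B where "B \<ge> 0" "\<And>x. norm (f x) \<le> B / (1 + norm x) ^ k"
proof -
  obtain B where B: "B \<ge> 0" "\<And>x. (1 + norm x) ^ k * norm (f x) \<le> B"
    using rapidE[OF assms] by metis
  have "norm (f x) \<le> B / (1 + norm x) ^ k" for x
    using B(2)[of x] by (subst pos_le_divide_eq) (auto simp: mult.commute intro!: zero_less_power add_pos_nonneg)
  with B(1) show thesis using that by blast
qed

lemma weighted_rapid_integrable:
  fixes f :: "'a::euclidean_space \<Rightarrow> 'b::{banach, second_countable_topology}"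
  assumes [measurable]: "f \<in> borel_measurable borel" and "rapid f"
  shows "integrable lborel (\<lambda>x. (1 + norm x) ^ k * norm (f x))"
proof -
  obtain B where B: "B \<ge> 0" "\<And>x. (1 + norm x) ^ (k + (DIM('a) + 1)) * norm (f x) \<le> B"
    using rapidE[OF assms(2)] by metis
  show ?thesis
  proof (rule Bochner_Integration.integrable_bound)
    show "integrable lborel (\<lambda>x::'a. B * (1 / (1 + norm x) ^ (DIM('a) + 1)))"
      by (intro integrable_mult_right integrable_weight)
    show "AE x in lborel. norm ((1 + norm x) ^ k * norm (f x)) \<le> norm (B * (1 / (1 + norm x) ^ (DIM('a) + 1)))"
    proof (rule AE_I2)
      fix x :: 'a
      have p: "0 < (1 + norm x) ^ (DIM('a) + 1)" by (intro zero_less_power add_pos_nonneg) auto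
      have "(1 + norm x) ^ k * norm (f x) * (1 + norm x) ^ (DIM('a) + 1) \<le> B"
        using B(2)[of x] by (simp add: power_add mult_ac)
      then have "(1 + norm x) ^ k * norm (f x) \<le> B / (1 + norm x) ^ (DIM('a) + 1)"
        using p by (simp only: pos_le_divide_eq)
      then show "norm ((1 + norm x) ^ k * norm (f x)) \<le> norm (B * (1 / (1 + norm x) ^ (DIM('a) + 1)))"
        using B(1) by (simp add: abs_mult)
    qed
  qed auto
qed

lemma rapid_integrable:
  fixes f :: "'a::euclidean_space \<Rightarrow> 'b::{banach, second_countable_topology}"
  assumes [measurable]: "f \<in> borel_measurable borel" and "rapid f"
  shows "integrable lborel f"
  by (rule Bochner_Integration.integrable_bound[OF weighted_rapid_integrable[OF assms, of 0]]) auto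

lemma rapid_add:
  assumes "rapid f" "rapid g" shows "rapid (\<lambda>x. f x + g x)"
  unfolding rapid_def
proof
  fix k
  obtain A B where AB: "\<And>x. (1 + norm x) ^ k * norm (f x) \<le> A" "\<And>x. (1 + norm x) ^ k * norm (g x) \<le> B"
    using assms unfolding rapid_def by meson
  have "(1 + norm x) ^ k * norm (f x + g x) \<le> A + B" for x
  proof -
    have "(1 + norm x) ^ k * norm (f x + g x) \<le> (1 + norm x) ^ k * (norm (f x) + norm (g x))"
      by (intro mult_left_mono norm_triangle_ineq) auto
    also have "\<dots> \<le> A + B" using add_mono[OF AB] by (simp add: distrib_left)
    finally show ?thesis .
  qed
  then show "\<exists>B. \<forall>x. (1 + norm x) ^ k * norm (f x + g x) \<le> B" by blast
qed

lemma rapid_bounded_linear_growth: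
  assumes "rapid f" and "\<And>x. norm (g x) \<le> C * (1 + norm x) ^ m * norm (f x)"
  shows "rapid g"
  unfolding rapid_def
proof
  fix k
  obtain A where A: "\<And>x. (1 + norm x) ^ (k + m) * norm (f x) \<le> A"
    using assms unfolding rapid_def by meson
  have "(1 + norm x) ^ k * norm (g x) \<le> \<bar>C\<bar> * A" for x
  proof -
    have "(1 + norm x) ^ k * norm (g x) \<le> (1 + norm x) ^ k * (C * (1 + norm x) ^ m * norm (f x))"
      by (intro mult_left_mono assms(2)) auto
    also have "\<dots> = C * ((1 + norm x) ^ (k + m) * norm (f x))" by (simp add: power_add)
    also have "\<dots> \<le> \<bar>C\<bar> * ((1 + norm x) ^ (k + m) * norm (f x))"
      by (intro mult_right_mono) auto
    also have "\<dots> \<le> \<bar>C\<bar> * A" by (intro mult_left_mono A) auto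
    finally show ?thesis .
  qed
  then show "\<exists>B. \<forall>x. (1 + norm x) ^ k * norm (g x) \<le> B" by blast
qed

lemma rapid_bound:
  assumes "rapid f" and "\<And>x. norm (g x) \<le> C * norm (f x)"
  shows "rapid g"
  by (rule rapid_bounded_linear_growth[OF assms(1), of _ C 0]) (use assms(2) in simp)

lemma rapid_cmult:
  fixes f :: "'a::real_normed_vector \<Rightarrow> 'b::real_normed_algebra"
  assumes "rapid f" shows "rapid (\<lambda>x. c * f x)"
  by (rule rapid_bound[OF assms, of _ "norm c"]) (simp add: norm_mult_ineq)

lemma rapid_translate:
  assumes "rapid f" shows "rapid (\<lambda>x. f (x - a))"
  unfolding rapid_def
proof
  fix k
  obtain A where A: "A \<ge> 0" "\<And>x. (1 + norm x) ^ k * norm (f x) \<le> A"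
    using rapidE[OF assms] by metis
  have "(1 + norm x) ^ k * norm (f (x - a)) \<le> (1 + norm a) ^ k * A" for x
  proof -
    have "(1 + norm x) ^ k * norm (f (x - a)) \<le> ((1 + norm a) ^ k * (1 + norm (x - a)) ^ k) * norm (f (x - a))"
      by (intro mult_right_mono weight_power_le) auto
    also have "\<dots> \<le> (1 + norm a) ^ k * A" using A(2)[of "x - a"] by (simp add: mult.assoc mult_left_mono)
    finally show ?thesis .
  qed
  then show "\<exists>B. \<forall>x. (1 + norm x) ^ k * norm (f (x - a)) \<le> B" by blast
qed

lemma rapid_scale:
  assumes "rapid f" and "t \<noteq> 0" shows "rapid (\<lambda>x. f (t *\<^sub>R x))"
  unfolding rapid_def
proof
  fix k
  define c where "c = max 1 (1 / \<bar>t\<bar>)"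
  obtain A where A: "A \<ge> 0" "\<And>x. (1 + norm x) ^ k * norm (f x) \<le> A"
    using rapidE[OF assms(1)] by metis
  have c: "c \<ge> 1" "c * \<bar>t\<bar> \<ge> 1" using assms(2) by (auto simp: c_def max_def field_simps)
  have "(1 + norm x) ^ k * norm (f (t *\<^sub>R x)) \<le> c ^ k * A" for x
  proof -
    have "1 + norm x \<le> c + c * \<bar>t\<bar> * norm x"
      using c(1) mult_right_mono[OF c(2), of "norm x"] by simp
    then have "(1 + norm x) ^ k \<le> (c * (1 + norm (t *\<^sub>R x))) ^ k"
      by (intro power_mono) (auto simp: algebra_simps)
    then have "(1 + norm x) ^ k * norm (f (t *\<^sub>R x)) \<le> (c * (1 + norm (t *\<^sub>R x))) ^ k * norm (f (t *\<^sub>R x))"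
      by (intro mult_right_mono) auto
    also have "\<dots> = c ^ k * ((1 + norm (t *\<^sub>R x)) ^ k * norm (f (t *\<^sub>R x)))"
      by (simp only: power_mult_distrib mult.assoc)
    also have "\<dots> \<le> c ^ k * A" using c(1) by (intro mult_left_mono A(2)) auto
    finally show ?thesis .
  qed
  then show "\<exists>B. \<forall>x. (1 + norm x) ^ k * norm (f (t *\<^sub>R x)) \<le> B" by blast
qed

lemma rapid_mult:
  fixes f g :: "'a::real_normed_vector \<Rightarrow> 'b::real_normed_algebra"
  assumes "rapid f" "rapid g" shows "rapid (\<lambda>x. f x * g x)"
proof -
  obtain A where A: "\<And>x. norm (f x) \<le> A"
    using rapid_bounded[OF assms(1)] by blast
  show ?thesis
    by (rule rapid_bound[OF assms(2), of _ A])
       (meson A mult_right_mono norm_ge_zero norm_mult_ineq order_trans)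
qed

section \<open>Calculus of Schwartz functions\<close>

lemma partial_deriv_eq:
  assumes "(f has_derivative f') (at x)"
  shows "partial_deriv i f x = f' (axis i 1)"
proof -
  have "((\<lambda>t. f (x + t *\<^sub>R axis i 1)) has_derivative (\<lambda>t. f' (t *\<^sub>R axis i 1))) (at 0)"
    by (rule has_derivative_compose[of "\<lambda>t. x + t *\<^sub>R axis i 1" _ 0 UNIV f f'])
       (use assms in \<open>auto intro!: derivative_eq_intros\<close>)
  moreover have "(\<lambda>t. f' (t *\<^sub>R axis i 1)) = (\<lambda>t. t *\<^sub>R f' (axis i 1))"
    using has_derivative_linear[OF assms] by (simp add: linear_cmul)
  ultimately show ?thesis
    unfolding partial_deriv_def by (intro vector_derivative_at) (simp add: has_vector_derivative_def)
qed

lemma has_derivative_partial: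
  fixes f :: "real^'n \<Rightarrow> complex"
  assumes "f differentiable (at x)"
  shows "(f has_derivative (\<lambda>h. \<Sum>i\<in>UNIV. (h $ i) *\<^sub>R partial_deriv i f x)) (at x)"
proof -
  obtain f' where f': "(f has_derivative f') (at x)" using assms by (auto simp: differentiable_def)
  have "f' h = (\<Sum>i\<in>UNIV. (h $ i) *\<^sub>R partial_deriv i f x)" for h
  proof -
    have "f' h = f' (\<Sum>i\<in>UNIV. (h $ i) *s axis i 1)" by (simp only: basis_expansion)
    also have "\<dots> = (\<Sum>i\<in>UNIV. (h $ i) *\<^sub>R f' (axis i 1))"
      using has_derivative_linear[OF f'] by (simp add: linear_sum linear_cmul scalar_mult_eq_scaleR)
    finally show ?thesis by (simp add: partial_deriv_eq[OF f'])
  qed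
  with f' show ?thesis by (metis (no_types, lifting) ext)
qed

lemma norm_gradient_le:
  fixes h :: "real^'n" and z :: "'n \<Rightarrow> complex"
  shows "norm (\<Sum>i\<in>UNIV. (h $ i) *\<^sub>R z i) \<le> norm h * (\<Sum>i\<in>UNIV. norm (z i))"
proof -
  have "norm (\<Sum>i\<in>UNIV. (h $ i) *\<^sub>R z i) \<le> (\<Sum>i\<in>UNIV. norm ((h $ i) *\<^sub>R z i))" by (rule norm_sum)
  also have "\<dots> \<le> (\<Sum>i\<in>UNIV. norm h * norm (z i))"
    by (intro sum_mono) (auto intro!: mult_right_mono component_le_norm_cart)
  finally show ?thesis by (simp add: sum_distrib_left)
qed

lemma iter_partial_Nil [simp]: "iter_partial [] f = f"
  and iter_partial_Cons: "iter_partial (i # \<alpha>) f = partial_deriv i (iter_partial \<alpha> f)"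
  and iter_partial_append: "iter_partial (\<alpha> @ \<beta>) f = iter_partial \<alpha> (iter_partial \<beta> f)"
  by (simp_all add: iter_partial_def)

lemma schwartz_iff:
  "f \<in> schwartz \<longleftrightarrow> (\<forall>\<alpha>. iter_partial \<alpha> f differentiable_on UNIV \<and> rapid (iter_partial \<alpha> f))"
  unfolding schwartz_def smooth_def rapid_def bdd_above_def by auto

text \<open>A well chosen class \<open>X\<close>, stable under first partial derivatives, replaces
  explicit formulas for iterated derivatives.\<close>

lemma schwartz_coinduct:
  assumes "f \<in> X" and "\<And>g. g \<in> X \<Longrightarrow> g differentiable_on UNIV" and "\<And>g. g \<in> X \<Longrightarrow> rapid g"
    and "\<And>g i. g \<in> X \<Longrightarrow> partial_deriv i g \<in> X"
  shows "f \<in> schwartz"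
proof -
  have "iter_partial \<alpha> f \<in> X" for \<alpha>
    by (induction \<alpha>) (auto simp: iter_partial_Cons assms)
  then show ?thesis unfolding schwartz_iff using assms by blast
qed

lemma schwartz_smooth: "f \<in> schwartz \<Longrightarrow> smooth f"
  by (simp add: schwartz_def)

lemma schwartz_differentiable: "f \<in> schwartz \<Longrightarrow> f differentiable (at x)"
  using schwartz_iff[of f] iter_partial_Nil[of f] differentiable_on_def[of f UNIV] by (metis UNIV_I)

lemma schwartz_has_derivative:
  "f \<in> schwartz \<Longrightarrow> (f has_derivative (\<lambda>h. \<Sum>i\<in>UNIV. (h $ i) *\<^sub>R partial_deriv i f x)) (at x)"
  by (intro has_derivative_partial schwartz_differentiable)

lemma schwartz_rapid: "f \<in> schwartz \<Longrightarrow> rapid f"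
  using schwartz_iff[of f] iter_partial_Nil[of f] by metis

lemma schwartz_continuous: "f \<in> schwartz \<Longrightarrow> continuous_on UNIV f"
  by (simp add: continuous_on_eq_continuous_at differentiable_imp_continuous_within schwartz_differentiable)

lemma schwartz_borel [measurable]: "f \<in> schwartz \<Longrightarrow> f \<in> borel_measurable borel"
  by (intro borel_measurable_continuous_onI schwartz_continuous)

lemma schwartz_integrable: "f \<in> schwartz \<Longrightarrow> integrable lborel f"
  by (intro rapid_integrable schwartz_borel schwartz_rapid)

lemma schwartz_iter: "f \<in> schwartz \<Longrightarrow> iter_partial \<alpha> f \<in> schwartz"
  unfolding schwartz_iff by (simp flip: iter_partial_append)

lemma schwartz_partial: "f \<in> schwartz \<Longrightarrow> partial_deriv i f \<in> schwartz"
  using schwartz_iter[of f "[i]"] by (simp add: iter_partial_Cons)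

lemma partial_deriv_linear:
  assumes "f differentiable (at x)" "g differentiable (at x)"
  shows "partial_deriv i (\<lambda>x. a * f x + b * g x) x = a * partial_deriv i f x + b * partial_deriv i g x"
proof -
  obtain f' g' where d: "(f has_derivative f') (at x)" "(g has_derivative g') (at x)"
    using assms by (auto simp: differentiable_def)
  have "((\<lambda>x. a * f x + b * g x) has_derivative (\<lambda>h. a * f' h + b * g' h)) (at x)"
    by (intro has_derivative_add has_derivative_mult_right d)
  then show ?thesis using d by (simp add: partial_deriv_eq)
qed

lemma partial_deriv_mult:
  assumes "f differentiable (at x)" "g differentiable (at x)"
  shows "partial_deriv i (\<lambda>x. f x * g x) x = f x * partial_deriv i g x + partial_deriv i f x * g x"
proof -
  obtain f' g' where d: "(f has_derivative f') (at x)" "(g has_derivative g') (at x)"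
    using assms by (auto simp: differentiable_def)
  have "((\<lambda>x. f x * g x) has_derivative (\<lambda>h. f x * g' h + f' h * g x)) (at x)"
    by (intro has_derivative_mult d)
  from partial_deriv_eq[OF this, of i] show ?thesis
    unfolding partial_deriv_eq[OF d(1)] partial_deriv_eq[OF d(2)] .
qed

lemma iter_partial_linear:
  assumes "f \<in> schwartz" "g \<in> schwartz"
  shows "iter_partial \<alpha> (\<lambda>x. a * f x + b * g x) = (\<lambda>x. a * iter_partial \<alpha> f x + b * iter_partial \<alpha> g x)"
proof (induction \<alpha>)
  case (Cons i \<alpha>)
  then show ?case unfolding iter_partial_Cons
    by (simp only:) (intro ext partial_deriv_linear schwartz_differentiable schwartz_iter assms)
qed simp

lemma schwartz_linear:
  assumes "f \<in> schwartz" "g \<in> schwartz"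
  shows "(\<lambda>x. a * f x + b * g x) \<in> schwartz"
proof (rule schwartz_coinduct[where X = "{\<lambda>x. a * f x + b * g x | f g. f \<in> schwartz \<and> g \<in> schwartz}"], goal_cases)
  case 1 then show ?case using assms by blast
next
  case (2 h)
  then obtain f g where "h = (\<lambda>x. a * f x + b * g x)" "f \<in> schwartz" "g \<in> schwartz" by blast
  then show ?case
    by (simp add: differentiable_on_def schwartz_differentiable)
next
  case (3 h)
  then obtain f g where "h = (\<lambda>x. a * f x + b * g x)" "f \<in> schwartz" "g \<in> schwartz" by blast
  then show ?case by (simp add: rapid_add rapid_cmult schwartz_rapid)
next
  case (4 h i)
  then obtain f g where h: "h = (\<lambda>x. a * f x + b * g x)" and fg: "f \<in> schwartz" "g \<in> schwartz" by blast
  have "partial_deriv i h = (\<lambda>x. a * partial_deriv i f x + b * partial_deriv i g x)"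
    unfolding h by (intro ext partial_deriv_linear schwartz_differentiable fg)
  then show ?case using schwartz_partial[OF fg(1), of i] schwartz_partial[OF fg(2), of i] by blast
qed

lemma schwartz_cmult: "f \<in> schwartz \<Longrightarrow> (\<lambda>x. a * f x) \<in> schwartz"
  using schwartz_linear[of f f a 0] by simp

lemma schwartz_diff: "f \<in> schwartz \<Longrightarrow> g \<in> schwartz \<Longrightarrow> (\<lambda>x. f x - g x) \<in> schwartz"
  using schwartz_linear[of f g 1 "-1"] by simp

lemma iter_partial_diff:
  "f \<in> schwartz \<Longrightarrow> g \<in> schwartz \<Longrightarrow>
    iter_partial \<alpha> (\<lambda>x. f x - g x) = (\<lambda>x. iter_partial \<alpha> f x - iter_partial \<alpha> g x)"
  using iter_partial_linear[of f g \<alpha> 1 "-1"] by simp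

lemma iter_partial_cmult:
  "f \<in> schwartz \<Longrightarrow> iter_partial \<alpha> (\<lambda>x. a * f x) = (\<lambda>x. a * iter_partial \<alpha> f x)"
  using iter_partial_linear[of f f \<alpha> a 0] by simp

text \<open>When \<open>X\<close> and \<open>Y\<close> are stable under partial derivatives, the
  product rule maps sums of products to sums of products. Hence \<open>schwartz_coinduct\<close>
  applies without the Leibniz formula.\<close>

inductive_set products :: "(real^'n \<Rightarrow> complex) set \<Rightarrow> (real^'n \<Rightarrow> complex) set \<Rightarrow> (real^'n \<Rightarrow> complex) set"
  for X Y where
  mult: "f \<in> X \<Longrightarrow> g \<in> Y \<Longrightarrow> (\<lambda>x. f x * g x) \<in> products X Y"
| add: "f \<in> products X Y \<Longrightarrow> g \<in> products X Y \<Longrightarrow> (\<lambda>x. f x + g x) \<in> products X Y"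

lemma products_closed:
  assumes "\<And>f i. f \<in> X \<Longrightarrow> f differentiable_on UNIV \<and> partial_deriv i f \<in> X"
    and "\<And>f i. f \<in> Y \<Longrightarrow> f differentiable_on UNIV \<and> partial_deriv i f \<in> Y"
    and "h \<in> products X Y"
  shows "h differentiable_on UNIV \<and> (\<forall>i. partial_deriv i h \<in> products X Y)"
  using assms(3)
proof induction
  case (mult f g)
  have d: "f differentiable at x" "g differentiable at x" for x
    using assms mult by (auto simp: differentiable_on_def)
  have "partial_deriv i (\<lambda>x. f x * g x) = (\<lambda>x. f x * partial_deriv i g x + partial_deriv i f x * g x)" for i
    by (intro ext partial_deriv_mult d)
  then show ?case using mult assms d
    by (auto simp: differentiable_on_def intro!: products.intros derivative_intros)
next
  case (add f g)
  then have d: "f differentiable at x" "g differentiable at x" for x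
    by (auto simp: differentiable_on_def)
  have "partial_deriv i (\<lambda>x. f x + g x) = (\<lambda>x. partial_deriv i f x + partial_deriv i g x)" for i
    using partial_deriv_linear[OF d, of i 1 1] by (auto simp: fun_eq_iff)
  then show ?case using add d
    by (auto simp: differentiable_on_def intro!: products.add derivative_intros)
qed

lemma schwartz_mult:
  assumes "f \<in> schwartz" "g \<in> schwartz"
  shows "(\<lambda>x. f x * g x) \<in> schwartz"
proof (rule schwartz_coinduct[where X = "products schwartz schwartz"])
  have c: "h differentiable_on UNIV \<and> (\<forall>i. partial_deriv i h \<in> products schwartz schwartz)"
    if "h \<in> products schwartz schwartz" for h :: "real^'n \<Rightarrow> complex"
    by (rule products_closed[OF _ _ that])
       (auto simp: differentiable_on_def schwartz_partial schwartz_differentiable)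
  show "h differentiable_on UNIV" if "h \<in> products schwartz schwartz" for h :: "real^'n \<Rightarrow> complex"
    using c[OF that] by blast
  show "partial_deriv i h \<in> products schwartz schwartz" if "h \<in> products schwartz schwartz"
    for h :: "real^'n \<Rightarrow> complex" and i
    using c[OF that] by blast
  show "rapid h" if "h \<in> products schwartz schwartz" for h :: "real^'n \<Rightarrow> complex"
    using that by induction (auto intro: rapid_mult rapid_add schwartz_rapid)
qed (auto intro: products.intros assms)

lemma schwartz_coord_mult:
  fixes f :: "real^'n \<Rightarrow> complex"
  assumes "f \<in> schwartz"
  shows "(\<lambda>x. of_real (x $ j) * f x) \<in> schwartz"
proof -
  \<comment> \<open>Constants are included because the coordinate function differentiates to a
    constant; with them the class is closed under partial derivatives.\<close>
  define X where "X = insert (\<lambda>x::real^'n. complex_of_real (x $ j)) {\<lambda>x. c | c. True}"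
  have d: "((\<lambda>x::real^'n. complex_of_real (x $ j)) has_derivative (\<lambda>h. of_real (h $ j))) (at x)" for x
    by (intro has_derivative_of_real bounded_linear_imp_has_derivative bounded_linear_vec_nth)
  have X: "f differentiable_on UNIV \<and> partial_deriv i f \<in> X" if "f \<in> X" for f i
  proof -
    have "partial_deriv i (\<lambda>x::real^'n. c) = (\<lambda>x. 0)" for c
      by (intro ext, subst partial_deriv_eq[OF has_derivative_const]) simp
    moreover have "partial_deriv i (\<lambda>x::real^'n. complex_of_real (x $ j)) = (\<lambda>x. of_real (axis i 1 $ j))"
      by (intro ext, subst partial_deriv_eq[OF d]) simp
    moreover have "(\<lambda>x::real^'n. complex_of_real (x $ j)) differentiable_on UNIV"
      unfolding differentiable_on_def differentiable_def using d by blast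
    ultimately show ?thesis using that by (auto simp: X_def)
  qed
  show ?thesis
  proof (rule schwartz_coinduct[where X = "products X schwartz"])
    have c: "h differentiable_on UNIV \<and> (\<forall>i. partial_deriv i h \<in> products X schwartz)"
      if "h \<in> products X schwartz" for h :: "real^'n \<Rightarrow> complex"
      by (rule products_closed[OF _ _ that])
         (auto simp: differentiable_on_def schwartz_partial schwartz_differentiable dest: X)
    show "h differentiable_on UNIV" if "h \<in> products X schwartz" for h :: "real^'n \<Rightarrow> complex"
      using c[OF that] by blast
    show "partial_deriv i h \<in> products X schwartz" if "h \<in> products X schwartz"
      for h :: "real^'n \<Rightarrow> complex" and i
      using c[OF that] by blast
    show "rapid h" if "h \<in> products X schwartz" for h :: "real^'n \<Rightarrow> complex"
      using that
    proof induction
      case (mult f g)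
      have "\<exists>C. \<forall>x. norm (f x) \<le> C * (1 + norm x) ^ 1"
      proof (cases "f = (\<lambda>x::real^'n. complex_of_real (x $ j))")
        case True
        have "norm (f x) \<le> 1 * (1 + norm x) ^ 1" for x
          using component_le_norm_cart[of x j] by (simp add: True)
        then show ?thesis by blast
      next
        case False
        then obtain c where "f = (\<lambda>x. c)" using mult(1) by (auto simp: X_def)
        then have "norm (f x) \<le> norm c * (1 + norm x) ^ 1" for x by (simp add: algebra_simps)
        then show ?thesis by blast
      qed
      then obtain C where C: "\<And>x. norm (f x) \<le> C * (1 + norm x) ^ 1" by blast
      show ?case
        by (rule rapid_bounded_linear_growth[OF schwartz_rapid[OF mult(2)], of _ C 1])
           (use C in \<open>auto simp: norm_mult intro!: mult_right_mono\<close>)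
    qed (auto intro: rapid_add)
  qed (auto intro!: products.intros assms simp: X_def)
qed

section \<open>Affine substitutions, conjugation and increments of Schwartz functions\<close>

lemma partial_deriv_affine:
  fixes f :: "real^'n \<Rightarrow> complex"
  assumes "f differentiable (at (t *\<^sub>R x - a))"
  shows "partial_deriv i (\<lambda>x. f (t *\<^sub>R x - a)) x = of_real t * partial_deriv i f (t *\<^sub>R x - a)"
proof -
  obtain f' where f': "(f has_derivative f') (at (t *\<^sub>R x - a))" using assms by (auto simp: differentiable_def)
  have "((\<lambda>x. f (t *\<^sub>R x - a)) has_derivative (\<lambda>h. f' (t *\<^sub>R h))) (at x)"
    by (rule has_derivative_compose[of "\<lambda>x. t *\<^sub>R x - a"]) (use f' in \<open>auto intro!: derivative_eq_intros\<close>)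
  from partial_deriv_eq[OF this, of i] show ?thesis
    unfolding linear_cmul[OF has_derivative_linear[OF f']] partial_deriv_eq[OF f']
    by (simp only: scaleR_conv_of_real)
qed

lemma iter_partial_affine:
  assumes "f \<in> schwartz"
  shows "iter_partial \<alpha> (\<lambda>x. f (t *\<^sub>R x - a)) = (\<lambda>x. of_real t ^ length \<alpha> * iter_partial \<alpha> f (t *\<^sub>R x - a))"
proof (induction \<alpha>)
  case (Cons i \<alpha>)
  have s: "iter_partial \<alpha> f \<in> schwartz" using assms by (rule schwartz_iter)
  have d: "(\<lambda>x. iter_partial \<alpha> f (t *\<^sub>R x - a)) differentiable (at x)" for x
  proof (rule differentiable_chain_at[of "\<lambda>x. t *\<^sub>R x - a" x, unfolded o_def])
    show "(\<lambda>x. t *\<^sub>R x - a) differentiable (at x)" by (auto intro!: derivative_intros)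
  qed (rule schwartz_differentiable[OF s])
  show ?case
  proof
    fix x
    \<comment> \<open>The vanishing second summand gives the expression the shape of
      \<open>partial_deriv_linear\<close>.\<close>
    have "iter_partial (i # \<alpha>) (\<lambda>x. f (t *\<^sub>R x - a)) x
        = partial_deriv i (\<lambda>x. of_real t ^ length \<alpha> * iter_partial \<alpha> f (t *\<^sub>R x - a)
            + 0 * iter_partial \<alpha> f (t *\<^sub>R x - a)) x"
      by (simp add: iter_partial_Cons Cons)
    also have "\<dots> = of_real t ^ length \<alpha> * partial_deriv i (\<lambda>x. iter_partial \<alpha> f (t *\<^sub>R x - a)) x"
      by (subst partial_deriv_linear[OF d d]) simp
    also have "\<dots> = of_real t ^ length (i # \<alpha>) * iter_partial (i # \<alpha>) f (t *\<^sub>R x - a)"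
      by (subst partial_deriv_affine[OF schwartz_differentiable[OF s]]) (simp add: iter_partial_Cons)
    finally show "iter_partial (i # \<alpha>) (\<lambda>x. f (t *\<^sub>R x - a)) x
        = of_real t ^ length (i # \<alpha>) * iter_partial (i # \<alpha>) f (t *\<^sub>R x - a)" .
  qed
qed simp

lemma schwartz_affine:
  fixes f :: "real^'n \<Rightarrow> complex"
  assumes "f \<in> schwartz" "t \<noteq> 0"
  shows "(\<lambda>x. f (t *\<^sub>R x - a)) \<in> schwartz"
  unfolding schwartz_iff iter_partial_affine[OF assms(1)]
proof (intro allI conjI)
  fix \<alpha> :: "'n list"
  let ?g = "iter_partial \<alpha> f"
  have s: "?g \<in> schwartz" using assms(1) by (rule schwartz_iter)
  have d: "(\<lambda>x. ?g (t *\<^sub>R x - a)) differentiable (at x)" for x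
  proof (rule differentiable_chain_at[of "\<lambda>x. t *\<^sub>R x - a" x, unfolded o_def])
    show "(\<lambda>x. t *\<^sub>R x - a) differentiable (at x)" by (auto intro!: derivative_intros)
  qed (rule schwartz_differentiable[OF s])
  show "(\<lambda>x. of_real t ^ length \<alpha> * ?g (t *\<^sub>R x - a)) differentiable_on UNIV"
    using d by (auto simp: differentiable_on_def intro!: derivative_intros)
  show "rapid (\<lambda>x. of_real t ^ length \<alpha> * ?g (t *\<^sub>R x - a))"
    using rapid_scale[OF rapid_translate[OF schwartz_rapid[OF s], of a] assms(2)] by (rule rapid_cmult)
qed

lemma schwartz_translate:
  fixes f :: "real^'n \<Rightarrow> complex"
  shows "f \<in> schwartz \<Longrightarrow> (\<lambda>x. f (x - a)) \<in> schwartz"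
  using schwartz_affine[of f 1 a] by simp

lemma iter_partial_translate:
  "f \<in> schwartz \<Longrightarrow> iter_partial \<alpha> (\<lambda>x. f (x - a)) = (\<lambda>x. iter_partial \<alpha> f (x - a))"
  using iter_partial_affine[of f \<alpha> 1 a] by simp

lemma schwartz_scale:
  fixes f :: "real^'n \<Rightarrow> complex"
  shows "f \<in> schwartz \<Longrightarrow> t \<noteq> 0 \<Longrightarrow> (\<lambda>x. f (t *\<^sub>R x)) \<in> schwartz"
  using schwartz_affine[of f t 0] by simp

lemma partial_deriv_cnj:
  assumes "f differentiable (at x)"
  shows "partial_deriv i (\<lambda>x. cnj (f x)) x = cnj (partial_deriv i f x)"
proof -
  obtain f' where d: "(f has_derivative f') (at x)" using assms by (auto simp: differentiable_def)
  from partial_deriv_eq[OF has_derivative_cnj[OF d]] d show ?thesis by (simp add: partial_deriv_eq)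
qed

lemma schwartz_cnj:
  assumes "f \<in> schwartz"
  shows "(\<lambda>x. cnj (f x)) \<in> schwartz"
proof (rule schwartz_coinduct[where X = "{\<lambda>x. cnj (f x) | f. f \<in> schwartz}"], goal_cases)
  case 1 then show ?case using assms by blast
next
  case (2 h) then obtain f where "h = (\<lambda>x. cnj (f x))" "f \<in> schwartz" by blast
  then show ?case unfolding differentiable_on_def differentiable_def
    using has_derivative_cnj[OF schwartz_has_derivative[of f]] by blast
next
  case (3 h) then obtain f where "h = (\<lambda>x. cnj (f x))" "f \<in> schwartz" by blast
  then show ?case using rapid_bound[OF schwartz_rapid[of f], of h 1] by simp
next
  case (4 h i)
  then obtain f where h: "h = (\<lambda>x. cnj (f x))" and f: "f \<in> schwartz" by blast
  have "partial_deriv i h = (\<lambda>x. cnj (partial_deriv i f x))"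
    unfolding h by (intro ext partial_deriv_cnj schwartz_differentiable f)
  then show ?case using schwartz_partial[OF f, of i] by blast
qed

text \<open>The mean value inequality on the segment from \<open>x\<close> to \<open>y\<close>. The
  gradient decays in terms of the intermediate point \<open>z\<close>; expressing this decay through
  \<open>x\<close> costs \<open>(1 + norm (x - z)) ^ k\<close>, which is at most
  \<open>(1 + norm (y - x)) ^ k\<close>. Convergence of translates, of discretised convolutions and
  of approximate identities reduces to this bound.\<close>

lemma schwartz_increment_bound:
  fixes f :: "real^'n \<Rightarrow> complex"
  assumes "f \<in> schwartz"
  obtains B where "B \<ge> 0"
    "\<And>x y. (1 + norm x) ^ k * norm (f y - f x) \<le> B * norm (y - x) * (1 + norm (y - x)) ^ k"
proof -
  have "\<forall>i. \<exists>B\<ge>0. \<forall>x. (1 + norm x) ^ k * norm (partial_deriv i f x) \<le> B"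
    using rapidE[OF schwartz_rapid[OF schwartz_partial[OF assms]], of k] by metis
  then obtain b where b: "\<And>i. b i \<ge> 0" "\<And>i x. (1 + norm x) ^ k * norm (partial_deriv i f x) \<le> b i"
    by metis
  define B where "B = (\<Sum>i\<in>UNIV. b i)"
  have "(1 + norm x) ^ k * norm (f y - f x) \<le> B * norm (y - x) * (1 + norm (y - x)) ^ k" for x y
  proof -
    let ?C = "B * (1 + norm (y - x)) ^ k / (1 + norm x) ^ k"
    have pos: "0 < (1 + norm x) ^ k" by (intro zero_less_power add_pos_nonneg) auto
    have "norm (f y - f x) \<le> ?C * norm (y - x)"
    proof (rule differentiable_bound)
      show "convex (closed_segment x y)" by simp
      show "(f has_derivative (\<lambda>h. \<Sum>i\<in>UNIV. (h $ i) *\<^sub>R partial_deriv i f z)) (at z within closed_segment x y)" for z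
        using schwartz_has_derivative[OF assms] by (rule has_derivative_at_withinI)
      show "onorm (\<lambda>h. \<Sum>i\<in>UNIV. (h $ i) *\<^sub>R partial_deriv i f z) \<le> ?C" if z: "z \<in> closed_segment x y" for z
      proof (rule onorm_bound)
        show "0 \<le> ?C" using b by (auto simp: B_def intro!: divide_nonneg_nonneg mult_nonneg_nonneg sum_nonneg)
        fix h :: "real^'n"
        have nz: "norm (x - z) \<le> norm (y - x)"
          using segment_bound(1)[OF z] by (simp add: norm_minus_commute)
        have "(1 + norm x) ^ k * (\<Sum>i\<in>UNIV. norm (partial_deriv i f z))
            \<le> ((1 + norm z) ^ k * (1 + norm (x - z)) ^ k) * (\<Sum>i\<in>UNIV. norm (partial_deriv i f z))"
          by (intro mult_right_mono weight_power_le sum_nonneg) auto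
        also have "\<dots> = (1 + norm (x - z)) ^ k * (\<Sum>i\<in>UNIV. (1 + norm z) ^ k * norm (partial_deriv i f z))"
          by (simp only: mult.assoc mult.left_commute flip: sum_distrib_left)
        also have "\<dots> \<le> (1 + norm (y - x)) ^ k * B"
          unfolding B_def using b nz by (intro mult_mono sum_mono power_mono sum_nonneg) auto
        finally have "(\<Sum>i\<in>UNIV. norm (partial_deriv i f z)) \<le> ?C"
          using pos by (simp add: pos_le_divide_eq mult_ac)
        then have "norm h * (\<Sum>i\<in>UNIV. norm (partial_deriv i f z)) \<le> ?C * norm h"
          by (metis mult.commute mult_left_mono norm_ge_zero)
        then show "norm (\<Sum>i\<in>UNIV. (h $ i) *\<^sub>R partial_deriv i f z) \<le> ?C * norm h"
          using norm_gradient_le[of h "\<lambda>i. partial_deriv i f z"] by linarith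
      qed
    qed auto
    then show ?thesis using pos by (simp add: field_simps)
  qed
  moreover have "B \<ge> 0" unfolding B_def by (intro sum_nonneg b)
  ultimately show thesis using that by blast
qed

section \<open>Convolutions\<close>

lemma lborel_integral_affine:
  fixes f :: "'a::euclidean_space \<Rightarrow> 'b::{banach, second_countable_topology}"
  assumes [measurable]: "f \<in> borel_measurable borel" and t: "t \<noteq> 0"
  shows "integral\<^sup>L lborel f = \<bar>t\<bar> ^ DIM('a) *\<^sub>R (\<integral>x. f (a + t *\<^sub>R x) \<partial>lborel)"
proof -
  have "integral\<^sup>L lborel f = integral\<^sup>L (density (distr lborel borel (\<lambda>x. a + t *\<^sub>R x)) (\<lambda>_. \<bar>t\<bar> ^ DIM('a))) f"
    using lborel_affine[OF t, of a] by simp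
  also have "\<dots> = (\<integral>x. \<bar>t\<bar> ^ DIM('a) *\<^sub>R f x \<partial>distr lborel borel (\<lambda>x. a + t *\<^sub>R x))"
    by (rule integral_density) auto
  also have "\<dots> = (\<integral>x. \<bar>t\<bar> ^ DIM('a) *\<^sub>R f (a + t *\<^sub>R x) \<partial>lborel)"
    by (rule integral_distr) auto
  finally show ?thesis by simp
qed

lemma lborel_integral_reflect:
  fixes f :: "'a::euclidean_space \<Rightarrow> 'b::{banach, second_countable_topology}"
  assumes "f \<in> borel_measurable borel"
  shows "(\<integral>x. f (a - x) \<partial>lborel) = integral\<^sup>L lborel f"
  using lborel_integral_affine[OF assms, of "-1" a] by simp

lemma lborel_integral_translate:
  fixes f :: "'a::euclidean_space \<Rightarrow> 'b::{banach, second_countable_topology}"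
  assumes "f \<in> borel_measurable borel"
  shows "(\<integral>x. f (x - a) \<partial>lborel) = integral\<^sup>L lborel f"
  using lborel_integral_affine[OF assms, of 1 "-a"] by simp

lemma norm_integral_le:
  fixes f :: "'a \<Rightarrow> 'b::{banach, second_countable_topology}"
  assumes "f \<in> borel_measurable M" "integrable M g" "\<And>x. norm (f x) \<le> g x"
  shows "norm (integral\<^sup>L M f) \<le> integral\<^sup>L M g"
proof -
  have "integrable M f"
    by (rule Bochner_Integration.integrable_bound[OF assms(2,1)]) (auto intro!: AE_I2 order_trans[OF assms(3)])
  then have "(\<integral>x. norm (f x) \<partial>M) \<le> integral\<^sup>L M g"
    by (intro integral_mono assms integrable_norm)
  then show ?thesis using integral_norm_bound[of M f] by linarith
qed

text \<open>Dominated convergence for the remainder quotients. By the mean value inequality the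
  bound on the derivative also bounds the increments of \<open>F\<close> by
  \<open>w y * norm h\<close>; the remainder is an increment minus a linear term, so its quotient is
  at most \<open>2 * w y\<close>. The limit is tested on sequences because dominated convergence is
  a statement about sequences.\<close>

lemma has_derivative_integral:
  fixes F :: "'a::real_normed_vector \<Rightarrow> 'b \<Rightarrow> 'c::{banach, second_countable_topology}"
  assumes der: "\<And>x y. ((\<lambda>x. F x y) has_derivative F' x y) (at x)"
    and int: "\<And>x. integrable M (F x)" and meas: "\<And>h. (\<lambda>y. F' x0 y h) \<in> borel_measurable M"
    and bound: "\<And>x y h. norm (F' x y h) \<le> w y * norm h" and w: "integrable M w" "\<And>y. 0 \<le> w y"
  shows "((\<lambda>x. \<integral>y. F x y \<partial>M) has_derivative (\<lambda>h. \<integral>y. F' x0 y h \<partial>M)) (at x0)"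
proof -
  have int': "integrable M (\<lambda>y. F' x0 y h)" for h
    by (rule Bochner_Integration.integrable_bound[OF integrable_mult_left[OF w(1), of "norm h"] meas])
       (auto simp: intro!: AE_I2 order_trans[OF bound])
  have lin: "linear (F' x0 y)" for y by (rule has_derivative_linear[OF der])
  show ?thesis unfolding has_derivative_at
  proof
    show "bounded_linear (\<lambda>h. \<integral>y. F' x0 y h \<partial>M)"
    proof (rule bounded_linear_intro[of _ "integral\<^sup>L M w"])
      fix h
      have "norm (\<integral>y. F' x0 y h \<partial>M) \<le> (\<integral>y. norm (F' x0 y h) \<partial>M)" by (rule integral_norm_bound)
      also have "\<dots> \<le> (\<integral>y. w y * norm h \<partial>M)"
        by (intro integral_mono integrable_norm int' integrable_mult_left w(1) bound)
      finally show "norm (\<integral>y. F' x0 y h \<partial>M) \<le> norm h * integral\<^sup>L M w" by (simp add: mult.commute)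
    qed (simp_all add: linear_add[OF lin] linear_cmul[OF lin] int')
    have mv: "norm (F (x0 + h) y - F x0 y) \<le> w y * norm h" for h y
    proof -
      have "onorm (F' x y) \<le> w y" for x by (rule onorm_bound[OF w(2) bound])
      then show ?thesis
        using differentiable_bound[of UNIV "\<lambda>x. F x y" "\<lambda>x. F' x y" "w y" "x0 + h" x0] der[of y] by simp
    qed
    show "((\<lambda>h. norm ((\<integral>y. F (x0 + h) y \<partial>M) - (\<integral>y. F x0 y \<partial>M) - (\<integral>y. F' x0 y h \<partial>M)) / norm h) \<longlongrightarrow> 0) (at 0)"
      unfolding tendsto_at_iff_sequentially o_def
    proof (intro allI impI)
      fix h :: "nat \<Rightarrow> 'a" assume h: "\<forall>n. h n \<in> UNIV - {0}" and h0: "h \<longlonglongrightarrow> 0"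
      define r where "r n y = norm (F (x0 + h n) y - F x0 y - F' x0 y (h n)) / norm (h n)" for n y
      have "(\<lambda>n. integral\<^sup>L M (r n)) \<longlonglongrightarrow> integral\<^sup>L M (\<lambda>y. 0)"
      proof (rule integral_dominated_convergence[where w = "\<lambda>y. 2 * w y"])
        show "r n \<in> borel_measurable M" for n
          unfolding r_def using int int' by (auto intro!: borel_measurable_divide)
        show "integrable M (\<lambda>y. 2 * w y)" using w(1) by simp
        show "AE y in M. (\<lambda>n. r n y) \<longlonglongrightarrow> 0"
        proof (rule AE_I2)
          fix y
          have "((\<lambda>h. norm (F (x0 + h) y - F x0 y - F' x0 y h) / norm h) \<longlongrightarrow> 0) (at 0)"
            using der[of y x0] unfolding has_derivative_at by blast
          then show "(\<lambda>n. r n y) \<longlonglongrightarrow> 0"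
            using h h0 unfolding tendsto_at_iff_sequentially o_def r_def by blast
        qed
        show "AE y in M. norm (r n y) \<le> 2 * w y" for n
        proof (rule AE_I2)
          fix y
          have "norm (F (x0 + h n) y - F x0 y - F' x0 y (h n)) \<le> w y * norm (h n) + w y * norm (h n)"
            by (rule order_trans[OF norm_triangle_ineq4 add_mono[OF mv bound]])
          then show "norm (r n y) \<le> 2 * w y" using h by (simp add: r_def divide_le_eq)
        qed
      qed auto
      then have lim: "(\<lambda>n. integral\<^sup>L M (r n)) \<longlonglongrightarrow> 0" by simp
      show "(\<lambda>n. norm ((\<integral>y. F (x0 + h n) y \<partial>M) - (\<integral>y. F x0 y \<partial>M) - (\<integral>y. F' x0 y (h n) \<partial>M)) / norm (h n)) \<longlonglongrightarrow> 0"
      proof (rule tendsto_sandwich[OF _ _ tendsto_const lim])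
        show "\<forall>\<^sub>F n in sequentially. norm ((\<integral>y. F (x0 + h n) y \<partial>M) - (\<integral>y. F x0 y \<partial>M) - (\<integral>y. F' x0 y (h n) \<partial>M)) / norm (h n) \<le> integral\<^sup>L M (r n)"
        proof (rule always_eventually, rule)
          fix n
          have "norm ((\<integral>y. F (x0 + h n) y \<partial>M) - (\<integral>y. F x0 y \<partial>M) - (\<integral>y. F' x0 y (h n) \<partial>M))
              = norm (\<integral>y. F (x0 + h n) y - F x0 y - F' x0 y (h n) \<partial>M)"
            by (simp add: int int')
          also have "\<dots> \<le> (\<integral>y. norm (F (x0 + h n) y - F x0 y - F' x0 y (h n)) \<partial>M)"
            by (rule integral_norm_bound)
          finally show "norm ((\<integral>y. F (x0 + h n) y \<partial>M) - (\<integral>y. F x0 y \<partial>M) - (\<integral>y. F' x0 y (h n) \<partial>M)) / norm (h n) \<le> integral\<^sup>L M (r n)"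
            unfolding r_def by (simp add: divide_right_mono)
        qed
      qed (auto intro: always_eventually)
    qed
  qed
qed

section \<open>Convolution with a Schwartz kernel\<close>

definition conv :: "(real^'n \<Rightarrow> complex) \<Rightarrow> (real^'n \<Rightarrow> complex) \<Rightarrow> real^'n \<Rightarrow> complex" where
  "conv k \<psi> x = (\<integral>y. k (x - y) * \<psi> y \<partial>lborel)"

lemma conv_commute:
  assumes [measurable]: "k \<in> borel_measurable borel" "\<psi> \<in> borel_measurable borel"
  shows "conv k \<psi> = conv \<psi> k"
proof
  fix x
  have "conv k \<psi> x = (\<integral>y. (\<lambda>z. \<psi> z * k (x - z)) (x - (x - y)) \<partial>lborel)"
    by (simp add: conv_def mult.commute)
  also have "\<dots> = (\<integral>y. (\<lambda>z. \<psi> (x - z) * k z) (x - y) \<partial>lborel)" by simp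
  also have "\<dots> = (\<integral>z. \<psi> (x - z) * k z \<partial>lborel)"
    by (rule lborel_integral_reflect) measurable
  finally show "conv k \<psi> x = conv \<psi> k x" by (simp add: conv_def)
qed

lemma sum_axis_scaleR: "(\<Sum>j\<in>UNIV. (axis i (1::real) $ j) *\<^sub>R z j) = (z i :: complex)"
  by (simp add: axis_def if_distrib[of "\<lambda>r. r *\<^sub>R _"] sum.delta cong: if_cong)

lemma schwartz_conv_integrable:
  assumes "k \<in> schwartz" and "integrable lborel \<psi>"
  shows "integrable lborel (\<lambda>y. k (x - y) * \<psi> y)"
proof -
  have [measurable]: "k \<in> borel_measurable borel" "\<psi> \<in> borel_measurable borel"
    using assms schwartz_borel by auto
  obtain A where A: "\<And>x. norm (k x) \<le> A"
    using rapid_bounded[OF schwartz_rapid[OF assms(1)]] by blast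
  show ?thesis
    by (rule Bochner_Integration.integrable_bound[where f = "\<lambda>y. A * norm (\<psi> y)"])
       (use assms(2) A in \<open>auto simp: norm_mult abs_mult intro!: mult_right_mono order_trans[OF A]\<close>)
qed

lemma has_derivative_conv:
  assumes k: "k \<in> schwartz" and \<psi>: "integrable lborel \<psi>"
  shows "(conv k \<psi> has_derivative (\<lambda>h. \<integral>y. (\<Sum>i\<in>UNIV. (h $ i) *\<^sub>R partial_deriv i k (x - y)) * \<psi> y \<partial>lborel)) (at x)"
proof -
  have "\<forall>i. \<exists>A. \<forall>x. norm (partial_deriv i k x) \<le> A"
    using schwartz_rapid[OF schwartz_partial[OF k]] unfolding rapid_def by (metis mult_1 power_0)
  then obtain A where A: "\<And>i x. norm (partial_deriv i k x) \<le> A i" by metis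
  then have A0: "0 \<le> A i" for i using norm_ge_zero order_trans by blast
  show ?thesis
  unfolding conv_def[abs_def]
proof (rule has_derivative_integral[where F' = "\<lambda>x y h. (\<Sum>i\<in>UNIV. (h $ i) *\<^sub>R partial_deriv i k (x - y)) * \<psi> y"])
  show "0 \<le> (\<Sum>i\<in>UNIV. A i) * norm (\<psi> y)" for y by (intro mult_nonneg_nonneg sum_nonneg A0) auto
  show "norm ((\<Sum>i\<in>UNIV. (h $ i) *\<^sub>R partial_deriv i k (x - y)) * \<psi> y) \<le> (\<Sum>i\<in>UNIV. A i) * norm (\<psi> y) * norm h" for h x y
  proof -
    have "norm (\<Sum>i\<in>UNIV. (h $ i) *\<^sub>R partial_deriv i k (x - y)) \<le> norm h * (\<Sum>i\<in>UNIV. A i)"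
      using norm_gradient_le[of h "\<lambda>i. partial_deriv i k (x - y)"]
      by (rule order_trans) (auto intro!: mult_left_mono sum_mono A)
    then have "norm (\<Sum>i\<in>UNIV. (h $ i) *\<^sub>R partial_deriv i k (x - y)) * norm (\<psi> y) \<le> norm h * (\<Sum>i\<in>UNIV. A i) * norm (\<psi> y)"
      by (intro mult_right_mono) auto
    then show ?thesis by (simp add: norm_mult mult_ac)
  qed
  show "integrable lborel (\<lambda>y. (\<Sum>i\<in>UNIV. A i) * norm (\<psi> y))" using \<psi> by simp
  have [measurable]: "partial_deriv i k \<in> borel_measurable borel" "\<psi> \<in> borel_measurable borel" for i
    using schwartz_borel[OF schwartz_partial[OF k]] \<psi> by auto
  show "(\<lambda>y. (\<Sum>i\<in>UNIV. (h $ i) *\<^sub>R partial_deriv i k (x - y)) * \<psi> y) \<in> borel_measurable lborel" for h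
    by measurable
  show "((\<lambda>x. k (x - y) * \<psi> y) has_derivative (\<lambda>h. (\<Sum>i\<in>UNIV. (h $ i) *\<^sub>R partial_deriv i k (x - y)) * \<psi> y)) (at x)" for x y
  proof (rule has_derivative_mult_left)
    have "((\<lambda>x. x - y) has_derivative (\<lambda>h. h)) (at x)" by (auto intro!: derivative_eq_intros)
    from has_derivative_compose[OF this, of k] schwartz_has_derivative[OF k, of "x - y"]
    show "((\<lambda>x. k (x - y)) has_derivative (\<lambda>h. \<Sum>i\<in>UNIV. (h $ i) *\<^sub>R partial_deriv i k (x - y))) (at x)" by blast
  qed
qed (rule schwartz_conv_integrable[OF assms])
qed

lemma iter_partial_conv:
  assumes k: "k \<in> schwartz" and \<psi>: "integrable lborel \<psi>"
  shows "iter_partial \<alpha> (conv k \<psi>) = conv (iter_partial \<alpha> k) \<psi>"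
proof (induction \<alpha>)
  case (Cons i \<alpha>)
  show ?case unfolding iter_partial_Cons Cons
    by (intro ext, subst partial_deriv_eq[OF has_derivative_conv[OF schwartz_iter[OF k] \<psi>]])
       (simp only: sum_axis_scaleR conv_def)
qed simp

text \<open>Peetre's inequality splits the weight at \<open>x\<close> into one at
  \<open>x - y\<close>, absorbed by the decay of \<open>k\<close>, and one at \<open>y\<close>,
  absorbed by the integrable product with \<open>\<psi>\<close>.\<close>

lemma rapid_conv:
  assumes [measurable]: "k \<in> borel_measurable borel" "\<psi> \<in> borel_measurable borel"
    and "rapid k" "rapid \<psi>"
  shows "rapid (conv k \<psi>)"
  unfolding rapid_def
proof
  fix m
  obtain A where A: "A \<ge> 0" "\<And>x. (1 + norm x) ^ m * norm (k x) \<le> A" using rapidE[OF assms(3)] by metis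
  note w = weighted_rapid_integrable[OF assms(2,4), of m]
  have "(1 + norm x) ^ m * norm (conv k \<psi> x) \<le> (\<integral>y. A * ((1 + norm y) ^ m * norm (\<psi> y)) \<partial>lborel)" for x
  proof -
    have "(1 + norm x) ^ m * norm (conv k \<psi> x) = norm (\<integral>y. of_real ((1 + norm x) ^ m) * (k (x - y) * \<psi> y) \<partial>lborel)"
      unfolding conv_def by (simp only: integral_mult_right_zero norm_mult norm_of_real) simp
    also have "\<dots> \<le> (\<integral>y. A * ((1 + norm y) ^ m * norm (\<psi> y)) \<partial>lborel)"
    proof (rule norm_integral_le)
      show "integrable lborel (\<lambda>y. A * ((1 + norm y) ^ m * norm (\<psi> y)))" using w by simp
      show "(\<lambda>y. of_real ((1 + norm x) ^ m) * (k (x - y) * \<psi> y)) \<in> borel_measurable lborel" by measurable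
      fix y
        have "(1 + norm x) ^ m * (norm (k (x - y)) * norm (\<psi> y))
            \<le> ((1 + norm y) ^ m * (1 + norm (x - y)) ^ m) * (norm (k (x - y)) * norm (\<psi> y))"
          by (intro mult_right_mono weight_power_le) auto
        also have "\<dots> = ((1 + norm (x - y)) ^ m * norm (k (x - y))) * ((1 + norm y) ^ m * norm (\<psi> y))"
          by (simp only: mult_ac)
        also have "\<dots> \<le> A * ((1 + norm y) ^ m * norm (\<psi> y))" by (intro mult_right_mono A) auto
        finally show "norm (of_real ((1 + norm x) ^ m) * (k (x - y) * \<psi> y)) \<le> A * ((1 + norm y) ^ m * norm (\<psi> y))"
          by (simp only: norm_mult norm_of_real) simp
    qed
    finally show ?thesis .
  qed
  then show "\<exists>B. \<forall>x. (1 + norm x) ^ m * norm (conv k \<psi> x) \<le> B" by blast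
qed

text \<open>All derivatives of the convolution fall on \<open>k\<close>, so \<open>\<psi>\<close>
  contributes decay only.\<close>

lemma schwartz_conv:
  assumes k: "k \<in> schwartz" and \<psi>: "\<psi> \<in> borel_measurable borel" "rapid \<psi>"
  shows "conv k \<psi> \<in> schwartz"
  unfolding schwartz_iff
proof (intro allI conjI)
  fix \<alpha> :: "'a list"
  note i = iter_partial_conv[OF k rapid_integrable[OF \<psi>], of \<alpha>]
  note s = schwartz_iter[OF k, of \<alpha>]
  show "iter_partial \<alpha> (conv k \<psi>) differentiable_on UNIV" unfolding i
    using has_derivative_conv[OF s rapid_integrable[OF \<psi>]] by (auto simp: differentiable_on_def differentiable_def)
  show "rapid (iter_partial \<alpha> (conv k \<psi>))" unfolding i
    by (intro rapid_conv schwartz_borel schwartz_rapid s \<psi>)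
qed

section \<open>Tempered distributions\<close>

lemma schwartz_tendstoI:
  assumes "\<And>n. \<psi> n \<in> schwartz" "\<eta> \<in> schwartz"
    and "\<And>k \<alpha>. \<exists>e. e \<longlonglongrightarrow> 0 \<and> (\<forall>n x. (1 + norm x) ^ k * norm (iter_partial \<alpha> (\<psi> n) x - iter_partial \<alpha> \<eta> x) \<le> e n)"
  shows "schwartz_tendsto \<psi> \<eta>"
  unfolding schwartz_tendsto_def
proof (intro allI)
  fix k \<alpha>
  obtain e where e: "e \<longlonglongrightarrow> 0" "\<And>n x. (1 + norm x) ^ k * norm (iter_partial \<alpha> (\<psi> n) x - iter_partial \<alpha> \<eta> x) \<le> e n"
    using assms(3) by metis
  show "(\<lambda>n. schwartz_seminorm k \<alpha> (\<lambda>x. \<psi> n x - \<eta> x)) \<longlonglongrightarrow> 0"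
  proof (rule tendsto_sandwich[OF _ _ tendsto_const e(1)])
    show "\<forall>\<^sub>F n in sequentially. schwartz_seminorm k \<alpha> (\<lambda>x. \<psi> n x - \<eta> x) \<le> e n"
      unfolding schwartz_seminorm_def iter_partial_diff[OF assms(1,2)]
      by (intro always_eventually allI cSUP_least e(2)) auto
    have "0 \<le> schwartz_seminorm k \<alpha> (\<lambda>x. \<psi> n x - \<eta> x)" for n
      unfolding schwartz_seminorm_def iter_partial_diff[OF assms(1,2)]
      by (rule cSUP_upper2[where x = 0]) (auto simp: bdd_above_def intro!: exI[of _ "e n"] e(2))
    then show "\<forall>\<^sub>F n in sequentially. 0 \<le> schwartz_seminorm k \<alpha> (\<lambda>x. \<psi> n x - \<eta> x)"
      by (intro always_eventually) auto
  qed
qed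

lemma tempered_tendsto:
  assumes "T \<in> tempered_distributions" and "\<And>n. \<psi> n \<in> schwartz" "\<eta> \<in> schwartz"
    and "\<And>k \<alpha>. \<exists>e. e \<longlonglongrightarrow> 0 \<and> (\<forall>n x. (1 + norm x) ^ k * norm (iter_partial \<alpha> (\<psi> n) x - iter_partial \<alpha> \<eta> x) \<le> e n)"
  shows "(\<lambda>n. T (\<psi> n)) \<longlonglongrightarrow> T \<eta>"
  using assms(1) schwartz_tendstoI[OF assms(2-4)] assms(2,3) unfolding tempered_distributions_def by blast

lemma tempered_linear:
  assumes "T \<in> tempered_distributions" "\<psi> \<in> schwartz" "\<eta> \<in> schwartz"
  shows "T (\<lambda>x. a * \<psi> x + b * \<eta> x) = a * T \<psi> + b * T \<eta>"
  using assms unfolding tempered_distributions_def by blast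

lemma schwartz_zero [simp]: "(\<lambda>x. 0) \<in> schwartz"
proof (rule schwartz_coinduct[of _ "{\<lambda>x. 0}"])
  show "partial_deriv i g \<in> {\<lambda>x. 0}" if "g \<in> {\<lambda>x. 0}" for g i
  proof -
    have "partial_deriv i (\<lambda>x::real^'b. 0) = (\<lambda>x. 0)"
      by (intro ext, subst partial_deriv_eq[OF has_derivative_const]) simp
    then show ?thesis using that by simp
  qed
qed (auto simp: rapid_def differentiable_on_def)

lemma schwartz_sum:
  assumes "finite A" "\<And>i. i \<in> A \<Longrightarrow> f i \<in> schwartz"
  shows "(\<lambda>x. \<Sum>i\<in>A. c i * f i x) \<in> schwartz"
  using assms
proof (induction A)
  case (insert i A)
  then show ?case using schwartz_linear[of "f i" "\<lambda>x. \<Sum>i\<in>A. c i * f i x" "c i" 1] by simp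
qed simp

lemma tempered_cmult:
  assumes "T \<in> tempered_distributions" "\<psi> \<in> schwartz"
  shows "T (\<lambda>x. a * \<psi> x) = a * T \<psi>"
  using tempered_linear[OF assms assms(2), of a 0] by simp

lemma tempered_diff:
  assumes "T \<in> tempered_distributions" "\<psi> \<in> schwartz" "\<eta> \<in> schwartz"
  shows "T (\<lambda>x. \<psi> x - \<eta> x) = T \<psi> - T \<eta>"
  using tempered_linear[OF assms, of 1 "-1"] by simp

lemma tempered_sum:
  assumes T: "T \<in> tempered_distributions" and "finite A" "\<And>i. i \<in> A \<Longrightarrow> f i \<in> schwartz"
  shows "T (\<lambda>x. \<Sum>i\<in>A. c i * f i x) = (\<Sum>i\<in>A. c i * T (f i))"
  using assms(2,3)
proof (induction A)
  case empty
  then show ?case using tempered_cmult[OF T schwartz_zero, of 0] by simp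
next
  case (insert i A)
  then show ?case
    using tempered_linear[OF T, of "f i" "\<lambda>x. \<Sum>i\<in>A. c i * f i x" "c i" 1] schwartz_sum[of A f c] by simp
qed

section \<open>Tempered distributions on translates, convolutions and approximate identities\<close>

lemma tempered_translates_continuous:
  assumes T: "T \<in> tempered_distributions" and k: "k \<in> schwartz"
  shows "continuous_on UNIV (\<lambda>y. T (\<lambda>x. k (x - y)))"
  unfolding continuous_on_sequentially o_def
proof (intro allI impI ballI, elim conjE)
  fix Y :: "nat \<Rightarrow> real^'a" and y assume Y: "Y \<longlonglongrightarrow> y"
  show "(\<lambda>n. T (\<lambda>x. k (x - Y n))) \<longlonglongrightarrow> T (\<lambda>x. k (x - y))"
  proof (rule tempered_tendsto[OF T])
    show "(\<lambda>x. k (x - Y n)) \<in> schwartz" "(\<lambda>x. k (x - y)) \<in> schwartz" for n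
      by (intro schwartz_translate k)+
    fix m \<alpha>
    obtain B where B: "B \<ge> 0" "\<And>x y. (1 + norm x) ^ m * norm (iter_partial \<alpha> k y - iter_partial \<alpha> k x) \<le> B * norm (y - x) * (1 + norm (y - x)) ^ m"
      using schwartz_increment_bound[OF schwartz_iter[OF k]] by metis
    define e where "e n = (1 + norm y) ^ m * (B * norm (y - Y n) * (1 + norm (y - Y n)) ^ m)" for n
    have d: "(\<lambda>n. y - Y n) \<longlonglongrightarrow> y - y" by (intro tendsto_intros Y)
    have "e \<longlonglongrightarrow> (1 + norm y) ^ m * (B * norm (y - y) * (1 + norm (y - y)) ^ m)"
      unfolding e_def by (intro tendsto_mult tendsto_power tendsto_add tendsto_norm tendsto_const d)
    then have "e \<longlonglongrightarrow> 0" by simp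
    moreover have "(1 + norm x) ^ m * norm (iter_partial \<alpha> (\<lambda>x. k (x - Y n)) x - iter_partial \<alpha> (\<lambda>x. k (x - y)) x) \<le> e n" for n x
    proof -
      have "(1 + norm x) ^ m * norm (iter_partial \<alpha> k (x - Y n) - iter_partial \<alpha> k (x - y))
          \<le> ((1 + norm y) ^ m * (1 + norm (x - y)) ^ m) * norm (iter_partial \<alpha> k (x - Y n) - iter_partial \<alpha> k (x - y))"
        by (intro mult_right_mono weight_power_le) auto
      also have "\<dots> = (1 + norm y) ^ m * ((1 + norm (x - y)) ^ m * norm (iter_partial \<alpha> k (x - Y n) - iter_partial \<alpha> k (x - y)))"
        by (simp only: mult.assoc)
      also have "\<dots> \<le> e n" unfolding e_def
        using B(2)[of "x - y" "x - Y n"] by (intro mult_left_mono) auto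
      finally show ?thesis by (simp only: iter_partial_translate[OF k])
    qed
    ultimately show "\<exists>e. e \<longlonglongrightarrow> 0 \<and> (\<forall>n x. (1 + norm x) ^ m * norm (iter_partial \<alpha> (\<lambda>x. k (x - Y n)) x - iter_partial \<alpha> (\<lambda>x. k (x - y)) x) \<le> e n)"
      by blast
  qed
qed

text \<open>Continuity of \<open>T\<close> is sequential, so no bound by a seminorm is at hand. If
  every polynomial bound failed, points \<open>Y n\<close> violating the bound of degree
  \<open>n\<close> would yield normalised translates that tend to 0 in the Schwartz topology
  although \<open>T\<close> is at least 1 in modulus on each of them.\<close>

lemma tempered_translates_growth:
  assumes T: "T \<in> tempered_distributions" and k: "k \<in> schwartz"
  obtains B m where "B > 0" "\<And>y. norm (T (\<lambda>x. k (x - y))) \<le> B * (1 + norm y) ^ m"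
proof -
  have "\<exists>n::nat. \<forall>y. norm (T (\<lambda>x. k (x - y))) \<le> real (Suc n) * (1 + norm y) ^ n"
  proof (rule ccontr)
    assume "\<not> ?thesis"
    then obtain Y where Y: "\<And>n. norm (T (\<lambda>x. k (x - Y n))) > real (Suc n) * (1 + norm (Y n)) ^ n"
      by (metis not_le)
    define c where "c n = inverse (real (Suc n) * (1 + norm (Y n)) ^ n)" for n
    have cp: "real (Suc n) * (1 + norm (Y n)) ^ n > 0" for n
      by (intro mult_pos_pos zero_less_power add_pos_nonneg) auto
    have s: "(\<lambda>x. k (x - Y n)) \<in> schwartz" for n by (intro schwartz_translate k)
    have "(\<lambda>n. T (\<lambda>x. of_real (c n) * k (x - Y n))) \<longlonglongrightarrow> T (\<lambda>x. 0)"
    proof (rule tempered_tendsto[OF T])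
      show "(\<lambda>x. of_real (c n) * k (x - Y n)) \<in> schwartz" for n by (intro schwartz_cmult s)
      fix m \<alpha>
      obtain A where A: "A \<ge> 0" "\<And>x. (1 + norm x) ^ m * norm (iter_partial \<alpha> k x) \<le> A"
        using rapidE[OF schwartz_rapid[OF schwartz_iter[OF k]]] by metis
      \<comment> \<open>Translation by \<open>Y n\<close> costs \<open>(1 + norm (Y n)) ^ m\<close>
        in the seminorm with weight exponent \<open>m\<close>. From \<open>n = m\<close> on, the
        degree \<open>n\<close> in \<open>c n\<close> absorbs this and leaves
        \<open>1 / Suc n\<close>; the finitely many earlier values do not affect the limit.\<close>
      define e where "e n = (if n < m then c n * (1 + norm (Y n)) ^ m * A else A * inverse (real (Suc n)))" for n
      have "(\<lambda>n. A * inverse (real (Suc n))) \<longlonglongrightarrow> A * 0"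
        by (intro tendsto_mult tendsto_const LIMSEQ_inverse_real_of_nat)
      moreover have "\<forall>\<^sub>F n in sequentially. A * inverse (real (Suc n)) = e n"
        using eventually_ge_at_top[of m] by eventually_elim (auto simp: e_def)
      ultimately have e: "e \<longlonglongrightarrow> 0" using tendsto_cong[of "\<lambda>n. A * inverse (real (Suc n))" e] by simp
      have zero: "iter_partial \<alpha> (\<lambda>x::real^'a. 0) = (\<lambda>x. 0)"
        using iter_partial_cmult[OF schwartz_zero, of \<alpha> 0] by (simp add: fun_eq_iff)
      have "(1 + norm x) ^ m * norm (iter_partial \<alpha> (\<lambda>x. of_real (c n) * k (x - Y n)) x - iter_partial \<alpha> (\<lambda>x. 0) x) \<le> e n" for n x
      proof -
        have c0: "c n \<ge> 0" using cp[of n] by (simp add: c_def)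
        have "(1 + norm x) ^ m * norm (iter_partial \<alpha> k (x - Y n))
            \<le> ((1 + norm (Y n)) ^ m * (1 + norm (x - Y n)) ^ m) * norm (iter_partial \<alpha> k (x - Y n))"
          by (intro mult_right_mono weight_power_le) auto
        also have "\<dots> = (1 + norm (Y n)) ^ m * ((1 + norm (x - Y n)) ^ m * norm (iter_partial \<alpha> k (x - Y n)))"
          by (simp only: mult.assoc)
        also have "\<dots> \<le> (1 + norm (Y n)) ^ m * A"
          by (intro mult_left_mono A) auto
        finally have "c n * ((1 + norm x) ^ m * norm (iter_partial \<alpha> k (x - Y n))) \<le> c n * ((1 + norm (Y n)) ^ m * A)"
          using c0 by (intro mult_left_mono)
        also have "\<dots> \<le> e n"
        proof (cases "n < m")
          case False
          then have "(1 + norm (Y n)) ^ m \<le> (1 + norm (Y n)) ^ n" by (intro power_increasing) auto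
          then have "c n * (1 + norm (Y n)) ^ m \<le> c n * (1 + norm (Y n)) ^ n" using c0 by (rule mult_left_mono)
          also have "\<dots> = inverse (real (Suc n))"
            using cp[of n] by (simp add: c_def field_simps)
          finally show ?thesis using False A(1) by (simp add: e_def mult.assoc[symmetric]) (metis mult.commute mult_left_mono)
        qed (simp add: e_def)
        finally show ?thesis
          unfolding zero iter_partial_cmult[OF s] iter_partial_translate[OF k]
          using c0 by (simp add: norm_mult mult_ac)
      qed
      with e show "\<exists>e. e \<longlonglongrightarrow> 0 \<and> (\<forall>n x. (1 + norm x) ^ m * norm (iter_partial \<alpha> (\<lambda>x. of_real (c n) * k (x - Y n)) x - iter_partial \<alpha> (\<lambda>x. 0) x) \<le> e n)"
        by blast
    qed simp
    then have "(\<lambda>n. of_real (c n) * T (\<lambda>x. k (x - Y n))) \<longlonglongrightarrow> 0"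
      using tempered_cmult[OF T schwartz_zero, of 0] by (simp add: tempered_cmult[OF T s])
    then have "(\<lambda>n. norm (of_real (c n) * T (\<lambda>x. k (x - Y n)))) \<longlonglongrightarrow> 0" by (rule tendsto_norm_zero)
    then have "\<forall>\<^sub>F n in sequentially. norm (of_real (c n) * T (\<lambda>x. k (x - Y n))) < 1"
      by (rule order_tendstoD) simp
    moreover have "norm (of_real (c n) * T (\<lambda>x. k (x - Y n))) \<ge> 1" for n
    proof -
      have "1 \<le> inverse (real (Suc n) * (1 + norm (Y n)) ^ n) * norm (T (\<lambda>x. k (x - Y n)))"
        using Y[of n] cp[of n] by (simp add: divide_simps del: of_nat_Suc)
      moreover have "c n \<ge> 0" using cp[of n] by (simp add: c_def)
      ultimately show ?thesis by (simp only: norm_mult norm_of_real abs_of_nonneg c_def)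
    qed
    ultimately show False
      by (meson eventually_sequentially linorder_not_less order_refl)
  qed
  then obtain n where "\<And>y. norm (T (\<lambda>x. k (x - y))) \<le> real (Suc n) * (1 + norm y) ^ n" by blast
  with that[of "real (Suc n)" n] show thesis by simp
qed

lemma iter_partial_sum:
  assumes "finite A" "\<And>i. i \<in> A \<Longrightarrow> f i \<in> schwartz"
  shows "iter_partial \<alpha> (\<lambda>x. \<Sum>i\<in>A. c i * f i x) = (\<lambda>x. \<Sum>i\<in>A. c i * iter_partial \<alpha> (f i) x)"
  using assms
proof (induction A)
  case empty
  show ?case using iter_partial_cmult[OF schwartz_zero, of \<alpha> 0] by (simp add: fun_eq_iff)
next
  case (insert i A)
  then show ?case
    using iter_partial_linear[of "f i" "\<lambda>x. \<Sum>i\<in>A. c i * f i x" \<alpha> "c i" 1] schwartz_sum[of A f c] by simp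
qed

text \<open>The integrand depends on \<open>s y\<close> through finitely many values, so
  \<open>F\<close> may be arbitrary. It is instantiated both with
  \<open>y \<mapsto> T (k (\<cdot> - y))\<close> and with the translated derivatives of
  \<open>k\<close>, which gives the same coefficients in both cases.\<close>

lemma integral_simple_function_mult:
  fixes F :: "'b \<Rightarrow> complex"
  assumes s: "simple_function lborel s" and \<psi>: "integrable lborel \<psi>"
  shows "(\<integral>y. F (s y) * \<psi> y \<partial>lborel) = (\<Sum>v\<in>range s. (\<integral>y. indicator (s -` {v}) y * \<psi> y \<partial>lborel) * F v)"
proof -
  have fin: "finite (range s)" and m: "\<And>v. v \<in> range s \<Longrightarrow> s -` {v} \<in> sets lborel"
    using s by (auto simp: simple_function_def)
  have i: "integrable lborel (\<lambda>y. indicator (s -` {v}) y * \<psi> y)" if "v \<in> range s" for v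
  proof (rule Bochner_Integration.integrable_bound[OF \<psi>])
    show "(\<lambda>y. indicator (s -` {v}) y * \<psi> y) \<in> borel_measurable lborel"
      using m[OF that] \<psi> by (intro borel_measurable_times borel_measurable_indicator) auto
  qed (auto simp: norm_mult indicator_def)
  have "(\<integral>y. F (s y) * \<psi> y \<partial>lborel) = (\<integral>y. (\<Sum>v\<in>range s. F v * (indicator (s -` {v}) y * \<psi> y)) \<partial>lborel)"
  proof (intro Bochner_Integration.integral_cong refl)
    fix y
    have "(\<Sum>v\<in>range s. F v * (indicator (s -` {v}) y * \<psi> y)) = (\<Sum>v\<in>range s. if s y = v then F v * \<psi> y else 0)"
      by (intro sum.cong) (auto simp: indicator_def)
    then show "F (s y) * \<psi> y = (\<Sum>v\<in>range s. F v * (indicator (s -` {v}) y * \<psi> y))"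
      using fin by (simp add: sum.delta')
  qed
  also have "\<dots> = (\<Sum>v\<in>range s. F v * (\<integral>y. indicator (s -` {v}) y * \<psi> y \<partial>lborel))"
    using i by (subst Bochner_Integration.integral_sum) auto
  finally show ?thesis by (simp add: mult.commute)
qed

text \<open>
  Replacing \<open>y\<close> by a simple function \<open>s\<^sub>i y\<close> turns the convolution integral into a finite sum, to which
  linearity applies; the sums converge in the Schwartz topology.
\<close>

lemma tempered_conv:
  assumes T: "T \<in> tempered_distributions" and k: "k \<in> schwartz"
    and \<psi>: "\<psi> \<in> borel_measurable borel" "rapid \<psi>"
  shows "T (conv k \<psi>) = (\<integral>y. T (\<lambda>x. k (x - y)) * \<psi> y \<partial>lborel)"
proof -
  define g where "g y = T (\<lambda>x. k (x - y))" for y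
  obtain C p where C: "C > 0" "\<And>y. norm (g y) \<le> C * (1 + norm y) ^ p"
    using tempered_translates_growth[OF T k] unfolding g_def by metis
  note [measurable] = \<psi>(1)
  note \<psi>i = rapid_integrable[OF \<psi>]
  have "(\<lambda>y. y) \<in> borel_measurable (lborel :: (real^'a) measure)" by simp
  \<comment> \<open>Approximation relative to the base point 0 gives the bound
    \<open>2 * norm y\<close>. It keeps weights at \<open>s i y\<close> comparable with weights at
    \<open>y\<close>, and all dominating functions below come from it.\<close>
  from borel_measurable_implies_sequence_metric[OF this, of 0]
  obtain s :: "nat \<Rightarrow> real^'a \<Rightarrow> real^'a" where s: "\<And>i. simple_function lborel (s i)"
    "\<And>y. (\<lambda>i. s i y) \<longlonglongrightarrow> y" "\<And>i y. norm (s i y) \<le> 2 * norm y" by (auto simp: dist_norm)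
  have [measurable]: "s i \<in> borel_measurable borel" for i
    using borel_measurable_simple_function[OF s(1)] by simp
  have fin: "finite (range (s i))" for i using s(1)[of i] by (simp add: simple_function_def)
  define c where "c i v = (\<integral>y. indicator (s i -` {v}) y * \<psi> y \<partial>lborel)" for i v
  define S where "S i x = (\<Sum>v\<in>range (s i). c i v * k (x - v))" for i x
  have ss: "S i \<in> schwartz" for i
    unfolding S_def[abs_def] by (intro schwartz_sum fin schwartz_translate k)
  have TS: "T (S i) = (\<integral>y. g (s i y) * \<psi> y \<partial>lborel)" for i
  proof -
    have "T (S i) = (\<Sum>v\<in>range (s i). c i v * g v)"
      unfolding S_def[abs_def] g_def by (intro tempered_sum T fin schwartz_translate k)
    also have "\<dots> = (\<integral>y. g (s i y) * \<psi> y \<partial>lborel)"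
      unfolding c_def by (rule integral_simple_function_mult[OF s(1) \<psi>i, symmetric])
    finally show ?thesis .
  qed
  have DS: "iter_partial \<alpha> (S i) x = (\<integral>y. iter_partial \<alpha> k (x - s i y) * \<psi> y \<partial>lborel)" for i \<alpha> x
    unfolding S_def[abs_def] iter_partial_sum[OF fin schwartz_translate[OF k]] iter_partial_translate[OF k]
      integral_simple_function_mult[OF s(1) \<psi>i, of "\<lambda>v. iter_partial \<alpha> k (x - v)"] c_def ..
  have "(\<lambda>i. T (S i)) \<longlonglongrightarrow> T (conv k \<psi>)"
  proof (rule tempered_tendsto[OF T ss schwartz_conv[OF k \<psi>]])
    fix m \<alpha>
    let ?K = "iter_partial \<alpha> k"
    have Ks: "?K \<in> schwartz" by (rule schwartz_iter[OF k])
    have [measurable]: "?K \<in> borel_measurable borel" by (rule schwartz_borel[OF Ks])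
    obtain B where B: "B \<ge> 0" "\<And>x y. (1 + norm x) ^ m * norm (?K y - ?K x) \<le> B * norm (y - x) * (1 + norm (y - x)) ^ m"
      using schwartz_increment_bound[OF Ks] by metis
    obtain A where A: "\<And>x. norm (?K x) \<le> A"
      using rapid_bounded[OF schwartz_rapid[OF Ks]] by blast
    \<comment> \<open>\<open>E i\<close> bounds the difference of the integrands at
      \<open>s i y\<close> and at \<open>y\<close>, weight at \<open>x\<close> included, with no
      dependence on \<open>x\<close>. It tends to 0 pointwise, and \<open>W\<close> dominates it
      since \<open>norm (y - s i y) \<le> 3 * norm y\<close>; so its integral bounds a seminorm and
      tends to 0.\<close>
    define E where "E i y = B * norm (y - s i y) * (1 + norm (y - s i y)) ^ m * ((1 + norm y) ^ m * norm (\<psi> y))" for i y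
    define W where "W y = B * 3 ^ (m + 1) * ((1 + norm y) ^ (m + 1 + m) * norm (\<psi> y))" for y
    have W: "integrable lborel W" unfolding W_def by (intro integrable_mult_right weighted_rapid_integrable \<psi>)
    have EW: "norm (E i y) \<le> W y" for i y
    proof -
      have n: "norm (y - s i y) \<le> 3 * norm y"
        using norm_triangle_ineq4[of y "s i y"] s(3)[of i y] by linarith
      have "norm (y - s i y) * (1 + norm (y - s i y)) ^ m \<le> (3 * (1 + norm y)) * (3 * (1 + norm y)) ^ m"
        using n by (intro mult_mono power_mono) auto
      also have "\<dots> = 3 ^ (m + 1) * (1 + norm y) ^ (m + 1)" by (simp only: power_mult_distrib power_add power_one_right mult_ac)
      finally have "B * (norm (y - s i y) * (1 + norm (y - s i y)) ^ m) * ((1 + norm y) ^ m * norm (\<psi> y))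
          \<le> B * (3 ^ (m + 1) * (1 + norm y) ^ (m + 1)) * ((1 + norm y) ^ m * norm (\<psi> y))"
        using B(1) by (intro mult_right_mono mult_left_mono) auto
      then show ?thesis using B(1) by (simp add: E_def W_def power_add mult_ac)
    qed
    have [measurable]: "E i \<in> borel_measurable borel" for i unfolding E_def[abs_def] by measurable
    have Ei: "integrable lborel (E i)" for i
      by (rule Bochner_Integration.integrable_bound[OF W]) (auto intro!: AE_I2 order_trans[OF EW[unfolded real_norm_def] abs_ge_self])
    have "(\<lambda>i. integral\<^sup>L lborel (E i)) \<longlonglongrightarrow> integral\<^sup>L lborel (\<lambda>y::real^'a. 0)"
    proof (rule integral_dominated_convergence[OF _ _ W])
      show "AE y in lborel. (\<lambda>i. E i y) \<longlonglongrightarrow> 0"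
      proof (rule AE_I2)
        fix y
        have d: "(\<lambda>i. y - s i y) \<longlonglongrightarrow> y - y" by (intro tendsto_diff tendsto_const s(2))
        have "(\<lambda>i. E i y) \<longlonglongrightarrow> B * norm (y - y) * (1 + norm (y - y)) ^ m * ((1 + norm y) ^ m * norm (\<psi> y))"
          unfolding E_def by (intro tendsto_mult tendsto_power tendsto_add tendsto_norm tendsto_const d)
        then show "(\<lambda>i. E i y) \<longlonglongrightarrow> 0" by simp
      qed
    qed (use EW in auto)
    then have "(\<lambda>i. integral\<^sup>L lborel (E i)) \<longlonglongrightarrow> 0" by simp
    moreover have "(1 + norm x) ^ m * norm (iter_partial \<alpha> (S i) x - iter_partial \<alpha> (conv k \<psi>) x) \<le> integral\<^sup>L lborel (E i)" for i x
    proof -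
      have i1: "integrable lborel (\<lambda>y. ?K (x - y) * \<psi> y)" by (rule schwartz_conv_integrable[OF Ks \<psi>i])
      have i2: "integrable lborel (\<lambda>y. ?K (x - s i y) * \<psi> y)"
        by (rule Bochner_Integration.integrable_bound[where f = "\<lambda>y. A * norm (\<psi> y)"])
           (use \<psi>i in \<open>auto simp: norm_mult abs_mult intro!: mult_right_mono order_trans[OF A]\<close>)
      have "iter_partial \<alpha> (S i) x - iter_partial \<alpha> (conv k \<psi>) x = (\<integral>y. ?K (x - s i y) * \<psi> y - ?K (x - y) * \<psi> y \<partial>lborel)"
        unfolding DS iter_partial_conv[OF k \<psi>i] conv_def using i1 i2 by simp
      then have "(1 + norm x) ^ m * norm (iter_partial \<alpha> (S i) x - iter_partial \<alpha> (conv k \<psi>) x)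
          = norm (\<integral>y. of_real ((1 + norm x) ^ m) * (?K (x - s i y) * \<psi> y - ?K (x - y) * \<psi> y) \<partial>lborel)"
        by (simp only: integral_mult_right_zero norm_mult norm_of_real) simp
      also have "\<dots> \<le> integral\<^sup>L lborel (E i)"
      proof (rule norm_integral_le[OF _ Ei])
        show "(\<lambda>y. of_real ((1 + norm x) ^ m) * (?K (x - s i y) * \<psi> y - ?K (x - y) * \<psi> y)) \<in> borel_measurable lborel"
          by measurable
        fix y
        have "norm (complex_of_real ((1 + norm x) ^ m) * (?K (x - s i y) * \<psi> y - ?K (x - y) * \<psi> y))
            = (1 + norm x) ^ m * (norm (?K (x - s i y) - ?K (x - y)) * norm (\<psi> y))"
          unfolding left_diff_distrib[symmetric] by (simp only: norm_mult norm_of_real) simp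
        also have "\<dots> \<le> ((1 + norm y) ^ m * (1 + norm (x - y)) ^ m) * (norm (?K (x - s i y) - ?K (x - y)) * norm (\<psi> y))"
          by (intro mult_right_mono weight_power_le) auto
        also have "\<dots> = ((1 + norm (x - y)) ^ m * norm (?K (x - s i y) - ?K (x - y))) * ((1 + norm y) ^ m * norm (\<psi> y))"
          by (simp only: mult_ac)
        also have "\<dots> \<le> E i y"
          using B(2)[of "x - y" "x - s i y"] unfolding E_def by (intro mult_right_mono) auto
        finally show "norm (complex_of_real ((1 + norm x) ^ m) * (?K (x - s i y) * \<psi> y - ?K (x - y) * \<psi> y)) \<le> E i y" .
      qed
      finally show ?thesis .
    qed
    ultimately show "\<exists>e. e \<longlonglongrightarrow> 0 \<and> (\<forall>n x. (1 + norm x) ^ m * norm (iter_partial \<alpha> (S n) x - iter_partial \<alpha> (conv k \<psi>) x) \<le> e n)"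
      by blast
  qed
  \<comment> \<open>The second limit of the same sequence: \<open>g\<close> is continuous and of
    polynomial growth, hence dominated by the decay of \<open>\<psi>\<close>.\<close>
  moreover have "(\<lambda>i. T (S i)) \<longlonglongrightarrow> (\<integral>y. g y * \<psi> y \<partial>lborel)"
    unfolding TS
  proof (rule integral_dominated_convergence)
    have gc: "continuous_on UNIV g"
      unfolding g_def[abs_def] by (rule tempered_translates_continuous[OF T k])
    have [measurable]: "g \<in> borel_measurable borel" by (rule borel_measurable_continuous_onI[OF gc])
    show "(\<lambda>y. g y * \<psi> y) \<in> borel_measurable lborel" "(\<lambda>y. g (s i y) * \<psi> y) \<in> borel_measurable lborel" for i
      by measurable
    show "integrable lborel (\<lambda>y. C * 2 ^ p * ((1 + norm y) ^ p * norm (\<psi> y)))"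
      by (intro integrable_mult_right weighted_rapid_integrable \<psi>)
    show "AE y in lborel. (\<lambda>i. g (s i y) * \<psi> y) \<longlonglongrightarrow> g y * \<psi> y"
    proof (intro AE_I2 tendsto_mult tendsto_const)
      fix y
      show "(\<lambda>i. g (s i y)) \<longlonglongrightarrow> g y"
        by (rule continuous_on_tendsto_compose[OF gc s(2)]) auto
    qed
    show "AE y in lborel. norm (g (s i y) * \<psi> y) \<le> C * 2 ^ p * ((1 + norm y) ^ p * norm (\<psi> y))" for i
    proof (rule AE_I2)
      fix y
      have "(1 + norm (s i y)) ^ p \<le> (2 * (1 + norm y)) ^ p" using s(3)[of i y] by (intro power_mono) auto
      then have "norm (g (s i y)) \<le> C * (2 * (1 + norm y)) ^ p"
        using C(1) by (intro order_trans[OF C(2)] mult_left_mono) auto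
      then have "norm (g (s i y)) * norm (\<psi> y) \<le> C * (2 * (1 + norm y)) ^ p * norm (\<psi> y)"
        by (rule mult_right_mono) auto
      then show "norm (g (s i y) * \<psi> y) \<le> C * 2 ^ p * ((1 + norm y) ^ p * norm (\<psi> y))"
        by (simp only: norm_mult power_mult_distrib mult.assoc)
    qed
  qed
  ultimately show ?thesis using LIMSEQ_unique unfolding g_def by blast
qed

text \<open>After substitution the convolution averages the translates of \<open>\<psi>\<close> by
  \<open>(1 / 2 ^ J) *\<^sub>R z\<close> with density \<open>k z\<close>. The increment bound and
  the finite moments of \<open>k\<close> make every seminorm of the error \<open>O (2 ^ -J)\<close>.
  The kernel is not normalised, whence the factor \<open>\<integral> k\<close> in the limit.\<close>

lemma tempered_approximate_identity:
  fixes k :: "real^'n \<Rightarrow> complex"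
  assumes T: "T \<in> tempered_distributions" and \<psi>: "\<psi> \<in> schwartz"
    and k: "k \<in> borel_measurable borel" "rapid k"
  shows "(\<lambda>J. T (conv (\<lambda>x. of_real ((2 ^ J) ^ CARD('n)) * k ((2 ^ J) *\<^sub>R x)) \<psi>))
    \<longlonglongrightarrow> (\<integral>x. k x \<partial>lborel) * T \<psi>"
proof -
  define K where "K J x = of_real ((2 ^ J) ^ CARD('n)) * k ((2 ^ J) *\<^sub>R x)" for J :: nat and x
  note [measurable] = k(1)
  have Km [measurable]: "K J \<in> borel_measurable borel" for J unfolding K_def[abs_def] by measurable
  have Kr: "rapid (K J)" for J
    unfolding K_def[abs_def] by (intro rapid_cmult rapid_scale k) auto
  have ex: "conv \<theta> (K J) x = (\<integral>z. \<theta> (x - (1 / 2 ^ J) *\<^sub>R z) * k z \<partial>lborel)" if "\<theta> \<in> schwartz" for \<theta> J x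
  proof -
    have [measurable]: "\<theta> \<in> borel_measurable borel" by (rule schwartz_borel[OF that])
    have "(\<integral>z. \<theta> (x - (1 / 2 ^ J) *\<^sub>R z) * k z \<partial>lborel)
       = \<bar>2 ^ J\<bar> ^ DIM(real^'n) *\<^sub>R (\<integral>z. \<theta> (x - (1 / 2 ^ J) *\<^sub>R (0 + (2 ^ J) *\<^sub>R z)) * k (0 + (2 ^ J) *\<^sub>R z) \<partial>lborel)"
      by (rule lborel_integral_affine) auto
    also have "\<dots> = (\<integral>z. \<theta> (x - z) * K J z \<partial>lborel)"
      unfolding integral_scaleR_right[symmetric]
      by (intro Bochner_Integration.integral_cong) (auto simp: K_def scaleR_conv_of_real[where 'a = complex])
    finally show ?thesis by (simp add: conv_def)
  qed
  define c where "c = (\<integral>x. k x \<partial>lborel)"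
  have "(\<lambda>J. T (conv (K J) \<psi>)) \<longlonglongrightarrow> T (\<lambda>x. c * \<psi> x)"
  proof (rule tempered_tendsto[OF T])
    \<comment> \<open>With \<open>\<psi>\<close> in the role of the kernel the derivatives fall on
      \<open>\<psi>\<close>; \<open>k\<close> is only measurable.\<close>
    have cc: "conv (K J) \<psi> = conv \<psi> (K J)" for J by (intro conv_commute Km schwartz_borel \<psi>)
    show "conv (K J) \<psi> \<in> schwartz" for J unfolding cc by (intro schwartz_conv \<psi> Km Kr)
    show "(\<lambda>x. c * \<psi> x) \<in> schwartz" by (intro schwartz_cmult \<psi>)
    fix m \<alpha>
    let ?D = "iter_partial \<alpha> \<psi>"
    have Ds: "?D \<in> schwartz" by (rule schwartz_iter[OF \<psi>])
    have [measurable]: "?D \<in> borel_measurable borel" by (rule schwartz_borel[OF Ds])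
    obtain B where B: "B \<ge> 0" "\<And>x y. (1 + norm x) ^ m * norm (?D y - ?D x) \<le> B * norm (y - x) * (1 + norm (y - x)) ^ m"
      using schwartz_increment_bound[OF Ds] by metis
    obtain A where A: "\<And>x. norm (?D x) \<le> A"
      using rapid_bounded[OF schwartz_rapid[OF Ds]] by blast
    define I where "I = (\<integral>z. (1 + norm z) ^ (m + 1) * norm (k z) \<partial>lborel)"
    have "(\<lambda>J. B * I * (1 / 2) ^ J) \<longlonglongrightarrow> B * I * 0"
      by (intro tendsto_mult tendsto_const LIMSEQ_power_zero) auto
    then have "(\<lambda>J. B * I * (1 / 2) ^ J) \<longlonglongrightarrow> 0" by simp
    moreover have "(1 + norm x) ^ m * norm (iter_partial \<alpha> (conv (K J) \<psi>) x - iter_partial \<alpha> (\<lambda>x. c * \<psi> x) x) \<le> B * I * (1 / 2) ^ J" for J x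
    proof -
      have i1: "integrable lborel (\<lambda>z. ?D (x - (1 / 2 ^ J) *\<^sub>R z) * k z)"
        by (rule Bochner_Integration.integrable_bound[where f = "\<lambda>y. A * norm (k y)"])
           (use rapid_integrable[OF k] in \<open>auto simp: norm_mult abs_mult intro!: mult_right_mono order_trans[OF A]\<close>)
      have i2: "integrable lborel (\<lambda>z. ?D x * k z)" using rapid_integrable[OF k] by simp
      have "iter_partial \<alpha> (conv (K J) \<psi>) x - iter_partial \<alpha> (\<lambda>x. c * \<psi> x) x
          = (\<integral>z. ?D (x - (1 / 2 ^ J) *\<^sub>R z) * k z \<partial>lborel) - c * ?D x"
        unfolding cc iter_partial_conv[OF \<psi> rapid_integrable[OF Km Kr]] ex[OF Ds] iter_partial_cmult[OF \<psi>] ..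
      also have "c * ?D x = (\<integral>z. ?D x * k z \<partial>lborel)" by (simp add: c_def mult.commute)
      finally have "iter_partial \<alpha> (conv (K J) \<psi>) x - iter_partial \<alpha> (\<lambda>x. c * \<psi> x) x
          = (\<integral>z. ?D (x - (1 / 2 ^ J) *\<^sub>R z) * k z - ?D x * k z \<partial>lborel)"
        using i1 i2 by simp
      then have "(1 + norm x) ^ m * norm (iter_partial \<alpha> (conv (K J) \<psi>) x - iter_partial \<alpha> (\<lambda>x. c * \<psi> x) x)
          = norm (\<integral>z. of_real ((1 + norm x) ^ m) * (?D (x - (1 / 2 ^ J) *\<^sub>R z) * k z - ?D x * k z) \<partial>lborel)"
        by (simp only: integral_mult_right_zero norm_mult norm_of_real) simp
      also have "\<dots> \<le> (\<integral>z. B * (1 / 2) ^ J * ((1 + norm z) ^ (m + 1) * norm (k z)) \<partial>lborel)"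
      proof (rule norm_integral_le)
        show "integrable lborel (\<lambda>z. B * (1 / 2) ^ J * ((1 + norm z) ^ (m + 1) * norm (k z)))"
          by (intro integrable_mult_right weighted_rapid_integrable k)
        show "(\<lambda>z. of_real ((1 + norm x) ^ m) * (?D (x - (1 / 2 ^ J) *\<^sub>R z) * k z - ?D x * k z)) \<in> borel_measurable lborel"
          by measurable
        fix z :: "real^'n"
        let ?w = "(1 / 2 ^ J) *\<^sub>R z"
        have nw: "norm ?w = (1 / 2) ^ J * norm z" by (simp add: power_one_over)
        have nw': "norm ?w \<le> norm z" unfolding nw by (intro mult_left_le_one_le power_le_one) auto
        have "norm (complex_of_real ((1 + norm x) ^ m) * (?D (x - ?w) * k z - ?D x * k z))
            = ((1 + norm x) ^ m * norm (?D (x - ?w) - ?D x)) * norm (k z)"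
          unfolding left_diff_distrib[symmetric] by (simp only: norm_mult norm_of_real) simp
        also have "\<dots> \<le> (B * norm ?w * (1 + norm ?w) ^ m) * norm (k z)"
          using B(2)[of x "x - ?w"] by (intro mult_right_mono) auto
        also have "\<dots> \<le> (B * ((1 / 2) ^ J * (1 + norm z)) * (1 + norm z) ^ m) * norm (k z)"
          using B(1) nw nw' by (intro mult_right_mono mult_mono power_mono) auto
        also have "\<dots> = B * (1 / 2) ^ J * ((1 + norm z) ^ (m + 1) * norm (k z))" by simp
        finally show "norm (complex_of_real ((1 + norm x) ^ m) * (?D (x - ?w) * k z - ?D x * k z))
            \<le> B * (1 / 2) ^ J * ((1 + norm z) ^ (m + 1) * norm (k z))" .
      qed
      also have "\<dots> = B * I * (1 / 2) ^ J" by (simp add: I_def)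
      finally show ?thesis .
    qed
    ultimately show "\<exists>e. e \<longlonglongrightarrow> 0 \<and> (\<forall>J x. (1 + norm x) ^ m * norm (iter_partial \<alpha> (conv (K J) \<psi>) x - iter_partial \<alpha> (\<lambda>x. c * \<psi> x) x) \<le> e J)"
      by blast
  qed
  then show ?thesis unfolding tempered_cmult[OF T \<psi>] c_def K_def[abs_def] .
qed

section \<open>The Fourier transform on Schwartz functions\<close>

lemma borel_measurable_cis [measurable]: "cis \<in> borel_measurable borel"
  by (intro borel_measurable_continuous_onI continuous_intros)

text \<open>The transform without its normalising factor and over Borel sets, where Fubini and
  substitution are available. \<open>fourier\<close> is a multiple of it, \<open>inv_fourier\<close>
  a multiple of its reflection.\<close>

definition ft :: "(real^'n \<Rightarrow> complex) \<Rightarrow> real^'n \<Rightarrow> complex" where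
  "ft \<psi> \<xi> = (\<integral>x. cis (- (x \<bullet> \<xi>)) * \<psi> x \<partial>lborel)"

lemma fourier_eq_ft:
  fixes \<psi> :: "real^'n \<Rightarrow> complex"
  assumes [measurable]: "\<psi> \<in> borel_measurable borel"
  shows "fourier \<psi> \<xi> = of_real ((2 * pi) powr (- real CARD('n) / 2)) * ft \<psi> \<xi>"
  unfolding fourier_def ft_def by (subst integral_completion) auto

lemma inv_fourier_eq_ft:
  fixes \<psi> :: "real^'n \<Rightarrow> complex"
  assumes [measurable]: "\<psi> \<in> borel_measurable borel"
  shows "inv_fourier \<psi> \<xi> = of_real ((2 * pi) powr (- real CARD('n) / 2)) * ft \<psi> (- \<xi>)"
proof -
  have "(\<integral>x. cis (\<xi> \<bullet> x) * \<psi> x \<partial>lebesgue) = (\<integral>x. cis (\<xi> \<bullet> x) * \<psi> x \<partial>lborel)"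
    by (subst integral_completion) auto
  then show ?thesis unfolding inv_fourier_def ft_def by (simp add: inner_commute)
qed

lemma integrable_phase:
  assumes "integrable lborel \<psi>" "h \<in> borel_measurable borel"
  shows "integrable lborel (\<lambda>x. cis (h x) * (\<psi> x :: complex))"
  by (rule Bochner_Integration.integrable_bound[OF assms(1)]) (use assms in \<open>auto simp: norm_mult\<close>)

lemma norm_ft_le:
  assumes "integrable lborel \<psi>"
  shows "norm (ft \<psi> \<xi>) \<le> (\<integral>x. norm (\<psi> x) \<partial>lborel)"
  unfolding ft_def by (rule norm_integral_le) (use assms in \<open>auto simp: norm_mult\<close>)

section \<open>The Fourier transform preserves the Schwartz class\<close>

lemma has_derivative_ft:
  fixes \<psi> :: "real^'n \<Rightarrow> complex"
  assumes \<psi>: "\<psi> \<in> schwartz"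
  shows "(ft \<psi> has_derivative (\<lambda>h. \<integral>x. (- (x \<bullet> h)) *\<^sub>R (\<i> * cis (- (x \<bullet> \<xi>))) * \<psi> x \<partial>lborel)) (at \<xi>)"
  unfolding ft_def[abs_def]
proof (rule has_derivative_integral[where F' = "\<lambda>\<xi> x h. (- (x \<bullet> h)) *\<^sub>R (\<i> * cis (- (x \<bullet> \<xi>))) * \<psi> x"])
  have [measurable]: "\<psi> \<in> borel_measurable borel" by (rule schwartz_borel[OF \<psi>])
  show "integrable lborel (\<lambda>x. cis (- (x \<bullet> \<xi>)) * \<psi> x)" for \<xi>
    by (intro integrable_phase schwartz_integrable \<psi>) auto
  show "(\<lambda>x. (- (x \<bullet> h)) *\<^sub>R (\<i> * cis (- (x \<bullet> \<xi>))) * \<psi> x) \<in> borel_measurable lborel" for h by measurable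
  show "integrable lborel (\<lambda>x. (1 + norm x) ^ 1 * norm (\<psi> x))"
    by (intro weighted_rapid_integrable schwartz_borel schwartz_rapid \<psi>)
  show "norm ((- (x \<bullet> h)) *\<^sub>R (\<i> * cis (- (x \<bullet> \<xi>))) * \<psi> x) \<le> (1 + norm x) ^ 1 * norm (\<psi> x) * norm h" for \<xi> x h
  proof -
    have "\<bar>x \<bullet> h\<bar> \<le> norm x * norm h" by (rule Cauchy_Schwarz_ineq2)
    also have "\<dots> \<le> (1 + norm x) * norm h" by (intro mult_right_mono) auto
    finally have "\<bar>x \<bullet> h\<bar> * norm (\<psi> x) \<le> (1 + norm x) * norm h * norm (\<psi> x)" by (rule mult_right_mono) auto
    then show ?thesis by (simp add: norm_mult mult_ac)
  qed
  show "((\<lambda>\<xi>. cis (- (x \<bullet> \<xi>)) * \<psi> x) has_derivative (\<lambda>h. (- (x \<bullet> h)) *\<^sub>R (\<i> * cis (- (x \<bullet> \<xi>))) * \<psi> x)) (at \<xi>)" for x \<xi>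
    by (intro has_derivative_mult_left has_derivative_cis has_derivative_minus has_derivative_inner_right has_derivative_ident)
qed auto

lemma partial_deriv_ft:
  fixes \<psi> :: "real^'n \<Rightarrow> complex"
  assumes \<psi>: "\<psi> \<in> schwartz"
  shows "partial_deriv i (ft \<psi>) = ft (\<lambda>x. - \<i> * (of_real (x $ i) * \<psi> x))"
proof
  fix \<xi>
  show "partial_deriv i (ft \<psi>) \<xi> = ft (\<lambda>x. - \<i> * (of_real (x $ i) * \<psi> x)) \<xi>"
    unfolding partial_deriv_eq[OF has_derivative_ft[OF \<psi>]] ft_def
    by (intro Bochner_Integration.integral_cong) (auto simp: inner_axis scaleR_conv_of_real[where 'a = complex])
qed

lemma vector_derivative_sequentially:
  assumes "(f has_vector_derivative D) (at 0)"
  shows "(\<lambda>n. real (Suc n) *\<^sub>R (f (inverse (real (Suc n))) - f 0)) \<longlonglongrightarrow> D"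
proof -
  have "(\<lambda>h. norm (f (0 + h) - f 0 - h *\<^sub>R D) / norm h) \<midarrow>0\<rightarrow> 0"
    using assms unfolding has_vector_derivative_def has_derivative_at by blast
  then have "(\<lambda>n. norm (f (0 + inverse (real (Suc n))) - f 0 - inverse (real (Suc n)) *\<^sub>R D) / norm (inverse (real (Suc n)))) \<longlonglongrightarrow> 0"
    by (rule filterlim_compose)
       (auto simp: filterlim_at eventually_sequentially LIMSEQ_inverse_real_of_nat simp del: of_nat_Suc)
  moreover have "norm (f (inverse (real (Suc n))) - f 0 - inverse (real (Suc n)) *\<^sub>R D) / norm (inverse (real (Suc n)))
      = norm (real (Suc n) *\<^sub>R (f (inverse (real (Suc n))) - f 0) - D)" for n
  proof -
    have "norm (real (Suc n) *\<^sub>R (f (inverse (real (Suc n))) - f 0) - D)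
        = norm (real (Suc n) *\<^sub>R (f (inverse (real (Suc n))) - f 0 - inverse (real (Suc n)) *\<^sub>R D))"
      by (simp add: scaleR_diff_right del: of_nat_Suc)
    then show ?thesis by (simp add: divide_inverse mult.commute del: of_nat_Suc)
  qed
  ultimately have "(\<lambda>n. norm (real (Suc n) *\<^sub>R (f (inverse (real (Suc n))) - f 0) - D)) \<longlonglongrightarrow> 0" by (simp only: add_0)
  then show ?thesis by (rule LIM_zero_cancel[OF tendsto_norm_zero_cancel])
qed

lemma ft_translate:
  assumes [measurable]: "\<psi> \<in> borel_measurable borel"
  shows "ft (\<lambda>x. \<psi> (x - a)) \<xi> = cis (- (a \<bullet> \<xi>)) * ft \<psi> \<xi>"
proof -
  have "ft (\<lambda>x. \<psi> (x - a)) \<xi> = (\<integral>x. (\<lambda>z. cis (- ((z + a) \<bullet> \<xi>)) * \<psi> z) (x - a) \<partial>lborel)"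
    by (simp add: ft_def)
  also have "\<dots> = (\<integral>z. cis (- ((z + a) \<bullet> \<xi>)) * \<psi> z \<partial>lborel)"
    by (rule lborel_integral_translate) measurable
  also have "\<dots> = (\<integral>z. cis (- (a \<bullet> \<xi>)) * (cis (- (z \<bullet> \<xi>)) * \<psi> z) \<partial>lborel)"
  proof (intro Bochner_Integration.integral_cong refl)
    fix z
    have "cis (- ((z + a) \<bullet> \<xi>)) = cis (- (a \<bullet> \<xi>)) * cis (- (z \<bullet> \<xi>))"
      by (simp add: cis_mult inner_add_left add.commute)
    then show "cis (- ((z + a) \<bullet> \<xi>)) * \<psi> z = cis (- (a \<bullet> \<xi>)) * (cis (- (z \<bullet> \<xi>)) * \<psi> z)" by simp
  qed
  finally show ?thesis by (simp add: ft_def)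
qed

lemma ft_scale:
  fixes \<psi> :: "real^'n \<Rightarrow> complex"
  assumes [measurable]: "\<psi> \<in> borel_measurable borel" and t: "t > 0"
  shows "ft (\<lambda>x. \<psi> (t *\<^sub>R x)) \<xi> = of_real (1 / t ^ CARD('n)) * ft \<psi> ((1 / t) *\<^sub>R \<xi>)"
proof -
  have "ft (\<lambda>x. \<psi> (t *\<^sub>R x)) \<xi>
      = \<bar>1 / t\<bar> ^ DIM(real^'n) *\<^sub>R (\<integral>x. cis (- ((0 + (1 / t) *\<^sub>R x) \<bullet> \<xi>)) * \<psi> (t *\<^sub>R (0 + (1 / t) *\<^sub>R x)) \<partial>lborel)"
    unfolding ft_def by (rule lborel_integral_affine) (use t in auto)
  then show ?thesis using t by (simp add: ft_def scaleR_conv_of_real[where 'a = complex] power_one_over)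
qed

text \<open>In place of integration by parts, a difference quotient is transformed: translation
  becomes multiplication by a character, so the transform is a difference quotient of the character
  times \<open>ft \<psi>\<close>. Both sides are then passed to the limit.\<close>

lemma ft_partial_deriv:
  fixes \<psi> :: "real^'n \<Rightarrow> complex"
  assumes \<psi>: "\<psi> \<in> schwartz"
  shows "ft (partial_deriv i \<psi>) \<xi> = \<i> * of_real (\<xi> $ i) * ft \<psi> \<xi>"
proof -
  define e :: "real^'n" where "e = axis i 1"
  have ne: "norm e = 1" by (simp add: e_def)
  define h where "h n = inverse (real (Suc n))" for n
  have h: "0 < h n" "h n \<le> 1" "real (Suc n) * h n = 1" for n
    unfolding h_def by (auto simp del: of_nat_Suc simp: inverse_le_1_iff)
  define D where "D n x = real (Suc n) *\<^sub>R (\<psi> (x + h n *\<^sub>R e) - \<psi> x)" for n x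
  have [measurable]: "\<psi> \<in> borel_measurable borel" "partial_deriv i \<psi> \<in> borel_measurable borel"
    by (intro schwartz_borel schwartz_partial \<psi>)+
  \<comment> \<open>With this exponent the increment bound dominates all difference quotients by one
    integrable weight.\<close>
  let ?m = "DIM(real^'n) + 1"
  obtain B where B: "B \<ge> 0" "\<And>x y. (1 + norm x) ^ ?m * norm (\<psi> y - \<psi> x) \<le> B * norm (y - x) * (1 + norm (y - x)) ^ ?m"
    using schwartz_increment_bound[OF \<psi>] by metis
  have bd: "norm (D n x) \<le> B * 2 ^ ?m * (1 / (1 + norm x) ^ ?m)" for n x
  proof -
    have p: "0 < (1 + norm x) ^ ?m" by (intro zero_less_power add_pos_nonneg) auto
    have "(1 + norm x) ^ ?m * norm (\<psi> (x + h n *\<^sub>R e) - \<psi> x) \<le> B * h n * (1 + h n) ^ ?m"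
      using B(2)[of x "x + h n *\<^sub>R e"] h(1)[of n] by (simp add: ne)
    also have "\<dots> \<le> B * h n * 2 ^ ?m"
      using B(1) h(1,2)[of n] by (intro mult_left_mono power_mono) auto
    finally have "real (Suc n) * ((1 + norm x) ^ ?m * norm (\<psi> (x + h n *\<^sub>R e) - \<psi> x)) \<le> real (Suc n) * (B * h n * 2 ^ ?m)"
      by (rule mult_left_mono) auto
    also have "\<dots> = (real (Suc n) * h n) * (B * 2 ^ ?m)" by (simp only: mult_ac)
    finally have "norm (D n x) * (1 + norm x) ^ ?m \<le> B * 2 ^ ?m"
      unfolding h(3) D_def by (simp only: norm_scaleR mult_ac abs_of_nat mult_1_left)
    then have "norm (D n x) \<le> B * 2 ^ ?m / (1 + norm x) ^ ?m" using p by (simp only: pos_le_divide_eq)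
    then show ?thesis by simp
  qed
  have [measurable]: "D n \<in> borel_measurable borel" for n unfolding D_def[abs_def] by measurable
  have lim1: "(\<lambda>n. ft (D n) \<xi>) \<longlonglongrightarrow> ft (partial_deriv i \<psi>) \<xi>"
    unfolding ft_def
  proof (rule integral_dominated_convergence)
    show "integrable lborel (\<lambda>x::real^'n. B * 2 ^ ?m * (1 / (1 + norm x) ^ ?m))"
      by (intro integrable_mult_right integrable_weight)
    show "AE x in lborel. norm (cis (- (x \<bullet> \<xi>)) * D n x) \<le> B * 2 ^ ?m * (1 / (1 + norm x) ^ ?m)" for n
      using bd[of n] by (auto simp: norm_mult)
    show "AE x in lborel. (\<lambda>n. cis (- (x \<bullet> \<xi>)) * D n x) \<longlonglongrightarrow> cis (- (x \<bullet> \<xi>)) * partial_deriv i \<psi> x"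
    proof (intro AE_I2 tendsto_mult tendsto_const)
      fix x
      have "((\<lambda>t. x + t *\<^sub>R e) has_derivative (\<lambda>t. t *\<^sub>R e)) (at 0)" by (auto intro!: derivative_eq_intros)
      from has_derivative_compose[OF this, of \<psi> "\<lambda>h. \<Sum>j\<in>UNIV. (h $ j) *\<^sub>R partial_deriv j \<psi> x"]
      have "((\<lambda>t. \<psi> (x + t *\<^sub>R e)) has_derivative (\<lambda>t. \<Sum>j\<in>UNIV. ((t *\<^sub>R e) $ j) *\<^sub>R partial_deriv j \<psi> x)) (at 0)"
        using schwartz_has_derivative[OF \<psi>, of x] by simp
      also have "(\<lambda>t. \<Sum>j\<in>UNIV. ((t *\<^sub>R e) $ j) *\<^sub>R partial_deriv j \<psi> x) = (\<lambda>t. t *\<^sub>R (\<Sum>j\<in>UNIV. (e $ j) *\<^sub>R partial_deriv j \<psi> x))"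
        by (simp add: scaleR_sum_right)
      finally have "((\<lambda>t. \<psi> (x + t *\<^sub>R e)) has_vector_derivative partial_deriv i \<psi> x) (at 0)"
        unfolding has_vector_derivative_def e_def sum_axis_scaleR .
      from vector_derivative_sequentially[OF this]
      show "(\<lambda>n. D n x) \<longlonglongrightarrow> partial_deriv i \<psi> x" unfolding D_def h_def by simp
    qed
  qed measurable
  have "ft (D n) \<xi> = (real (Suc n) *\<^sub>R (cis (h n * (\<xi> $ i)) - cis (0 * (\<xi> $ i)))) * ft \<psi> \<xi>" for n
  proof -
    have i1: "integrable lborel (\<lambda>x. cis (- (x \<bullet> \<xi>)) * \<psi> (x - - h n *\<^sub>R e))"
      by (intro integrable_phase schwartz_integrable schwartz_translate \<psi>) auto
    have i2: "integrable lborel (\<lambda>x. cis (- (x \<bullet> \<xi>)) * \<psi> x)"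
      by (intro integrable_phase schwartz_integrable \<psi>) auto
    have "ft (D n) \<xi> = (\<integral>x. real (Suc n) *\<^sub>R (cis (- (x \<bullet> \<xi>)) * \<psi> (x - - h n *\<^sub>R e) - cis (- (x \<bullet> \<xi>)) * \<psi> x) \<partial>lborel)"
      unfolding ft_def D_def
      by (intro Bochner_Integration.integral_cong refl) (simp add: algebra_simps)
    also have "\<dots> = real (Suc n) *\<^sub>R (ft (\<lambda>x. \<psi> (x - - h n *\<^sub>R e)) \<xi> - ft \<psi> \<xi>)"
      unfolding ft_def integral_scaleR_right Bochner_Integration.integral_diff[OF i1 i2] ..
    also have "ft (\<lambda>x. \<psi> (x - - h n *\<^sub>R e)) \<xi> = cis (h n * (\<xi> $ i)) * ft \<psi> \<xi>"
      by (subst ft_translate) (auto simp: e_def inner_axis')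
    finally show ?thesis by (simp add: algebra_simps)
  qed
  moreover have "(\<lambda>n. (real (Suc n) *\<^sub>R (cis (h n * (\<xi> $ i)) - cis (0 * (\<xi> $ i)))) * ft \<psi> \<xi>) \<longlonglongrightarrow> (\<i> * of_real (\<xi> $ i)) * ft \<psi> \<xi>"
  proof (intro tendsto_mult tendsto_const)
    have "((\<lambda>t. cis (t * (\<xi> $ i))) has_derivative (\<lambda>t. (t * (\<xi> $ i)) *\<^sub>R (\<i> * cis (0 * (\<xi> $ i))))) (at 0)"
      by (intro has_derivative_cis has_derivative_mult_left has_derivative_ident)
    then have "((\<lambda>t. cis (t * (\<xi> $ i))) has_vector_derivative (\<i> * of_real (\<xi> $ i))) (at 0)"
      unfolding has_vector_derivative_def by (simp add: scaleR_conv_of_real[where 'a = complex] mult_ac)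
    from vector_derivative_sequentially[OF this]
    show "(\<lambda>n. real (Suc n) *\<^sub>R (cis (h n * (\<xi> $ i)) - cis (0 * (\<xi> $ i)))) \<longlonglongrightarrow> \<i> * of_real (\<xi> $ i)"
      by (simp only: h_def)
  qed
  ultimately have "(\<lambda>n. ft (D n) \<xi>) \<longlonglongrightarrow> (\<i> * of_real (\<xi> $ i)) * ft \<psi> \<xi>" by simp
  then show ?thesis using LIMSEQ_unique[OF lim1] by simp
qed

text \<open>Induction on the power of the weight, for all \<open>\<psi>\<close> at once: one more
  factor \<open>norm \<xi>\<close> is at most the sum of the coordinates, and multiplying
  \<open>ft \<psi>\<close> by a coordinate amounts, up to \<open>\<i>\<close>, to transforming a
  partial derivative of \<open>\<psi>\<close>.\<close>

lemma rapid_ft: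
  fixes \<psi> :: "real^'n \<Rightarrow> complex"
  assumes "\<psi> \<in> schwartz"
  shows "rapid (ft \<psi>)"
proof -
  have "\<exists>B. \<forall>\<xi>. (1 + norm \<xi>) ^ k * norm (ft \<psi> \<xi>) \<le> B" if "\<psi> \<in> schwartz" for k and \<psi> :: "real^'n \<Rightarrow> complex"
    using that
  proof (induction k arbitrary: \<psi>)
    case 0
    then show ?case using norm_ft_le[OF schwartz_integrable] by (metis mult_1 power_0)
  next
    case (Suc k)
    obtain A where A: "\<And>\<xi>. (1 + norm \<xi>) ^ k * norm (ft \<psi> \<xi>) \<le> A" using Suc by blast
    have "\<forall>i. \<exists>B. \<forall>\<xi>. (1 + norm \<xi>) ^ k * norm (ft (partial_deriv i \<psi>) \<xi>) \<le> B"
      using Suc schwartz_partial by blast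
    then obtain B where B: "\<And>i \<xi>. (1 + norm \<xi>) ^ k * norm (ft (partial_deriv i \<psi>) \<xi>) \<le> B i" by metis
    have "(1 + norm \<xi>) ^ Suc k * norm (ft \<psi> \<xi>) \<le> A + (\<Sum>i\<in>UNIV. B i)" for \<xi>
    proof -
      have "(1 + norm \<xi>) ^ Suc k * norm (ft \<psi> \<xi>) = (1 + norm \<xi>) ^ k * norm (ft \<psi> \<xi>) + norm \<xi> * ((1 + norm \<xi>) ^ k * norm (ft \<psi> \<xi>))"
        by (simp add: algebra_simps)
      also have "\<dots> \<le> A + (\<Sum>i\<in>UNIV. \<bar>\<xi> $ i\<bar>) * ((1 + norm \<xi>) ^ k * norm (ft \<psi> \<xi>))"
        by (intro add_mono A mult_right_mono norm_le_l1_cart) auto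
      also have "\<dots> = A + (\<Sum>i\<in>UNIV. (1 + norm \<xi>) ^ k * norm (ft (partial_deriv i \<psi>) \<xi>))"
      proof -
        have "(1 + norm \<xi>) ^ k * norm (ft (partial_deriv i \<psi>) \<xi>) = \<bar>\<xi> $ i\<bar> * ((1 + norm \<xi>) ^ k * norm (ft \<psi> \<xi>))" for i
          by (simp add: ft_partial_deriv[OF Suc.prems] norm_mult)
        then show ?thesis by (simp only: sum_distrib_right)
      qed
      also have "\<dots> \<le> A + (\<Sum>i\<in>UNIV. B i)" by (intro add_left_mono sum_mono B)
      finally show ?thesis .
    qed
    then show ?case by blast
  qed
  then show ?thesis using assms unfolding rapid_def by blast
qed

lemma schwartz_ft:
  fixes \<psi> :: "real^'n \<Rightarrow> complex"
  assumes "\<psi> \<in> schwartz"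
  shows "ft \<psi> \<in> schwartz"
proof (rule schwartz_coinduct[where X = "ft ` schwartz"])
  show "ft \<psi> \<in> ft ` schwartz" using assms by blast
  show "g differentiable_on UNIV" if "g \<in> ft ` schwartz" for g :: "real^'n \<Rightarrow> complex"
    using that has_derivative_ft unfolding differentiable_on_def differentiable_def by blast
  show "rapid g" if "g \<in> ft ` schwartz" for g :: "real^'n \<Rightarrow> complex"
    using that rapid_ft by blast
  show "partial_deriv i g \<in> ft ` schwartz" if "g \<in> ft ` schwartz" for i and g :: "real^'n \<Rightarrow> complex"
    using that partial_deriv_ft schwartz_cmult[OF schwartz_coord_mult] by blast
qed

section \<open>Exchange of integrals and Fourier inversion\<close>

lemma Fubini_phase:
  fixes f g :: "real^'n \<Rightarrow> complex" and P :: "real^'n \<Rightarrow> real^'n \<Rightarrow> complex"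
  assumes f: "integrable lborel f" and g: "integrable lborel g"
    and P [measurable]: "(\<lambda>z. P (fst z) (snd z)) \<in> borel_measurable (lborel \<Otimes>\<^sub>M lborel)" and nP: "\<And>x y. norm (P x y) \<le> 1"
  shows "(\<integral>y. (\<integral>x. P x y * f x \<partial>lborel) * g y \<partial>lborel) = (\<integral>x. f x * (\<integral>y. P x y * g y \<partial>lborel) \<partial>lborel)"
proof -
  have [measurable]: "f \<in> borel_measurable lborel" "g \<in> borel_measurable lborel" using f g by auto
  have P' [measurable]: "P x \<in> borel_measurable lborel" for x
    using measurable_compose[OF measurable_Pair1' P, of x] by simp
  have int: "integrable (lborel \<Otimes>\<^sub>M lborel) (\<lambda>(x, y). f x * (P x y * g y))"
  proof (rule Bochner_Integration.integrable_bound)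
    show "integrable (lborel \<Otimes>\<^sub>M lborel) (\<lambda>z. f (fst z) * g (snd z))"
    proof (rule lborel_pair.Fubini_integrable)
      show "(\<lambda>z. f (fst z) * g (snd z)) \<in> borel_measurable (lborel \<Otimes>\<^sub>M lborel)" by measurable
      show "integrable lborel (\<lambda>x. \<integral>y. norm (f (fst (x, y)) * g (snd (x, y))) \<partial>lborel)"
        using f by (simp add: norm_mult)
      show "AE x in lborel. integrable lborel (\<lambda>y. f (fst (x, y)) * g (snd (x, y)))"
        using g by (intro AE_I2) simp
    qed
    show "(\<lambda>(x, y). f x * (P x y * g y)) \<in> borel_measurable (lborel \<Otimes>\<^sub>M lborel)"
      unfolding case_prod_beta by measurable
    show "AE z in lborel \<Otimes>\<^sub>M lborel. norm (case z of (x, y) \<Rightarrow> f x * (P x y * g y)) \<le> norm (f (fst z) * g (snd z))"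
      using nP by (intro AE_I2) (auto simp: norm_mult intro!: mult_left_mono mult_left_le_one_le)
  qed
  have "(\<integral>y. (\<integral>x. P x y * f x \<partial>lborel) * g y \<partial>lborel) = (\<integral>y. (\<integral>x. f x * (P x y * g y) \<partial>lborel) \<partial>lborel)"
  proof (intro Bochner_Integration.integral_cong refl)
    fix y
    have "(\<integral>x. P x y * f x \<partial>lborel) * g y = (\<integral>x. P x y * f x * g y \<partial>lborel)" by simp
    then show "(\<integral>x. P x y * f x \<partial>lborel) * g y = (\<integral>x. f x * (P x y * g y) \<partial>lborel)" by (simp add: mult_ac)
  qed
  also have "\<dots> = (\<integral>x. (\<integral>y. f x * (P x y * g y) \<partial>lborel) \<partial>lborel)"
    by (rule lborel_pair.Fubini_integral[OF int])
  finally show ?thesis by simp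
qed

lemma ft_swap:
  assumes "\<theta> \<in> schwartz" "\<phi> \<in> schwartz"
  shows "(\<integral>z. ft \<theta> z * \<phi> z \<partial>lborel) = (\<integral>x. \<theta> x * ft \<phi> x \<partial>lborel)"
  using Fubini_phase[OF assms[THEN schwartz_integrable], of "\<lambda>x y. cis (- (x \<bullet> y))"]
  unfolding ft_def by (simp add: inner_commute)

text \<open>Both sides are limits of \<open>\<integral> ft \<phi> z * \<theta> (z / n)\<close>, which is symmetric in \<open>\<phi>\<close> and \<open>\<theta>\<close>.\<close>

lemma ft_integral_proportional:
  fixes \<theta> \<phi> :: "real^'n \<Rightarrow> complex"
  assumes \<theta>: "\<theta> \<in> schwartz" and \<phi>: "\<phi> \<in> schwartz"
  shows "(\<integral>z. ft \<phi> z \<partial>lborel) * \<theta> 0 = (\<integral>z. ft \<theta> z \<partial>lborel) * \<phi> 0"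
proof -
  define I where "I \<phi> \<theta> n = (\<integral>z. ft \<phi> z * \<theta> (inverse (real (Suc n)) *\<^sub>R z) \<partial>lborel)"
    for \<phi> \<theta> :: "real^'n \<Rightarrow> complex" and n
  have lim: "I \<phi> \<theta> \<longlonglongrightarrow> (\<integral>z. ft \<phi> z \<partial>lborel) * \<theta> 0" if \<phi>: "\<phi> \<in> schwartz" and \<theta>: "\<theta> \<in> schwartz" for \<phi> \<theta> :: "real^'n \<Rightarrow> complex"
  proof -
    have [measurable]: "\<theta> \<in> borel_measurable borel" "ft \<phi> \<in> borel_measurable borel"
      by (intro schwartz_borel schwartz_ft \<phi> \<theta>)+
    obtain A where A: "\<And>x. norm (\<theta> x) \<le> A"
      using rapid_bounded[OF schwartz_rapid[OF \<theta>]] by blast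
    have "I \<phi> \<theta> \<longlonglongrightarrow> (\<integral>z. ft \<phi> z * \<theta> 0 \<partial>lborel)"
      unfolding I_def[abs_def]
    proof (rule integral_dominated_convergence[where w = "\<lambda>z. norm (ft \<phi> z) * A"])
      show "integrable lborel (\<lambda>z. norm (ft \<phi> z) * A)"
        by (intro integrable_mult_left integrable_norm schwartz_integrable schwartz_ft \<phi>)
      show "AE z in lborel. (\<lambda>n. ft \<phi> z * \<theta> (inverse (real (Suc n)) *\<^sub>R z)) \<longlonglongrightarrow> ft \<phi> z * \<theta> 0"
      proof (intro AE_I2 tendsto_mult tendsto_const)
        fix z :: "real^'n"
        have "(\<lambda>n. inverse (real (Suc n)) *\<^sub>R z) \<longlonglongrightarrow> 0 *\<^sub>R z"
          by (intro tendsto_scaleR tendsto_const LIMSEQ_inverse_real_of_nat)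
        then show "(\<lambda>n. \<theta> (inverse (real (Suc n)) *\<^sub>R z)) \<longlonglongrightarrow> \<theta> 0"
          by (intro continuous_on_tendsto_compose[OF schwartz_continuous[OF \<theta>]]) auto
      qed
      show "AE z in lborel. norm (ft \<phi> z * \<theta> (inverse (real (Suc n)) *\<^sub>R z)) \<le> norm (ft \<phi> z) * A" for n
        using A by (auto simp: norm_mult intro!: mult_left_mono simp del: of_nat_Suc)
    qed measurable
    then show ?thesis by simp
  qed
  \<comment> \<open>\<open>ft_swap\<close> moves the transform to the dilated
    \<open>\<theta>\<close>. Rescaling the variable then undilates \<open>\<theta>\<close> and
    dilates \<open>\<phi>\<close>, and the Jacobian cancels the factor from
    \<open>ft_scale\<close>.\<close>
  have "I \<phi> \<theta> n = I \<theta> \<phi> n" for n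
  proof -
    let ?e = "inverse (real (Suc n))"
    have e: "?e > 0" by simp
    have [measurable]: "\<phi> \<in> borel_measurable borel" "\<theta> \<in> borel_measurable borel" "ft \<theta> \<in> borel_measurable borel"
      by (intro schwartz_borel schwartz_ft \<phi> \<theta>)+
    have "I \<phi> \<theta> n = (\<integral>x. \<phi> x * ft (\<lambda>z. \<theta> (?e *\<^sub>R z)) x \<partial>lborel)"
      unfolding I_def by (rule ft_swap[OF \<phi> schwartz_scale[OF \<theta>]]) simp
    also have "\<dots> = (\<integral>x. \<phi> x * (of_real (1 / ?e ^ CARD('n)) * ft \<theta> ((1 / ?e) *\<^sub>R x)) \<partial>lborel)"
      by (subst ft_scale[OF _ e]) (auto simp del: of_nat_Suc)
    also have "\<dots> = \<bar>?e\<bar> ^ DIM(real^'n) *\<^sub>R (\<integral>x. \<phi> (0 + ?e *\<^sub>R x) * (of_real (1 / ?e ^ CARD('n)) * ft \<theta> ((1 / ?e) *\<^sub>R (0 + ?e *\<^sub>R x))) \<partial>lborel)"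
      by (rule lborel_integral_affine) (auto simp del: of_nat_Suc)
    also have "\<dots> = (\<integral>x. ft \<theta> x * \<phi> (?e *\<^sub>R x) \<partial>lborel)"
      unfolding integral_scaleR_right[symmetric] using e
      by (intro Bochner_Integration.integral_cong refl)
         (simp add: scaleR_conv_of_real[where 'a = complex] del: of_nat_Suc)
    finally show ?thesis unfolding I_def .
  qed
  then have "I \<phi> \<theta> = I \<theta> \<phi>" by blast
  then show ?thesis using lim[OF \<phi> \<theta>] lim[OF \<theta> \<phi>] LIMSEQ_unique by metis
qed

text \<open>If the integral vanished, \<open>g\<close> would be 0 almost everywhere; its zero set is
  closed, and a closed set of full measure contains every point.\<close>

lemma integral_pos_of_continuous:
  fixes g :: "'a::euclidean_space \<Rightarrow> real"
  assumes "continuous_on UNIV g" "\<And>x. g x \<ge> 0" "integrable lborel g" "g a \<noteq> 0"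
  shows "integral\<^sup>L lborel g > 0"
proof (rule ccontr)
  assume "\<not> ?thesis"
  moreover have "integral\<^sup>L lborel g \<ge> 0" using assms(2) by simp
  ultimately have "integral\<^sup>L lborel g = 0" by linarith
  then have "AE x in lborel. g x = 0"
    using integral_nonneg_eq_0_iff_AE[OF assms(3)] assms(2) by simp
  then have "AE x in lebesgue. x \<in> g -` {0}" by (intro AE_completion) simp
  moreover have "closed (g -` {0})" using assms(1) by (intro closed_vimage) auto
  ultimately have "a \<in> g -` {0}" by (rule mem_closed_if_AE_lebesgue[rotated])
  then show False using assms(4) by simp
qed

text \<open>The constant is \<open>(2\<pi>)\<^sup>n\<close>, but only its being nonzero matters, and this follows from Plancherel's identity.\<close>

lemma ft_inversion:
  fixes \<phi> :: "real^'n \<Rightarrow> complex"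
  assumes \<phi>: "\<phi> \<in> schwartz" "\<phi> 0 \<noteq> 0"
  obtains c where "c \<noteq> 0"
    "\<And>\<theta> x. \<theta> \<in> schwartz \<Longrightarrow> (\<integral>\<xi>. cis (x \<bullet> \<xi>) * ft \<theta> \<xi> \<partial>lborel) = c * \<theta> (x :: real^'n)"
proof -
  \<comment> \<open>By proportionality the quotient formed with the reference function
    \<open>\<phi>\<close> serves all Schwartz functions.\<close>
  define c where "c = (\<integral>z. ft \<phi> z \<partial>lborel) / \<phi> 0"
  have c0: "(\<integral>z. ft \<theta> z \<partial>lborel) = c * \<theta> 0" if "\<theta> \<in> schwartz" for \<theta> :: "real^'n \<Rightarrow> complex"
    using ft_integral_proportional[OF that \<phi>(1)] \<phi>(2) by (simp add: c_def field_simps)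
  \<comment> \<open>Inversion at \<open>x\<close> is inversion at 0 for a translate of
    \<open>\<theta>\<close>.\<close>
  have c: "(\<integral>\<xi>. cis (x \<bullet> \<xi>) * ft \<theta> \<xi> \<partial>lborel) = c * \<theta> x" if \<theta>: "\<theta> \<in> schwartz" for \<theta> and x :: "real^'n"
    using c0[OF schwartz_translate[OF \<theta>, of "-x"]]
    by (simp only: ft_translate[OF schwartz_borel[OF \<theta>]]) simp
  have "c \<noteq> 0"
  proof
    assume "c = 0"
    \<comment> \<open>\<open>\<beta>\<close> is the square of the modulus of \<open>\<phi>\<close>,
      so \<open>ft \<beta> 0\<close> is a positive integral and \<open>ft \<beta>\<close> is not
      identically 0. With \<open>c = 0\<close>, Fubini and the inversion formula would give
      \<open>ft \<beta>\<close> the square norm 0.\<close>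
    define \<beta> where "\<beta> x = \<phi> x * cnj (\<phi> x)" for x
    have \<beta>: "\<beta> \<in> schwartz" unfolding \<beta>_def[abs_def] by (intro schwartz_mult schwartz_cnj \<phi>)
    have cc: "continuous_on UNIV (\<lambda>x. (norm (\<theta> x))\<^sup>2)" "integrable lborel (\<lambda>x. (norm (\<theta> x))\<^sup>2)"
      "complex_of_real (\<integral>x. (norm (\<theta> x))\<^sup>2 \<partial>lborel) = (\<integral>x. \<theta> x * cnj (\<theta> x) \<partial>lborel)"
      if \<theta>: "\<theta> \<in> schwartz" for \<theta> :: "real^'n \<Rightarrow> complex"
    proof -
      show "continuous_on UNIV (\<lambda>x. (norm (\<theta> x))\<^sup>2)" by (intro continuous_intros schwartz_continuous \<theta>)
      have "integrable lborel (\<lambda>x. \<theta> x * cnj (\<theta> x))"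
        by (intro schwartz_integrable schwartz_mult schwartz_cnj \<theta>)
      then have i: "integrable lborel (\<lambda>x. complex_of_real ((norm (\<theta> x))\<^sup>2))"
        by (simp only: complex_norm_square)
      then show "integrable lborel (\<lambda>x. (norm (\<theta> x))\<^sup>2)" by (rule complex_of_real_integrable_eq[THEN iffD1])
      show "complex_of_real (\<integral>x. (norm (\<theta> x))\<^sup>2 \<partial>lborel) = (\<integral>x. \<theta> x * cnj (\<theta> x) \<partial>lborel)"
        by (simp only: integral_complex_of_real[symmetric] complex_norm_square)
    qed
    have "0 < (\<integral>x. (norm (\<phi> x))\<^sup>2 \<partial>lborel)"
      by (rule integral_pos_of_continuous[where a = 0]) (use \<phi> cc[OF \<phi>(1)] in auto)
    then have "ft \<beta> 0 \<noteq> 0"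
      using cc(3)[OF \<phi>(1)] by (simp add: ft_def \<beta>_def) (metis less_irrefl of_real_eq_0_iff)
    then have "0 < (\<integral>x. (norm (ft \<beta> x))\<^sup>2 \<partial>lborel)"
      by (intro integral_pos_of_continuous[where a = 0]) (use cc[OF schwartz_ft[OF \<beta>]] in auto)
    moreover have "complex_of_real (\<integral>x. (norm (ft \<beta> x))\<^sup>2 \<partial>lborel) = 0"
    proof -
      have cn: "cnj (ft \<beta> \<xi>) = (\<integral>x. cis (x \<bullet> \<xi>) * cnj (\<beta> x) \<partial>lborel)" for \<xi>
      proof -
        have "cnj (ft \<beta> \<xi>) = (\<integral>x. cnj (cis (- (x \<bullet> \<xi>)) * \<beta> x) \<partial>lborel)"
          unfolding ft_def by (rule Bochner_Integration.integral_cnj[symmetric])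
        then show ?thesis by (simp only: complex_cnj_mult cis_cnj minus_minus)
      qed
      have "complex_of_real (\<integral>x. (norm (ft \<beta> x))\<^sup>2 \<partial>lborel) = (\<integral>\<xi>. (\<integral>x. cis (x \<bullet> \<xi>) * cnj (\<beta> x) \<partial>lborel) * ft \<beta> \<xi> \<partial>lborel)"
        unfolding cc(3)[OF schwartz_ft[OF \<beta>]] cn by (simp add: mult.commute)
      also have "\<dots> = (\<integral>x. cnj (\<beta> x) * (\<integral>\<xi>. cis (x \<bullet> \<xi>) * ft \<beta> \<xi> \<partial>lborel) \<partial>lborel)"
        by (rule Fubini_phase) (auto intro!: schwartz_integrable schwartz_cnj schwartz_ft \<beta>)
      also have "\<dots> = 0" by (simp add: c[OF \<beta>] \<open>c = 0\<close>)
      finally show ?thesis .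
    qed
    ultimately show False by simp
  qed
  with c show thesis using that by blast
qed

section \<open>Fourier multipliers as convolutions\<close>

text \<open>The convolution kernel of the multiplier \<open>m\<close> on the side of test functions.
  The factor collects the two normalisations of \<open>fourier\<close> and
  \<open>inv_fourier\<close>.\<close>

definition kern :: "(real^'n \<Rightarrow> complex) \<Rightarrow> real^'n \<Rightarrow> complex" where
  "kern m x = of_real ((2 * pi) powr (- real CARD('n))) * ft m x"

lemma schwartz_kern: "m \<in> schwartz \<Longrightarrow> kern m \<in> schwartz"
  unfolding kern_def[abs_def] by (intro schwartz_cmult schwartz_ft)

lemma schwartz_reflect:
  fixes \<psi> :: "real^'n \<Rightarrow> complex"
  shows "\<psi> \<in> schwartz \<Longrightarrow> (\<lambda>x. \<psi> (- x)) \<in> schwartz"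
  using schwartz_scale[of \<psi> "-1"] by simp

lemma multiplier_eq_conv:
  fixes m \<psi> :: "real^'n \<Rightarrow> complex"
  assumes m: "m \<in> schwartz" and \<psi>: "\<psi> \<in> schwartz"
  shows "fourier (\<lambda>\<xi>. m \<xi> * inv_fourier \<psi> \<xi>) = conv (kern m) \<psi>"
proof
  fix x
  define a where "a = complex_of_real ((2 * pi) powr (- real CARD('n) / 2))"
  have a2: "a * a = of_real ((2 * pi) powr (- real CARD('n)))"
    unfolding a_def of_real_mult[symmetric] powr_add[symmetric] by simp
  have i: "inv_fourier \<psi> = (\<lambda>\<xi>. a * ft \<psi> (- \<xi>))"
    by (intro ext) (simp add: inv_fourier_eq_ft[OF schwartz_borel[OF \<psi>]] a_def)
  have s: "(\<lambda>\<xi>. m \<xi> * inv_fourier \<psi> \<xi>) \<in> schwartz"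
    unfolding i by (rule schwartz_mult[OF m schwartz_cmult[OF schwartz_reflect[OF schwartz_ft[OF \<psi>]]]])
  have "fourier (\<lambda>\<xi>. m \<xi> * inv_fourier \<psi> \<xi>) x = a * (\<integral>\<xi>. cis (- (\<xi> \<bullet> x)) * (m \<xi> * (a * ft \<psi> (- \<xi>))) \<partial>lborel)"
    unfolding fourier_eq_ft[OF schwartz_borel[OF s]] a_def[symmetric] unfolding ft_def[of "\<lambda>\<xi>. m \<xi> * _ \<xi>"] i ..
  also have "\<dots> = (a * a) * (\<integral>\<xi>. m \<xi> * (cis (- (\<xi> \<bullet> x)) * ft \<psi> (- \<xi>)) \<partial>lborel)"
  proof -
    have "(\<lambda>\<xi>. cis (- (\<xi> \<bullet> x)) * (m \<xi> * (a * ft \<psi> (- \<xi>)))) = (\<lambda>\<xi>. a * (m \<xi> * (cis (- (\<xi> \<bullet> x)) * ft \<psi> (- \<xi>))))"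
      by (intro ext) simp
    then show ?thesis by simp
  qed
  also have "(\<lambda>\<xi>. cis (- (\<xi> \<bullet> x)) * ft \<psi> (- \<xi>)) = (\<lambda>\<xi>. \<integral>y. cis (- (\<xi> \<bullet> (x - y))) * \<psi> y \<partial>lborel)"
  proof
    fix \<xi>
    have "cis (- (\<xi> \<bullet> x)) * ft \<psi> (- \<xi>) = (\<integral>y. cis (- (\<xi> \<bullet> x)) * (cis (- (y \<bullet> (- \<xi>))) * \<psi> y) \<partial>lborel)"
      by (simp add: ft_def)
    also have "\<dots> = (\<integral>y. cis (- (\<xi> \<bullet> (x - y))) * \<psi> y \<partial>lborel)"
    proof (intro Bochner_Integration.integral_cong refl)
      fix y
      have "cis (- (\<xi> \<bullet> x)) * cis (- (y \<bullet> (- \<xi>))) = cis (- (\<xi> \<bullet> (x - y)))"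
        by (simp add: cis_mult inner_diff_right inner_commute)
      then show "cis (- (\<xi> \<bullet> x)) * (cis (- (y \<bullet> (- \<xi>))) * \<psi> y) = cis (- (\<xi> \<bullet> (x - y))) * \<psi> y"
        by (simp only: mult.assoc[symmetric])
    qed
    finally show "cis (- (\<xi> \<bullet> x)) * ft \<psi> (- \<xi>) = (\<integral>y. cis (- (\<xi> \<bullet> (x - y))) * \<psi> y \<partial>lborel)" .
  qed
  then have "(\<integral>\<xi>. m \<xi> * (cis (- (\<xi> \<bullet> x)) * ft \<psi> (- \<xi>)) \<partial>lborel)
      = (\<integral>\<xi>. m \<xi> * (\<integral>y. cis (- (\<xi> \<bullet> (x - y))) * \<psi> y \<partial>lborel) \<partial>lborel)"
    by (simp add: fun_eq_iff)
  also have "\<dots> = (\<integral>y. (\<integral>\<xi>. cis (- (\<xi> \<bullet> (x - y))) * m \<xi> \<partial>lborel) * \<psi> y \<partial>lborel)"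
    by (rule Fubini_phase[symmetric]) (auto intro: schwartz_integrable m \<psi>)
  also have "(a * a) * \<dots> = conv (kern m) \<psi> x"
    unfolding conv_def kern_def a2 by (simp only: mult.assoc integral_mult_right_zero ft_def)
  finally show "fourier (\<lambda>\<xi>. m \<xi> * inv_fourier \<psi> \<xi>) x = conv (kern m) \<psi> x" .
qed

text \<open>Transposition reverses the order of the three operations, so the test function first
  meets \<open>inv_fourier\<close>, then \<open>m\<close>, then \<open>fourier\<close>.\<close>

lemma multiplier_dist_eq:
  assumes "m \<in> schwartz" "\<psi> \<in> schwartz"
  shows "dist_inv_fourier (dist_mult m (dist_fourier T)) \<psi> = T (conv (kern m) \<psi>)"
  unfolding dist_inv_fourier_def dist_mult_def dist_fourier_def multiplier_eq_conv[OF assms] ..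

lemma ft_diff:
  assumes "m \<in> schwartz" "n \<in> schwartz"
  shows "ft (\<lambda>x. m x - n x) \<xi> = ft m \<xi> - ft n \<xi>"
proof -
  have "integrable lborel (\<lambda>x. cis (- (x \<bullet> \<xi>)) * m x)" "integrable lborel (\<lambda>x. cis (- (x \<bullet> \<xi>)) * n x)"
    by (intro integrable_phase schwartz_integrable assms; simp)+
  then show ?thesis unfolding ft_def by (simp add: right_diff_distrib)
qed

lemma kern_diff:
  assumes "m \<in> schwartz" "n \<in> schwartz"
  shows "kern (\<lambda>x. m x - n x) = (\<lambda>x. kern m x - kern n x)"
  by (intro ext) (simp add: kern_def ft_diff[OF assms] right_diff_distrib)

lemma conv_diff_left:
  assumes "k \<in> schwartz" "l \<in> schwartz" "\<psi> \<in> schwartz"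
  shows "conv (\<lambda>x. k x - l x) \<psi> = (\<lambda>x. conv k \<psi> x - conv l \<psi> x)"
  unfolding conv_def[abs_def]
  by (intro ext) (simp add: left_diff_distrib schwartz_conv_integrable schwartz_integrable assms)

text \<open>After Fubini the inner integral is the inversion formula for \<open>n\<close>. The
  inversion constant enters as an assumption so that this identity and the limit of the partial sums
  share one value.\<close>

lemma conv_kern:
  fixes m n :: "real^'n \<Rightarrow> complex"
  assumes m: "m \<in> schwartz" and n: "n \<in> schwartz"
    and c: "\<And>\<theta> x. \<theta> \<in> schwartz \<Longrightarrow> (\<integral>\<xi>. cis (x \<bullet> \<xi>) * ft \<theta> \<xi> \<partial>lborel) = c * \<theta> (x :: real^'n)"
  shows "conv (kern m) (kern n) x = of_real ((2 * pi) powr (- real CARD('n))) * c * kern (\<lambda>\<xi>. m \<xi> * n \<xi>) x"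
proof -
  let ?a = "complex_of_real ((2 * pi) powr (- real CARD('n)))"
  have "conv (kern m) (kern n) x = ?a * ?a * (\<integral>y. (\<integral>\<xi>. cis (- (\<xi> \<bullet> (x - y))) * m \<xi> \<partial>lborel) * ft n y \<partial>lborel)"
  proof -
    have "(\<lambda>y. kern m (x - y) * kern n y) = (\<lambda>y. ?a * ?a * (ft m (x - y) * ft n y))"
      by (intro ext) (simp add: kern_def)
    then show ?thesis by (simp only: conv_def integral_mult_right_zero ft_def[of m])
  qed
  also have "(\<integral>y. (\<integral>\<xi>. cis (- (\<xi> \<bullet> (x - y))) * m \<xi> \<partial>lborel) * ft n y \<partial>lborel)
      = (\<integral>\<xi>. m \<xi> * (\<integral>y. cis (- (\<xi> \<bullet> (x - y))) * ft n y \<partial>lborel) \<partial>lborel)"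
    by (rule Fubini_phase) (auto intro: schwartz_integrable schwartz_ft m n)
  also have "\<dots> = (\<integral>\<xi>. c * (cis (- (\<xi> \<bullet> x)) * (m \<xi> * n \<xi>)) \<partial>lborel)"
  proof (intro Bochner_Integration.integral_cong refl)
    fix \<xi>
    have "(\<integral>y. cis (- (\<xi> \<bullet> (x - y))) * ft n y \<partial>lborel) = (\<integral>y. cis (- (\<xi> \<bullet> x)) * (cis (\<xi> \<bullet> y) * ft n y) \<partial>lborel)"
    proof (intro Bochner_Integration.integral_cong refl)
      fix y
      have "cis (- (\<xi> \<bullet> (x - y))) = cis (- (\<xi> \<bullet> x)) * cis (\<xi> \<bullet> y)"
        by (simp add: cis_mult inner_diff_right)
      then show "cis (- (\<xi> \<bullet> (x - y))) * ft n y = cis (- (\<xi> \<bullet> x)) * (cis (\<xi> \<bullet> y) * ft n y)" by simp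
    qed
    also have "\<dots> = cis (- (\<xi> \<bullet> x)) * (c * n \<xi>)" by (simp add: c[OF n])
    finally show "m \<xi> * (\<integral>y. cis (- (\<xi> \<bullet> (x - y))) * ft n y \<partial>lborel) = c * (cis (- (\<xi> \<bullet> x)) * (m \<xi> * n \<xi>))"
      by (simp add: mult_ac)
  qed
  also have "\<dots> = c * ft (\<lambda>\<xi>. m \<xi> * n \<xi>) x" by (simp add: ft_def)
  finally show ?thesis by (simp only: kern_def[of "\<lambda>\<xi>. m \<xi> * n \<xi>"] mult_ac)
qed

section \<open>Test functions and uniqueness of representatives\<close>

lemma partial_deriv_zero_on_open:
  assumes "open U" "\<And>x. x \<in> U \<Longrightarrow> f x = 0" "x \<in> U"
  shows "partial_deriv i f x = 0"
proof -
  have "(f has_derivative (\<lambda>h. 0)) (at x)"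
    by (rule has_derivative_transform_within_open[of "\<lambda>x. 0" _ x UNIV U]) (use assms in auto)
  from partial_deriv_eq[OF this] show ?thesis by simp
qed

lemma outside_supp: "x \<notin> supp f \<Longrightarrow> f x = 0"
  unfolding supp_def using closure_subset[of "{x. f x \<noteq> 0}"] by blast

text \<open>All derivatives vanish on the open complement of the support, so each weighted
  derivative is a continuous function on a compact set, extended by 0.\<close>

lemma test_function_schwartz:
  fixes \<psi> :: "real^'n \<Rightarrow> complex"
  assumes "\<psi> \<in> test_functions" shows "\<psi> \<in> schwartz"
proof -
  have cpt: "compact (supp \<psi>)" and d: "iter_partial \<alpha> \<psi> differentiable_on UNIV" for \<alpha>
    using assms by (auto simp: test_functions_def smooth_def)
  have z: "iter_partial \<alpha> \<psi> x = 0" if "x \<notin> supp \<psi>" for \<alpha> x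
    using that
  proof (induction \<alpha> arbitrary: x)
    case Nil then show ?case using outside_supp by simp
  next
    case (Cons i \<alpha>)
    have "open (- supp \<psi>)" unfolding supp_def by (intro open_Compl closed_closure)
    then show ?case unfolding iter_partial_Cons
      by (rule partial_deriv_zero_on_open) (use Cons in auto)
  qed
  show ?thesis unfolding schwartz_iff
  proof (intro allI conjI d)
    fix \<alpha>
    show "rapid (iter_partial \<alpha> \<psi>)" unfolding rapid_def
    proof
      fix k
      have "continuous_on (supp \<psi>) (\<lambda>x. (1 + norm x) ^ k * norm (iter_partial \<alpha> \<psi> x))"
        using differentiable_imp_continuous_on[OF d] continuous_on_subset
        by (intro continuous_intros) blast
      then have "bounded ((\<lambda>x. (1 + norm x) ^ k * norm (iter_partial \<alpha> \<psi> x)) ` supp \<psi>)"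
        using cpt by (intro compact_imp_bounded compact_continuous_image)
      then obtain B where "\<And>x. x \<in> supp \<psi> \<Longrightarrow> \<bar>(1 + norm x) ^ k * norm (iter_partial \<alpha> \<psi> x)\<bar> \<le> B"
        unfolding bounded_iff by auto
      then have "(1 + norm x) ^ k * norm (iter_partial \<alpha> \<psi> x) \<le> B" if "x \<in> supp \<psi>" for x
        using that abs_le_D1 by blast
      then have "(1 + norm x) ^ k * norm (iter_partial \<alpha> \<psi> x) \<le> max B 0" for x
        using z[of x \<alpha>] by (cases "x \<in> supp \<psi>") (simp_all add: max.coboundedI1)
      then show "\<exists>B. \<forall>x. (1 + norm x) ^ k * norm (iter_partial \<alpha> \<psi> x) \<le> B" by blast
    qed
  qed
qed

lemma continuous_test_integrable:
  fixes g \<psi> :: "real^'n \<Rightarrow> complex"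
  assumes g: "continuous_on UNIV g" and \<psi>: "\<psi> \<in> test_functions"
  shows "integrable lborel (\<lambda>x. g x * \<psi> x)"
proof -
  have "continuous_on (supp \<psi>) (\<lambda>x. g x * \<psi> x)"
    by (intro continuous_on_mult continuous_on_subset[OF g]
        continuous_on_subset[OF schwartz_continuous[OF test_function_schwartz[OF \<psi>]]]) auto
  then have "integrable lborel (\<lambda>x. indicator (supp \<psi>) x *\<^sub>R (g x * \<psi> x))"
    using \<psi> by (intro borel_integrable_compact) (auto simp: test_functions_def)
  also have "(\<lambda>x. indicator (supp \<psi>) x *\<^sub>R (g x * \<psi> x)) = (\<lambda>x. g x * \<psi> x)"
    using outside_supp[of _ \<psi>] by (auto simp: fun_eq_iff indicator_def)
  finally show ?thesis .
qed

text \<open>\<open>\<phi>\<close> provides the bump function: dilates of \<open>\<beta>\<close> that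
  concentrate at \<open>a\<close> are test functions, and integrating the difference
  \<open>d\<close> against them, rescaled, tends to \<open>d a\<close> times the integral of
  \<open>\<beta>\<close>.\<close>

lemma continuous_eq_by_test_functions:
  fixes g g' \<phi> :: "real^'n \<Rightarrow> complex"
  assumes \<phi>: "\<phi> \<in> schwartz" "\<phi> 0 \<noteq> 0" "\<And>x. norm x > 2 \<Longrightarrow> \<phi> x = 0"
    and g: "continuous_on UNIV g" "continuous_on UNIV g'"
    and eq: "\<And>\<psi>. \<psi> \<in> test_functions \<Longrightarrow> (\<integral>x. g x * \<psi> x \<partial>lborel) = (\<integral>x. g' x * \<psi> x \<partial>lborel)"
  shows "g = g'"
proof
  fix a
  \<comment> \<open>\<open>\<phi>\<close> is complex valued and may have integral 0; the square of
    its modulus has a positive integral.\<close>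
  define \<beta> where "\<beta> x = \<phi> x * cnj (\<phi> x)" for x
  have \<beta>: "\<beta> \<in> schwartz" unfolding \<beta>_def[abs_def] by (intro schwartz_mult schwartz_cnj \<phi>)
  have \<beta>0: "\<beta> x = 0" if "norm x > 2" for x using \<phi>(3)[OF that] by (simp add: \<beta>_def)
  have [measurable]: "\<beta> \<in> borel_measurable borel" by (rule schwartz_borel[OF \<beta>])
  have \<beta>n: "\<beta> x = of_real ((norm (\<phi> x))\<^sup>2)" for x unfolding \<beta>_def by (simp only: complex_norm_square)
  have "integrable lborel (\<lambda>x. (norm (\<phi> x))\<^sup>2)"
    using schwartz_integrable[OF \<beta>] unfolding \<beta>n[abs_def] by (rule complex_of_real_integrable_eq[THEN iffD1])
  then have "0 < (\<integral>x. (norm (\<phi> x))\<^sup>2 \<partial>lborel)"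
    by (intro integral_pos_of_continuous[where a = 0])
       (auto intro!: continuous_intros schwartz_continuous \<phi>)
  then have I: "(\<integral>x. \<beta> x \<partial>lborel) \<noteq> 0" unfolding \<beta>n[abs_def] integral_complex_of_real by simp
  define d where "d x = g x - g' x" for x
  have dc: "continuous_on UNIV d" unfolding d_def[abs_def] by (intro continuous_intros g)
  have [measurable]: "d \<in> borel_measurable borel" by (rule borel_measurable_continuous_onI[OF dc])
  have zero: "(\<integral>y. d (a + inverse (real (Suc n)) *\<^sub>R y) * \<beta> y \<partial>lborel) = 0" for n
  proof -
    define t where "t = real (Suc n)"
    have t: "t > 0" by (simp add: t_def)
    define \<psi> where "\<psi> x = \<beta> (t *\<^sub>R x - t *\<^sub>R a)" for x
    have \<psi>: "\<psi> \<in> test_functions"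
    proof -
      have "\<psi> \<in> schwartz" unfolding \<psi>_def[abs_def] by (rule schwartz_affine[OF \<beta>]) (use t in simp)
      moreover have "{x. \<psi> x \<noteq> 0} \<subseteq> cball a (2 / t)"
      proof
        fix x assume "x \<in> {x. \<psi> x \<noteq> 0}"
        then have "norm (t *\<^sub>R x - t *\<^sub>R a) \<le> 2" using \<beta>0[of "t *\<^sub>R x - t *\<^sub>R a"] by (force simp: \<psi>_def)
        then have "t * norm (x - a) \<le> 2" using t by (simp flip: scaleR_diff_right)
        then show "x \<in> cball a (2 / t)" using t by (simp add: dist_norm norm_minus_commute field_simps)
      qed
      then have "bounded {x. \<psi> x \<noteq> 0}" by (rule bounded_subset[OF bounded_cball])
      ultimately show ?thesis by (simp add: test_functions_def schwartz_smooth supp_def compact_closure)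
    qed
    have [measurable]: "\<psi> \<in> borel_measurable borel" unfolding \<psi>_def[abs_def] by measurable
    have "(\<integral>x. d x * \<psi> x \<partial>lborel) = 0"
      unfolding d_def left_diff_distrib
      using eq[OF \<psi>] continuous_test_integrable[OF g(1) \<psi>] continuous_test_integrable[OF g(2) \<psi>] by simp
    moreover have "(\<integral>x. d x * \<psi> x \<partial>lborel) = \<bar>inverse t\<bar> ^ DIM(real^'n) *\<^sub>R (\<integral>y. d (a + inverse t *\<^sub>R y) * \<psi> (a + inverse t *\<^sub>R y) \<partial>lborel)"
      by (rule lborel_integral_affine) (use t in auto)
    moreover have "\<psi> (a + inverse t *\<^sub>R y) = \<beta> y" for y
      using t by (simp add: \<psi>_def scaleR_add_right)
    ultimately show ?thesis using t by (simp add: t_def del: of_nat_Suc)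
  qed
  have "bounded (d ` cball a 2)"
    by (intro compact_imp_bounded compact_continuous_image continuous_on_subset[OF dc]) auto
  then obtain B where B: "\<And>x. x \<in> cball a 2 \<Longrightarrow> norm (d x) \<le> B" unfolding bounded_iff by blast
  have "(\<lambda>n. \<integral>y. d (a + inverse (real (Suc n)) *\<^sub>R y) * \<beta> y \<partial>lborel) \<longlonglongrightarrow> (\<integral>y. d a * \<beta> y \<partial>lborel)"
  proof (rule integral_dominated_convergence[where w = "\<lambda>y. B * norm (\<beta> y)"])
    show "integrable lborel (\<lambda>y. B * norm (\<beta> y))"
      by (intro integrable_mult_right integrable_norm schwartz_integrable \<beta>)
    show "AE y in lborel. (\<lambda>n. d (a + inverse (real (Suc n)) *\<^sub>R y) * \<beta> y) \<longlonglongrightarrow> d a * \<beta> y"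
    proof (intro AE_I2 tendsto_mult tendsto_const)
      fix y
      have "(\<lambda>n. a + inverse (real (Suc n)) *\<^sub>R y) \<longlonglongrightarrow> a + 0 *\<^sub>R y"
        by (intro tendsto_add tendsto_scaleR tendsto_const LIMSEQ_inverse_real_of_nat)
      then show "(\<lambda>n. d (a + inverse (real (Suc n)) *\<^sub>R y)) \<longlonglongrightarrow> d a"
        by (intro continuous_on_tendsto_compose[OF dc]) auto
    qed
    show "AE y in lborel. norm (d (a + inverse (real (Suc n)) *\<^sub>R y) * \<beta> y) \<le> B * norm (\<beta> y)" for n
    proof (rule AE_I2)
      fix y
      show "norm (d (a + inverse (real (Suc n)) *\<^sub>R y) * \<beta> y) \<le> B * norm (\<beta> y)"
      proof (cases "norm y > 2")
        case False
        have "inverse (real (Suc n)) * norm y \<le> norm y"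
          by (intro mult_left_le_one_le) (auto simp: inverse_le_1_iff simp del: of_nat_Suc)
        then have "norm (d (a + inverse (real (Suc n)) *\<^sub>R y)) \<le> B"
          using False by (intro B) (simp add: dist_norm del: of_nat_Suc)
        then show ?thesis by (simp only: norm_mult) (intro mult_right_mono, auto)
      qed (simp add: \<beta>0)
    qed
  qed measurable
  then have "(\<integral>y. d a * \<beta> y \<partial>lborel) = 0" unfolding zero using LIMSEQ_unique tendsto_const by blast
  then show "g a = g' a" using I by (simp add: d_def)
qed

section \<open>Continuous representatives of Fourier multipliers\<close>

lemma represents_multiplier:
  assumes T: "T \<in> tempered_distributions" and m: "m \<in> schwartz"
  shows "represents (\<lambda>y. T (\<lambda>x. kern m (x - y))) (dist_inv_fourier (dist_mult m (dist_fourier T)))"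
proof -
  let ?g = "\<lambda>y. T (\<lambda>x. kern m (x - y))"
  have gc: "continuous_on UNIV ?g" by (rule tempered_translates_continuous[OF T schwartz_kern[OF m]])
  have [measurable]: "?g \<in> borel_measurable borel" by (rule borel_measurable_continuous_onI[OF gc])
  show ?thesis unfolding represents_def
  proof (intro conjI allI ballI impI)
    fix K :: "(real^'a) set" assume K: "compact K"
    have "integrable lborel (\<lambda>x. indicator K x *\<^sub>R ?g x)"
      by (intro borel_integrable_compact K continuous_on_subset[OF gc]) auto
    then show "?g absolutely_integrable_on K"
      unfolding set_integrable_def by (subst integrable_completion) auto
  next
    fix \<psi> :: "real^'a \<Rightarrow> complex" assume "\<psi> \<in> test_functions"
    then have \<psi>: "\<psi> \<in> schwartz" by (rule test_function_schwartz)
    note [measurable] = schwartz_borel[OF \<psi>]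
    show "dist_inv_fourier (dist_mult m (dist_fourier T)) \<psi> = (\<integral>x. ?g x * \<psi> x \<partial>lebesgue)"
      unfolding multiplier_dist_eq[OF m \<psi>]
        tempered_conv[OF T schwartz_kern[OF m] schwartz_borel[OF \<psi>] schwartz_rapid[OF \<psi>]]
      by (subst integral_completion) auto
  qed
qed

text \<open>Resolves the description operator. Existence is \<open>tempered_conv\<close> read as
  integration against a continuous function; uniqueness uses test functions built from
  \<open>\<phi>\<close>.\<close>

lemma fun_of_dist_multiplier:
  fixes \<phi> m :: "real^'n \<Rightarrow> complex"
  assumes T: "T \<in> tempered_distributions" and m: "m \<in> schwartz" and \<phi>: "resolution_generator \<phi>"
  shows "fun_of_dist (dist_inv_fourier (dist_mult m (dist_fourier T))) = (\<lambda>y. T (\<lambda>x. kern m (x - y)))"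
  unfolding fun_of_dist_def
proof (rule the_equality)
  let ?g = "\<lambda>y. T (\<lambda>x. kern m (x - y))"
  have gc: "continuous_on UNIV ?g" by (rule tempered_translates_continuous[OF T schwartz_kern[OF m]])
  note r = represents_multiplier[OF T m]
  show "continuous_on UNIV ?g \<and> represents ?g (dist_inv_fourier (dist_mult m (dist_fourier T)))"
    using gc r by blast
  fix g' assume g': "continuous_on UNIV g' \<and> represents g' (dist_inv_fourier (dist_mult m (dist_fourier T)))"
  show "g' = ?g"
  proof (rule continuous_eq_by_test_functions[of \<phi>])
    show "\<phi> \<in> schwartz" "\<phi> 0 \<noteq> 0" using \<phi> by (auto simp: resolution_generator_def)
    show "\<phi> x = 0" if "norm x > 2" for x
      using that \<phi> outside_supp[of x \<phi>] by (force simp: resolution_generator_def)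
    show "(\<integral>x. g' x * \<psi> x \<partial>lborel) = (\<integral>x. ?g x * \<psi> x \<partial>lborel)" if \<psi>: "\<psi> \<in> test_functions" for \<psi>
    proof -
      have c: "(\<integral>x. h x * \<psi> x \<partial>lebesgue) = (\<integral>x. h x * \<psi> x \<partial>lborel)" if "continuous_on UNIV h" for h
        using continuous_test_integrable[OF that \<psi>] by (intro integral_completion) auto
      show ?thesis using g' r \<psi> c[OF gc] c[of g'] unfolding represents_def by auto
    qed
  qed (use gc g' in auto)
qed

section \<open>Littlewood--Paley pieces\<close>

locale resolution_setup =
  fixes \<phi> :: "real^'n \<Rightarrow> complex"
  assumes generator: "resolution_generator \<phi>"
begin

lemma schwartz_generator: "\<phi> \<in> schwartz" and generator_one: "norm x \<le> 1 \<Longrightarrow> \<phi> x = 1"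
  using generator by (auto simp: resolution_generator_def)

lemma generator_zero: "norm x > 2 \<Longrightarrow> \<phi> x = 0"
  using generator outside_supp[of x \<phi>] by (force simp: resolution_generator_def)

text \<open>The telescoped partial sum of the resolution up to index \<open>J\<close>.\<close>

definition low :: "nat \<Rightarrow> real^'n \<Rightarrow> complex" where
  "low J x = \<phi> ((1 / 2 ^ J) *\<^sub>R x)"

lemma schwartz_low: "low J \<in> schwartz"
  unfolding low_def[abs_def] by (intro schwartz_scale schwartz_generator) simp

lemma resolution_0: "resolution \<phi> 0 = low 0"
  by (simp add: resolution_def low_def fun_eq_iff)

lemma resolution_Suc: "resolution \<phi> (Suc J) = (\<lambda>x. low (Suc J) x - low J x)"
proof -
  have p: "(2::real) powi (- int n) = 1 / 2 ^ n" for n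
    by (simp only: power_int_minus power_int_of_nat inverse_eq_divide)
  have "- int (Suc J) + 1 = - int J" by simp
  then have "(2::real) powi (- int (Suc J)) = 1 / 2 ^ Suc J" "(2::real) powi (- int (Suc J) + 1) = 1 / 2 ^ J"
    by (simp_all only: p)
  then show ?thesis unfolding resolution_def low_def by (simp only: nat.distinct if_False)
qed

lemma schwartz_resolution: "resolution \<phi> j \<in> schwartz"
proof (cases j)
  case 0 then show ?thesis using schwartz_low by (simp add: resolution_0)
next
  case (Suc i) then show ?thesis using schwartz_diff[OF schwartz_low schwartz_low] by (simp add: resolution_Suc)
qed

text \<open>The function \<open>resolution \<phi> j\<close> vanishes outside the ball of radius
  \<open>2 ^ Suc j\<close>, which is where \<open>low (Suc j)\<close> equals 1; \<open>low j\<close>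
  is known to be 1 only on half that radius. This makes \<open>kern (low (Suc j))\<close> a
  reproducing kernel for the pieces.\<close>

lemma resolution_mult_low: "resolution \<phi> j x * low (Suc j) x = resolution \<phi> j x"
proof (cases "norm x \<le> 2 ^ Suc j")
  case True
  then have "low (Suc j) x = 1" unfolding low_def
    by (intro generator_one) (simp add: field_simps)
  then show ?thesis by simp
next
  case False
  then have z: "low i x = 0" if "i \<le> j" for i
  proof -
    have "(2::real) ^ Suc i \<le> 2 ^ Suc j" using that by (intro power_increasing) auto
    then have "2 ^ Suc i < norm x" using False by linarith
    then have "2 * 2 ^ i < norm x" by simp
    then show ?thesis unfolding low_def by (intro generator_zero) (simp add: field_simps)
  qed
  show ?thesis
  proof (cases j)
    case 0 then show ?thesis using z by (simp add: resolution_0)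
  next
    case (Suc i)
    then show ?thesis using z[of j] z[of i] by (simp add: resolution_Suc)
  qed
qed

lemma kern_low: "kern (low J) = (\<lambda>x. of_real ((2 ^ J) ^ CARD('n)) * kern \<phi> ((2 ^ J) *\<^sub>R x))"
  unfolding kern_def low_def[abs_def]
  by (intro ext) (subst ft_scale[OF schwartz_borel[OF schwartz_generator]], auto simp: power_one_over)

text \<open>The explicit form of \<open>lp_piece\<close>, free of the description operator.\<close>

definition piece :: "'n functional \<Rightarrow> nat \<Rightarrow> real^'n \<Rightarrow> complex" where
  "piece T j y = T (\<lambda>x. kern (resolution \<phi> j) (x - y))"

lemma lp_piece_eq: "T \<in> tempered_distributions \<Longrightarrow> lp_piece \<phi> j T = piece T j"
  unfolding lp_piece_def piece_def[abs_def] by (rule fun_of_dist_multiplier[OF _ schwartz_resolution generator])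

lemma piece_continuous: "T \<in> tempered_distributions \<Longrightarrow> continuous_on UNIV (piece T j)"
  unfolding piece_def[abs_def] by (intro tempered_translates_continuous schwartz_kern schwartz_resolution)

lemma piece_borel [measurable]: "T \<in> tempered_distributions \<Longrightarrow> piece T j \<in> borel_measurable borel"
  by (intro borel_measurable_continuous_onI piece_continuous)

lemma piece_growth:
  assumes "T \<in> tempered_distributions"
  obtains B m where "B > 0" "\<And>y. norm (piece T j y) \<le> B * (1 + norm y) ^ m"
  unfolding piece_def
  using tempered_translates_growth[OF assms schwartz_kern[OF schwartz_resolution]] by metis

lemma sum_pieces:
  assumes T: "T \<in> tempered_distributions" and \<psi>: "\<psi> \<in> schwartz"
  shows "(\<Sum>j\<le>J. \<integral>y. piece T j y * \<psi> y \<partial>lborel) = T (conv (kern (low J)) \<psi>)"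
proof -
  have p: "(\<integral>y. piece T j y * \<psi> y \<partial>lborel) = T (conv (kern (resolution \<phi> j)) \<psi>)" for j
    unfolding piece_def
    using tempered_conv[OF T schwartz_kern[OF schwartz_resolution] schwartz_borel[OF \<psi>] schwartz_rapid[OF \<psi>]] by simp
  show ?thesis
  proof (induction J)
    case 0 show ?case by (simp add: p resolution_0)
  next
    case (Suc J)
    have "T (conv (kern (resolution \<phi> (Suc J))) \<psi>) = T (conv (kern (low (Suc J))) \<psi>) - T (conv (kern (low J)) \<psi>)"
      unfolding resolution_Suc kern_diff[OF schwartz_low schwartz_low]
        conv_diff_left[OF schwartz_kern[OF schwartz_low] schwartz_kern[OF schwartz_low] \<psi>]
      by (intro tempered_diff[OF T] schwartz_conv schwartz_kern schwartz_low schwartz_borel schwartz_rapid \<psi>)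
    then show ?case using Suc by (simp add: p)
  qed
qed

text \<open>The factor \<open>\<gamma>\<close> arises twice from the same inversion constant: as the
  integral of \<open>kern \<phi>\<close>, by inversion at 0 where \<open>\<phi>\<close> is 1, and in
  the convolution of two kernels.\<close>

lemma sum_pieces_tendsto_and_reproducing:
  obtains \<gamma> where "\<gamma> \<noteq> 0"
    "\<And>T \<psi>. T \<in> tempered_distributions \<Longrightarrow> \<psi> \<in> schwartz \<Longrightarrow>
      (\<lambda>J. \<Sum>j\<le>J. \<integral>y. piece T j y * \<psi> y \<partial>lborel) \<longlonglongrightarrow> \<gamma> * T \<psi>"
    "\<And>T j y. T \<in> tempered_distributions \<Longrightarrow>
      \<gamma> * piece T j y = (\<integral>z. piece T j z * kern (low (Suc j)) (z - y) \<partial>lborel)"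
proof -
  obtain c where c: "c \<noteq> 0"
    "\<And>\<theta> x. \<theta> \<in> schwartz \<Longrightarrow> (\<integral>\<xi>. cis (x \<bullet> \<xi>) * ft \<theta> \<xi> \<partial>lborel) = c * \<theta> (x :: real^'n)"
    using ft_inversion[OF schwartz_generator] generator_one[of 0] by auto
  define \<gamma> where "\<gamma> = of_real ((2 * pi) powr (- real CARD('n))) * c"
  have "\<gamma> \<noteq> 0" using c(1) by (simp add: \<gamma>_def)
  moreover have "(\<lambda>J. \<Sum>j\<le>J. \<integral>y. piece T j y * \<psi> y \<partial>lborel) \<longlonglongrightarrow> \<gamma> * T \<psi>"
    if T: "T \<in> tempered_distributions" and \<psi>: "\<psi> \<in> schwartz" for T \<psi>
  proof -
    have "(\<integral>x. kern \<phi> x \<partial>lborel) = \<gamma>"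
      using c(2)[OF schwartz_generator, of 0] generator_one[of 0] by (simp add: kern_def \<gamma>_def)
    then show ?thesis unfolding sum_pieces[OF T \<psi>] kern_low
      using tempered_approximate_identity[OF T \<psi>, of "kern \<phi>"] schwartz_kern[OF schwartz_generator]
      by (simp add: schwartz_borel schwartz_rapid)
  qed
  moreover have "\<gamma> * piece T j y = (\<integral>z. piece T j z * kern (low (Suc j)) (z - y) \<partial>lborel)"
    if T: "T \<in> tempered_distributions" for T j y
  proof -
    let ?m = "kern (resolution \<phi> j)" and ?n = "kern (low (Suc j))"
    have ms: "?m \<in> schwartz" and ns: "?n \<in> schwartz"
      by (intro schwartz_kern schwartz_resolution schwartz_low)+
    note [measurable] = schwartz_borel[OF ms] schwartz_borel[OF ns]
    have nt: "(\<lambda>z. ?n (z - y)) \<in> schwartz" by (rule schwartz_translate[OF ns])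
    \<comment> \<open>Convolution commutes with translation, so the reproducing identity of the
      kernels holds around every \<open>y\<close>; applying \<open>T\<close> to it yields the
      formula for the pieces.\<close>
    have cv: "conv ?m (\<lambda>z. ?n (z - y)) x = \<gamma> * ?m (x - y)" for x
    proof -
      have "conv ?m (\<lambda>z. ?n (z - y)) x = (\<integral>z. (\<lambda>w. ?m (x - y - w) * ?n w) (z - y) \<partial>lborel)"
        unfolding conv_def by (simp add: algebra_simps)
      also have "\<dots> = conv ?m ?n (x - y)"
        unfolding conv_def by (rule lborel_integral_translate) measurable
      also have "\<dots> = \<gamma> * ?m (x - y)"
        using conv_kern[OF schwartz_resolution schwartz_low c(2), of j "Suc j"]
        by (simp add: resolution_mult_low \<gamma>_def)
      finally show ?thesis .
    qed
    have "\<gamma> * piece T j y = T (\<lambda>x. \<gamma> * ?m (x - y))"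
      unfolding piece_def by (rule tempered_cmult[OF T schwartz_translate[OF ms], symmetric])
    also have "\<dots> = T (conv ?m (\<lambda>z. ?n (z - y)))" unfolding cv[symmetric] ..
    also have "\<dots> = (\<integral>z. piece T j z * ?n (z - y) \<partial>lborel)"
      unfolding piece_def by (rule tempered_conv[OF T ms schwartz_borel[OF nt] schwartz_rapid[OF nt]])
    finally show ?thesis .
  qed
  ultimately show thesis using that by blast
qed

end

section \<open>Dyadic cubes\<close>

text \<open>In this form the cubes of one scale are the fibres of a map, hence a partition of the
  space.\<close>

lemma dyadic_cube_eq: "dyadic_cube j (k :: int^'n) = {x. \<forall>i. k $ i = \<lfloor>2 powi j * x $ i\<rfloor>}"
proof (intro set_eqI iffI)
  have e: "(2::real) powi j * 2 powi (- j) = 1" by (simp add: power_int_minus)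
  fix x :: "real^'n"
  show "x \<in> {x. \<forall>i. k $ i = \<lfloor>2 powi j * x $ i\<rfloor>}" if "x \<in> dyadic_cube j k"
  proof -
    from that obtain z where z: "\<forall>i. 0 \<le> z $ i \<and> z $ i < 1" and x: "x = (2 powi (- j)) *\<^sub>R (z + (\<chi> i. of_int (k $ i)))"
      unfolding dyadic_cube_def by blast
    have "2 powi j * x $ i = z $ i + of_int (k $ i)" for i
      using e by (simp add: x mult.assoc[symmetric])
    then show ?thesis using z by (auto simp: floor_eq_iff)
  qed
  show "x \<in> dyadic_cube j k" if "x \<in> {x. \<forall>i. k $ i = \<lfloor>2 powi j * x $ i\<rfloor>}"
  proof -
    define z where "z = (2 powi j) *\<^sub>R x - (\<chi> i. of_int (k $ i))"
    have "\<forall>i. 0 \<le> z $ i \<and> z $ i < 1"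
      using that by (simp add: z_def) linarith
    moreover have "x = (2 powi (- j)) *\<^sub>R (z + (\<chi> i. of_int (k $ i)))"
      using e by (simp add: z_def mult.commute)
    ultimately show ?thesis unfolding dyadic_cube_def by blast
  qed
qed

lemma dyadic_cube_interval:
  "dyadic_cube j (k :: int^'n) = {x. \<forall>i. of_int (k $ i) / 2 powi j \<le> x $ i \<and> x $ i < (of_int (k $ i) + 1) / 2 powi j}"
proof -
  have p: "(2::real) powi j > 0" by simp
  have "(m = \<lfloor>2 powi j * r\<rfloor>) = (of_int m / 2 powi j \<le> r \<and> r < (of_int m + 1) / 2 powi j)" for m and r :: real
  proof -
    have "(m = \<lfloor>2 powi j * r\<rfloor>) = (of_int m \<le> 2 powi j * r \<and> 2 powi j * r < of_int m + 1)"
      by (metis floor_eq_iff)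
    then show ?thesis by (simp add: pos_divide_le_eq[OF p] pos_less_divide_eq[OF p] mult.commute)
  qed
  then show ?thesis unfolding dyadic_cube_eq by simp
qed

lemma dyadic_cube_borel [measurable]: "dyadic_cube j (k :: int^'n) \<in> sets borel"
proof -
  have "dyadic_cube j k = (\<Inter>i. {x. of_int (k $ i) / 2 powi j \<le> x $ i} \<inter> {x. x $ i < (of_int (k $ i) + 1) / 2 powi j})"
    unfolding dyadic_cube_interval by auto
  also have "\<dots> \<in> sets borel"
    by (intro sets.countable_INT sets.Int borel_closed borel_open closed_Collect_le open_Collect_less continuous_intros) auto
  finally show ?thesis .
qed

text \<open>The half-open cube lies between an open and a closed box of equal volume.\<close>

lemma emeasure_dyadic_cube:
  "emeasure lborel (dyadic_cube j k :: (real^'n) set) = ennreal ((1 / 2 powi j) ^ CARD('n))"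
proof -
  define a b :: "real^'n" where "a = (\<chi> i. of_int (k $ i) / 2 powi j)" and "b = (\<chi> i. (of_int (k $ i) + 1) / 2 powi j)"
  have ab: "a \<bullet> i \<le> b \<bullet> i" if "i \<in> Basis" for i
    using that by (auto simp: a_def b_def Basis_vec_def inner_axis intro!: divide_right_mono)
  have d: "(\<Prod>i\<in>Basis. (b - a) \<bullet> i) = (1 / 2 powi j) ^ CARD('n)"
  proof -
    have "(b - a) \<bullet> i = 1 / 2 powi j" if "i \<in> Basis" for i
      using that by (auto simp: a_def b_def Basis_vec_def inner_axis diff_divide_distrib[symmetric])
    then show ?thesis by simp
  qed
  have "box a b \<subseteq> dyadic_cube j k" "dyadic_cube j k \<subseteq> cbox a b"
    unfolding dyadic_cube_interval by (auto simp: mem_box_cart a_def b_def less_imp_le)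
  then have "emeasure lborel (box a b) \<le> emeasure lborel (dyadic_cube j k)"
    "emeasure lborel (dyadic_cube j k) \<le> emeasure lborel (cbox a b)"
    by (auto intro!: emeasure_mono)
  then show ?thesis
    using ab by (simp add: emeasure_lborel_box emeasure_lborel_cbox d)
qed

lemma measure_dyadic_cube:
  "measure lebesgue (dyadic_cube j k :: (real^'n) set) = (1 / 2 powi j) ^ CARD('n)"
  using emeasure_dyadic_cube[of j k] by (simp add: measure_def)

lemma dyadic_cube_norm_diff:
  fixes x y :: "real^'n"
  assumes "x \<in> dyadic_cube j k" "y \<in> dyadic_cube j k"
  shows "2 powi j * norm (x - y) \<le> CARD('n)"
proof -
  have "2 powi j * norm (x - y) = norm ((2 powi j) *\<^sub>R (x - y))" by simp
  also have "\<dots> \<le> (\<Sum>i\<in>UNIV. \<bar>((2 powi j) *\<^sub>R (x - y)) $ i\<bar>)" by (rule norm_le_l1_cart)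
  also have "\<dots> \<le> (\<Sum>i\<in>(UNIV::'n set). 1)"
  proof (rule sum_mono)
    fix i
    have "k $ i = \<lfloor>2 powi j * x $ i\<rfloor>" "k $ i = \<lfloor>2 powi j * y $ i\<rfloor>"
      using assms unfolding dyadic_cube_eq by auto
    then have "\<bar>2 powi j * x $ i - 2 powi j * y $ i\<bar> \<le> 1" by linarith
    then show "\<bar>((2 powi j) *\<^sub>R (x - y)) $ i\<bar> \<le> 1" by (simp add: right_diff_distrib)
  qed
  finally show ?thesis by simp
qed

lemma nn_integral_dyadic_sum:
  fixes f :: "real^'n \<Rightarrow> ennreal"
  assumes [measurable]: "f \<in> borel_measurable borel"
  shows "(\<integral>\<^sup>+x. f x \<partial>lborel) = (\<integral>\<^sup>+k. (\<integral>\<^sup>+x\<in>dyadic_cube j k. f x \<partial>lborel) \<partial>count_space UNIV)"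
proof -
  have U: "(\<Union>k. dyadic_cube j k) = (UNIV :: (real^'n) set)"
  proof -
    have "x \<in> dyadic_cube j (\<chi> i. \<lfloor>2 powi j * x $ i\<rfloor>)" for x :: "real^'n" by (simp add: dyadic_cube_eq)
    then show ?thesis by blast
  qed
  have "disjoint_family (\<lambda>k. dyadic_cube j k :: (real^'n) set)"
    unfolding disjoint_family_on_def dyadic_cube_eq by (auto simp: vec_eq_iff)
  then have "emeasure (density lborel f) (\<Union>k. dyadic_cube j k) = (\<integral>\<^sup>+k. emeasure (density lborel f) (dyadic_cube j k) \<partial>count_space UNIV)"
    by (intro emeasure_UN_countable) auto
  then show ?thesis unfolding U by (simp add: emeasure_density)
qed

lemma nn_integral_affine:
  fixes f :: "'a::euclidean_space \<Rightarrow> ennreal"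
  assumes [measurable]: "f \<in> borel_measurable borel" and t: "t > 0"
  shows "(\<integral>\<^sup>+x. f (t *\<^sub>R (x - a)) \<partial>lborel) = ennreal ((1 / t) ^ DIM('a)) * (\<integral>\<^sup>+x. f x \<partial>lborel)"
proof -
  have "(\<integral>\<^sup>+x. f (t *\<^sub>R (x - a)) \<partial>lborel)
      = (\<integral>\<^sup>+x. f (t *\<^sub>R (x - a)) \<partial>density (distr lborel borel (\<lambda>x. a + (1 / t) *\<^sub>R x)) (\<lambda>_. ennreal (\<bar>1 / t\<bar> ^ DIM('a))))"
    using lborel_affine[of "1 / t" a] t by simp
  also have "\<dots> = (\<integral>\<^sup>+x. ennreal (\<bar>1 / t\<bar> ^ DIM('a)) * f x \<partial>lborel)"
    using t by (subst nn_integral_density, simp, simp, subst nn_integral_distr) auto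
  also have "\<dots> = ennreal ((1 / t) ^ DIM('a)) * (\<integral>\<^sup>+x. f x \<partial>lborel)"
    using t by (simp add: nn_integral_cmult)
  finally show ?thesis .
qed

text \<open>A bound for means at the single scale \<open>2 ^ -j\<close>, multiplied out to avoid
  quotients of extended reals.\<close>

definition cube_mean_le :: "nat \<Rightarrow> ennreal \<Rightarrow> (real^'n \<Rightarrow> ennreal) \<Rightarrow> bool" where
  "cube_mean_le j A V \<longleftrightarrow>
    (\<forall>k. (\<integral>\<^sup>+x\<in>dyadic_cube (int j) k. V x \<partial>lborel) \<le> A * emeasure lborel (dyadic_cube (int j) k))"

text \<open>The weight varies by at most a constant factor on each cube of the scale \<open>2\<^sup>-\<^sup>j\<close>.\<close>

lemma nn_integral_dyadic_weight:
  obtains C :: real where "C > 0"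
    "\<And>(V :: real^'n \<Rightarrow> ennreal) j A y. V \<in> borel_measurable borel \<Longrightarrow>
      cube_mean_le j A V \<Longrightarrow>
      (\<integral>\<^sup>+z. V z * ennreal (2 ^ (j * CARD('n)) / (1 + 2 ^ j * norm (z - y)) ^ (CARD('n) + 1)) \<partial>lborel) \<le> ennreal C * A"
proof -
  let ?d = "CARD('n)"
  define I where "I = (\<integral>x. 1 / (1 + norm (x :: real^'n)) ^ (?d + 1) \<partial>lborel)"
  define c where "c = (1 + real ?d) ^ (?d + 1)"
  have I0: "I \<ge> 0" unfolding I_def by (intro integral_nonneg_AE) (auto intro!: AE_I2 divide_nonneg_nonneg)
  have nI: "(\<integral>\<^sup>+x. ennreal (1 / (1 + norm (x :: real^'n)) ^ (?d + 1)) \<partial>lborel) = ennreal I"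
    unfolding I_def using integrable_weight[where 'a = "real^'n"]
    by (intro nn_integral_eq_integral) (auto intro!: AE_I2 divide_nonneg_nonneg)
  have c0: "c > 0" by (auto simp: c_def)
  have main: "(\<integral>\<^sup>+z. V z * ennreal (2 ^ (j * ?d) / (1 + 2 ^ j * norm (z - y)) ^ (?d + 1)) \<partial>lborel) \<le> ennreal (c * I + 1) * A"
    if V [measurable]: "V \<in> borel_measurable borel"
      and VA: "cube_mean_le j A V"
    for V :: "real^'n \<Rightarrow> ennreal" and j A y
  proof -
    define w where "w z = 2 ^ (j * ?d) / (1 + 2 ^ j * norm (z - y)) ^ (?d + 1)" for z
    have wp: "w z > 0" for z unfolding w_def by (intro divide_pos_pos zero_less_power add_pos_nonneg) auto
    have [measurable]: "w \<in> borel_measurable borel" unfolding w_def[abs_def] by measurable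
    have wle: "w z \<le> c * w z'" if "z \<in> dyadic_cube (int j) k" "z' \<in> dyadic_cube (int j) k" for z z' k
    proof -
      have "2 ^ j * norm (z' - z) \<le> ?d"
        using dyadic_cube_norm_diff[OF that(2,1)] by simp
      moreover have "norm (z' - y) \<le> norm (z' - z) + norm (z - y)"
        using norm_triangle_ineq[of "z' - z" "z - y"] by simp
      then have "2 ^ j * norm (z' - y) \<le> 2 ^ j * (norm (z' - z) + norm (z - y))" by simp
      ultimately have "1 + 2 ^ j * norm (z' - y) \<le> 1 + real ?d + 2 ^ j * norm (z - y)"
        by (simp only: distrib_left)
      also have "\<dots> \<le> (1 + real ?d) * (1 + 2 ^ j * norm (z - y))" by (simp add: algebra_simps)
      finally have "(1 + 2 ^ j * norm (z' - y)) ^ (?d + 1) \<le> ((1 + real ?d) * (1 + 2 ^ j * norm (z - y))) ^ (?d + 1)"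
        by (intro power_mono) auto
      also have "\<dots> = c * (1 + 2 ^ j * norm (z - y)) ^ (?d + 1)" unfolding c_def by (rule power_mult_distrib)
      finally have le: "(1 + 2 ^ j * norm (z' - y)) ^ (?d + 1) \<le> c * (1 + 2 ^ j * norm (z - y)) ^ (?d + 1)" .
      have p: "0 < (1 + 2 ^ j * norm (z' - y)) ^ (?d + 1)" "0 < (1 + 2 ^ j * norm (z - y)) ^ (?d + 1)"
        by (intro zero_less_power add_pos_nonneg; simp)+
      have "1 / (1 + 2 ^ j * norm (z - y)) ^ (?d + 1) \<le> c / (1 + 2 ^ j * norm (z' - y)) ^ (?d + 1)"
        using le p by (simp only: pos_divide_le_eq pos_le_divide_eq times_divide_eq_left mult_1_left)
      then have "2 ^ (j * ?d) * (1 / (1 + 2 ^ j * norm (z - y)) ^ (?d + 1)) \<le> 2 ^ (j * ?d) * (c / (1 + 2 ^ j * norm (z' - y)) ^ (?d + 1))"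
        by (intro mult_left_mono) auto
      then show ?thesis unfolding w_def by (simp only: times_divide_eq_right mult_1_right mult.commute)
    qed
    have cube: "(\<integral>\<^sup>+z\<in>dyadic_cube (int j) k. V z * ennreal (w z) \<partial>lborel) \<le> ennreal c * A * (\<integral>\<^sup>+z\<in>dyadic_cube (int j) k. ennreal (w z) \<partial>lborel)" for k
    proof -
      let ?Q = "dyadic_cube (int j) k :: (real^'n) set"
      let ?X = "\<integral>\<^sup>+z\<in>?Q. V z * ennreal (w z) \<partial>lborel"
      let ?m = "emeasure lborel ?Q"
      have m: "?m \<noteq> 0" "?m \<noteq> top" by (auto simp: emeasure_dyadic_cube)
      have X: "?X \<le> ennreal c * A * ?m * ennreal (w z')" if z': "z' \<in> ?Q" for z'
      proof -
        have "?X \<le> (\<integral>\<^sup>+z. ennreal (c * w z') * (V z * indicator ?Q z) \<partial>lborel)"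
          using wle[OF _ z'] by (intro nn_integral_mono) (auto simp: indicator_def mult.commute intro!: mult_left_mono ennreal_leI)
        also have "\<dots> = ennreal (c * w z') * (\<integral>\<^sup>+z\<in>?Q. V z \<partial>lborel)" by (rule nn_integral_cmult) measurable
        also have "\<dots> \<le> ennreal (c * w z') * (A * ?m)" by (intro mult_left_mono VA[unfolded cube_mean_le_def, rule_format]) auto
        also have "\<dots> = ennreal c * A * ?m * ennreal (w z')"
          using c0 wp[of z'] by (simp add: ennreal_mult less_imp_le mult_ac)
        finally show ?thesis .
      qed
      \<comment> \<open>\<open>X\<close> holds for every point \<open>z'\<close> of the cube.
        Integrating it over \<open>z'\<close> and cancelling the measure of the cube replaces the
        value of \<open>w\<close> by its integral.\<close>
      have "?X * ?m = (\<integral>\<^sup>+z'\<in>?Q. ?X \<partial>lborel)" by (simp add: nn_integral_cmult_indicator)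
      also have "\<dots> \<le> (\<integral>\<^sup>+z'. ennreal c * A * ?m * (ennreal (w z') * indicator ?Q z') \<partial>lborel)"
        using X by (intro nn_integral_mono) (auto simp: indicator_def)
      also have "\<dots> = ennreal c * A * ?m * (\<integral>\<^sup>+z'\<in>?Q. ennreal (w z') \<partial>lborel)"
        by (rule nn_integral_cmult) measurable
      finally have "?m * ?X \<le> ?m * (ennreal c * A * (\<integral>\<^sup>+z'\<in>?Q. ennreal (w z') \<partial>lborel))" by (simp add: mult_ac)
      then show ?thesis using m by (simp add: ennreal_mult_le_mult_iff)
    qed
    have "(\<integral>\<^sup>+z. V z * ennreal (w z) \<partial>lborel)
        = (\<integral>\<^sup>+k. (\<integral>\<^sup>+z\<in>dyadic_cube (int j) k. V z * ennreal (w z) \<partial>lborel) \<partial>count_space UNIV)"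
      by (rule nn_integral_dyadic_sum) measurable
    also have "\<dots> \<le> (\<integral>\<^sup>+k. ennreal c * A * (\<integral>\<^sup>+z\<in>dyadic_cube (int j) k. ennreal (w z) \<partial>lborel) \<partial>count_space UNIV)"
      by (intro nn_integral_mono cube)
    also have "\<dots> = ennreal c * A * (\<integral>\<^sup>+k. (\<integral>\<^sup>+z\<in>dyadic_cube (int j) k. ennreal (w z) \<partial>lborel) \<partial>count_space UNIV)"
      by (rule nn_integral_cmult) simp
    also have "(\<integral>\<^sup>+k. (\<integral>\<^sup>+z\<in>dyadic_cube (int j) k. ennreal (w z) \<partial>lborel) \<partial>count_space UNIV) = (\<integral>\<^sup>+z. ennreal (w z) \<partial>lborel)"
      by (rule nn_integral_dyadic_sum[symmetric]) measurable
    \<comment> \<open>Rescaling by \<open>2 ^ j\<close> shows that the total mass of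
      \<open>w\<close> depends neither on \<open>j\<close> nor on \<open>y\<close>.\<close>
    also have "\<dots> = (\<integral>\<^sup>+z. ennreal (2 ^ (j * ?d)) * ennreal (1 / (1 + norm ((2 ^ j) *\<^sub>R (z - y))) ^ (?d + 1)) \<partial>lborel)"
      unfolding w_def by (intro nn_integral_cong, subst ennreal_mult[symmetric]) (auto intro!: divide_nonneg_nonneg)
    also have "\<dots> = ennreal (2 ^ (j * ?d)) * (\<integral>\<^sup>+z. ennreal (1 / (1 + norm ((2 ^ j) *\<^sub>R (z - y))) ^ (?d + 1)) \<partial>lborel)"
      by (rule nn_integral_cmult) measurable
    also have "(\<integral>\<^sup>+z. ennreal (1 / (1 + norm ((2 ^ j) *\<^sub>R (z - y))) ^ (?d + 1)) \<partial>lborel) = ennreal ((1 / 2 ^ j) ^ DIM(real^'n)) * ennreal I"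
      unfolding nI[symmetric] by (rule nn_integral_affine) auto
    also have "ennreal (2 ^ (j * ?d)) * (ennreal ((1 / 2 ^ j) ^ DIM(real^'n)) * ennreal I) = ennreal I"
      using I0 by (simp add: mult.assoc[symmetric] ennreal_mult[symmetric] power_mult power_one_over)
    also have "ennreal c * A * ennreal I = ennreal (c * I) * A"
      using c0 I0 by (simp add: ennreal_mult mult_ac)
    \<comment> \<open>Adding 1 makes the constant positive from \<open>I \<ge> 0\<close>
      alone.\<close>
    also have "\<dots> \<le> ennreal (c * I + 1) * A" by (intro mult_right_mono ennreal_leI) auto
    finally show ?thesis unfolding w_def .
  qed
  show thesis
    by (rule that[of "c * I + 1"]) (use main c0 I0 in \<open>auto intro: add_nonneg_pos\<close>)
qed

section \<open>A pointwise estimate for the exponential Orlicz function\<close>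

text \<open>\<open>2 * y \<le> exp (2 * y)\<close>, raised to the power \<open>p\<close>, absorbs
  the power of \<open>y\<close> into the exponential. The 2 is chosen for the gain
  \<open>2 powr (- p)\<close>: it leaves room for an additive constant in the exponent when the
  bound \<open>t powr p\<close> is needed with \<open>t\<close> close to 1.\<close>

lemma powr_exp_le:
  fixes y p :: real
  assumes "0 \<le> y" "0 < p"
  shows "y powr p * exp y \<le> 2 powr (- p) * exp ((2 * p + 1) * y)"
proof -
  have "2 * y \<le> exp (2 * y)" using exp_ge_add_one_self[of "2 * y"] by linarith
  then have "(2 * y) powr p \<le> exp (2 * y) powr p" using assms by (intro powr_mono2) auto
  then have "2 powr p * y powr p \<le> exp (2 * y * p)" using assms by (simp add: powr_mult exp_powr_real)
  then have "y powr p \<le> 2 powr (- p) * exp (2 * y * p)"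
    by (simp add: powr_minus field_simps)
  then have "y powr p * exp y \<le> 2 powr (- p) * exp (2 * y * p) * exp y" by (rule mult_right_mono) auto
  also have "\<dots> = 2 powr (- p) * exp ((2 * p + 1) * y)"
    by (simp add: mult.assoc algebra_simps flip: exp_add)
  finally show ?thesis .
qed

lemma Phi_p1_mono: "0 < p \<Longrightarrow> 0 \<le> x \<Longrightarrow> x \<le> y \<Longrightarrow> Phi_p1 p x \<le> Phi_p1 p y"
  unfolding Phi_p1_def by (intro mult_mono powr_mono2) auto

text \<open>For \<open>t \<le> 1\<close> the geometric sum gives
  \<open>S / \<Lambda> \<le> exp (- 1 / p) * t\<close>; the power \<open>p\<close> of this gains
  \<open>exp (- 1)\<close>, which pays for \<open>exp (S / \<Lambda>) \<le> exp 1\<close>. For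
  \<open>t > 1\<close> the bound \<open>C\<close> is used until the geometric bound falls below 1,
  so \<open>S\<close> grows only logarithmically in \<open>t\<close> and the exponential turns it
  back into a power.\<close>

lemma Phi_p1_truncated_geometric_sum:
  fixes \<rho> C p :: real
  assumes \<rho>: "0 < \<rho>" "\<rho> < 1" and C: "0 \<le> C" and p: "0 < p"
  obtains \<Lambda> where "\<Lambda> > 0"
    "\<And>t a. 0 \<le> t \<Longrightarrow> (\<And>j. 0 \<le> a j \<and> a j \<le> C \<and> a j \<le> \<rho> ^ j * t) \<Longrightarrow>
      summable a \<and> Phi_p1 p (suminf a / \<Lambda>) \<le> t powr p"
proof -
  define g where "g = 1 / (1 - \<rho>)"
  define L where "L = 1 / ln (1 / \<rho>)"
  \<comment> \<open>The first summand serves \<open>t \<le> 1\<close>. For \<open>t > 1\<close> the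
    second makes the constant part of the exponent at most \<open>p * ln 2\<close>, the gain of
    \<open>powr_exp_le\<close>, and the third makes the coefficient of \<open>ln t\<close> at most
    \<open>p\<close>.\<close>
  define \<Lambda> where "\<Lambda> = g * exp (1 / p) + (2 * p + 1) * (C + g) / (p * ln 2) + (2 * p + 1) * (C * L) / p"
  have g: "g > 0" using \<rho> by (simp add: g_def)
  have L: "L > 0" using \<rho> by (simp add: L_def)
  have l2: "ln (2::real) > 0" by simp
  have t1: "0 < g * exp (1 / p)" "0 \<le> (2 * p + 1) * (C + g) / (p * ln 2)" "0 \<le> (2 * p + 1) * (C * L) / p"
    using g C p L by auto
  have \<Lambda>: "\<Lambda> > 0" "g * exp (1 / p) \<le> \<Lambda>" "(2 * p + 1) * (C + g) / (p * ln 2) \<le> \<Lambda>" "(2 * p + 1) * (C * L) / p \<le> \<Lambda>"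
    unfolding \<Lambda>_def using t1 by linarith+
  have geo: "(\<lambda>j. \<rho> ^ j * s) sums (g * s)" for s
    using geometric_sums[of \<rho>] \<rho> unfolding g_def by (intro sums_mult2) auto
  have "summable a \<and> Phi_p1 p (suminf a / \<Lambda>) \<le> t powr p"
    if t: "0 \<le> t" and a: "\<And>j. 0 \<le> a j \<and> a j \<le> C \<and> a j \<le> \<rho> ^ j * t" for t a
  proof
    show sa: "summable a"
      by (rule summable_comparison_test'[OF sums_summable[OF geo[of t]], of 0]) (use a in auto)
    define S where "S = suminf a"
    have S0: "S \<ge> 0" unfolding S_def using a sa by (intro suminf_nonneg) auto
    have y0: "S / \<Lambda> \<ge> 0" using S0 \<Lambda> by simp
    show "Phi_p1 p (suminf a / \<Lambda>) \<le> t powr p"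
    proof (cases "t \<le> 1")
      case True
      have "S \<le> g * t" unfolding S_def sums_unique[OF geo]
        by (intro suminf_le sa sums_summable[OF geo]) (use a in auto)
      also have "g * t = (g * exp (1 / p)) * (exp (- (1 / p)) * t)" by (simp add: exp_minus)
      also have "\<dots> \<le> \<Lambda> * (exp (- (1 / p)) * t)" using \<Lambda>(2) t by (intro mult_right_mono) auto
      finally have y: "S / \<Lambda> \<le> exp (- (1 / p)) * t" using \<Lambda>(1) by (simp add: pos_divide_le_eq mult.commute)
      have "exp (- (1 / p)) * t \<le> 1 * 1" using True t p by (intro mult_mono) auto
      then have "S / \<Lambda> \<le> 1" using y by linarith
      then have "Phi_p1 p (S / \<Lambda>) \<le> (exp (- (1 / p)) * t) powr p * exp 1"
        unfolding Phi_p1_def using y y0 p by (intro mult_mono powr_mono2) auto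
      also have "\<dots> = t powr p" using p t by (simp add: powr_mult exp_powr_real mult.commute mult.left_commute flip: exp_add)
      finally show ?thesis unfolding S_def .
    next
      case False
      \<comment> \<open>The least \<open>n\<close> with \<open>\<rho> ^ n * t \<le> 1\<close>: from
        there on the geometric bound sums to at most \<open>g\<close>.\<close>
      define n where "n = nat \<lceil>L * ln t\<rceil>"
      have lt: "ln t > 0" using False by simp
      have "L * ln t > 0" using L lt by simp
      then have n: "L * ln t \<le> real n" "real n \<le> L * ln t + 1"
        unfolding n_def by linarith+
      have "\<rho> ^ n * t \<le> 1"
      proof -
        have lr: "ln (1 / \<rho>) > 0" using \<rho> by simp
        have "ln t = L * ln t * ln (1 / \<rho>)" using lr by (simp add: L_def)
        also have "\<dots> \<le> real n * ln (1 / \<rho>)" using n(1) lr by (intro mult_right_mono) auto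
        also have "\<dots> = ln ((1 / \<rho>) ^ n)" using \<rho> by (simp add: ln_realpow)
        finally have "t \<le> (1 / \<rho>) ^ n" using False \<rho> by (subst (asm) ln_le_cancel_iff) auto
        then show ?thesis using \<rho> by (simp add: power_one_over field_simps)
      qed
      have "S = (\<Sum>j. a (j + n)) + (\<Sum>j<n. a j)"
        unfolding S_def using suminf_split_initial_segment[OF sa] .
      also have "(\<Sum>j<n. a j) \<le> real n * C" using sum_bounded_above[of "{..<n}" a C] a by simp
      also have "(\<Sum>j. a (j + n)) \<le> g * (\<rho> ^ n * t)"
        unfolding sums_unique[OF geo[of "\<rho> ^ n * t"]]
      proof (intro suminf_le summable_ignore_initial_segment sa sums_summable[OF geo])
        show "a (j + n) \<le> \<rho> ^ j * (\<rho> ^ n * t)" for j using a[of "j + n"] by (simp add: power_add mult.assoc)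
      qed
      also have "g * (\<rho> ^ n * t) \<le> g * 1" using g \<open>\<rho> ^ n * t \<le> 1\<close> by (intro mult_left_mono) auto
      finally have "S \<le> g + real n * C" by simp
      also have "\<dots> \<le> g + (L * ln t + 1) * C" using n(2) C by (intro add_left_mono mult_right_mono) auto
      finally have S: "S \<le> (C + g) + C * L * ln t" by (simp add: algebra_simps)
      have A: "(2 * p + 1) * (C + g) \<le> \<Lambda> * (p * ln 2)"
        using \<Lambda>(3) p l2 by (subst (asm) pos_divide_le_eq) auto
      have B: "(2 * p + 1) * (C * L) \<le> \<Lambda> * p" using \<Lambda>(4) p by (subst (asm) pos_divide_le_eq) auto
      have "(2 * p + 1) * S \<le> (2 * p + 1) * ((C + g) + C * L * ln t)" using S p by (intro mult_left_mono) auto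
      also have "\<dots> = (2 * p + 1) * (C + g) + (2 * p + 1) * (C * L) * ln t" by (simp add: algebra_simps)
      also have "\<dots> \<le> \<Lambda> * (p * ln 2) + \<Lambda> * p * ln t" using A B lt by (intro add_mono mult_right_mono) auto
      also have "\<dots> = \<Lambda> * (p * ln 2 + p * ln t)" by (simp add: algebra_simps)
      finally have "(2 * p + 1) * (S / \<Lambda>) \<le> p * ln 2 + p * ln t" using \<Lambda>(1) by (simp add: pos_divide_le_eq mult.commute)
      then have "exp ((2 * p + 1) * (S / \<Lambda>)) \<le> exp (p * ln 2 + p * ln t)" by simp
      also have "\<dots> = 2 powr p * t powr p" using False by (simp add: powr_def exp_add)
      finally have "2 powr (- p) * exp ((2 * p + 1) * (S / \<Lambda>)) \<le> 2 powr (- p) * (2 powr p * t powr p)"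
        by (intro mult_left_mono) auto
      also have "\<dots> = t powr p" by (simp add: powr_minus)
      finally show ?thesis using powr_exp_le[OF y0 p] unfolding Phi_p1_def S_def by linarith
    qed
  qed
  with \<Lambda>(1) show thesis using that by blast
qed

section \<open>Uniform bounds for the pieces\<close>

text \<open>Above the level \<open>N\<close> the factor \<open>x powr (1 - p)\<close> is at most
  \<open>N powr (1 - p)\<close>, because the exponent is not positive. For \<open>p \<ge> 1\<close>
  this takes the place of Hoelder's inequality.\<close>

lemma real_split_powr:
  fixes x N p :: real
  assumes "0 \<le> x" "0 < N" "1 \<le> p"
  shows "x \<le> N + N powr (1 - p) * x powr p"
proof (cases "x \<le> N")
  case False
  then have x: "x > 0" using assms by simp
  have "x = x powr (1 - p) * x powr p" using x by (simp flip: powr_add)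
  also have "\<dots> \<le> N powr (1 - p) * x powr p"
    using False assms by (intro mult_right_mono powr_mono2') auto
  finally show ?thesis using assms by simp
qed (simp add: add_increasing2)

context resolution_setup
begin

text \<open>The kernels are normalised dilates of the single kernel \<open>kern \<phi>\<close>. Its
  decay is used to the order \<open>d + 1 + a\<close>: the excess \<open>a\<close> absorbs the extra
  weight because the dilation factor is at least 1, so \<open>B\<close> is uniform in
  \<open>j\<close>.\<close>

lemma kern_low_bound:
  obtains B where "B > 0"
    "\<And>j w. (1 + norm w) ^ a * norm (kern (low (Suc j)) w) \<le> B * (2 ^ (j * CARD('n)) / (1 + 2 ^ j * norm w) ^ (CARD('n) + 1))"
proof -
  let ?d = "CARD('n)"
  obtain B where B: "B \<ge> 0" "\<And>x. norm (kern \<phi> x) \<le> B / (1 + norm x) ^ (?d + 1 + a)"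
    using rapid_divide[OF schwartz_rapid[OF schwartz_kern[OF schwartz_generator]]] by metis
  have "(1 + norm w) ^ a * norm (kern (low (Suc j)) w) \<le> (2 ^ ?d * B + 1) * (2 ^ (j * ?d) / (1 + 2 ^ j * norm w) ^ (?d + 1))" for j w
  proof -
    let ?v = "(2 ^ Suc j) *\<^sub>R w"
    have p: "0 < (1 + 2 ^ j * norm w) ^ (?d + 1)" "0 < (1 + norm w) ^ a"
      by (intro zero_less_power add_pos_nonneg; simp)+
    have v: "norm ?v = 2 * (2 ^ j * norm w)" by simp
    have one: "(1::real) \<le> 2 ^ j" by simp
    have v1: "norm w \<le> 2 ^ j * norm w" using mult_right_mono[OF one, of "norm w"] by simp
    have le: "(1 + 2 ^ j * norm w) ^ (?d + 1) * (1 + norm w) ^ a \<le> (1 + norm ?v) ^ (?d + 1 + a)"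
    proof -
      have "(1 + 2 ^ j * norm w) ^ (?d + 1) * (1 + norm w) ^ a \<le> (1 + norm ?v) ^ (?d + 1) * (1 + norm ?v) ^ a"
        unfolding v using v1 by (intro mult_mono power_mono) (auto intro: order_trans[OF v1])
      then show ?thesis by (simp only: power_add)
    qed
    have n: "norm (kern (low (Suc j)) w) = (2 ^ ?d * 2 ^ (j * ?d)) * norm (kern \<phi> ?v)"
      unfolding kern_low by (simp add: norm_mult norm_power power_mult power_mult_distrib del: norm_scaleR)
    have "(1 + norm w) ^ a * norm (kern (low (Suc j)) w) \<le> (1 + norm w) ^ a * ((2 ^ ?d * 2 ^ (j * ?d)) * (B / (1 + norm ?v) ^ (?d + 1 + a)))"
      unfolding n by (intro mult_left_mono B) auto
    also have "\<dots> \<le> (1 + norm w) ^ a * ((2 ^ ?d * 2 ^ (j * ?d)) * (B / ((1 + 2 ^ j * norm w) ^ (?d + 1) * (1 + norm w) ^ a)))"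
    proof (intro mult_left_mono divide_left_mono le B(1) mult_pos_pos p)
      show "0 < (1 + norm ?v) ^ (?d + 1 + a)" by (intro zero_less_power add_pos_nonneg) auto
    qed auto
    also have "\<dots> = (2 ^ ?d * B) * (2 ^ (j * ?d) / (1 + 2 ^ j * norm w) ^ (?d + 1))"
    proof -
      have "q * ((x * y) * (b / (r * q))) = (x * b) * (y / r)" if "q > 0" for q x y b r :: real
        using that by simp
      then show ?thesis using p(2) by blast
    qed
    also have "\<dots> \<le> (2 ^ ?d * B + 1) * (2 ^ (j * ?d) / (1 + 2 ^ j * norm w) ^ (?d + 1))"
      using p by (intro mult_right_mono divide_nonneg_nonneg less_imp_le[OF p(1)]) auto
    finally show ?thesis .
  qed
  moreover have "2 ^ ?d * B + 1 > 0" using B(1) by (intro add_nonneg_pos) auto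
  ultimately show thesis using that by blast
qed

lemma nn_integral_kern_low:
  obtains K :: real where "K > 0"
    "\<And>(V :: real^'n \<Rightarrow> ennreal) j A y. V \<in> borel_measurable borel \<Longrightarrow>
      cube_mean_le j A V \<Longrightarrow>
      (\<integral>\<^sup>+z. V z * ennreal ((1 + norm (z - y)) ^ a * norm (kern (low (Suc j)) (z - y))) \<partial>lborel) \<le> ennreal K * A"
proof -
  let ?d = "CARD('n)"
  obtain B where B: "B > 0"
    "\<And>j w. (1 + norm w) ^ a * norm (kern (low (Suc j)) w) \<le> B * (2 ^ (j * ?d) / (1 + 2 ^ j * norm w) ^ (?d + 1))"
    using kern_low_bound by metis
  obtain C :: real where C: "C > 0"
    "\<And>(V :: real^'n \<Rightarrow> ennreal) j A y. V \<in> borel_measurable borel \<Longrightarrow>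
      cube_mean_le j A V \<Longrightarrow>
      (\<integral>\<^sup>+z. V z * ennreal (2 ^ (j * ?d) / (1 + 2 ^ j * norm (z - y)) ^ (?d + 1)) \<partial>lborel) \<le> ennreal C * A"
    using nn_integral_dyadic_weight[where 'n = 'n] by blast
  have "(\<integral>\<^sup>+z. V z * ennreal ((1 + norm (z - y)) ^ a * norm (kern (low (Suc j)) (z - y))) \<partial>lborel) \<le> ennreal (B * C) * A"
    if V: "V \<in> borel_measurable borel"
      and VA: "cube_mean_le j A V"
    for V :: "real^'n \<Rightarrow> ennreal" and j A y
  proof -
    note [measurable] = V
    let ?w = "\<lambda>z. 2 ^ (j * ?d) / (1 + 2 ^ j * norm (z - y)) ^ (?d + 1)"
    have "(\<integral>\<^sup>+z. V z * ennreal ((1 + norm (z - y)) ^ a * norm (kern (low (Suc j)) (z - y))) \<partial>lborel)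
        \<le> (\<integral>\<^sup>+z. ennreal B * (V z * ennreal (?w z)) \<partial>lborel)"
    proof (rule nn_integral_mono)
      fix z
      have "ennreal ((1 + norm (z - y)) ^ a * norm (kern (low (Suc j)) (z - y))) \<le> ennreal (B * ?w z)"
        by (intro ennreal_leI B)
      also have "\<dots> = ennreal B * ennreal (?w z)" using B(1) by (intro ennreal_mult) (auto intro!: divide_nonneg_nonneg)
      finally show "V z * ennreal ((1 + norm (z - y)) ^ a * norm (kern (low (Suc j)) (z - y))) \<le> ennreal B * (V z * ennreal (?w z))"
        by (metis mult.left_commute mult_left_mono zero_le)
    qed
    also have "\<dots> = ennreal B * (\<integral>\<^sup>+z. V z * ennreal (?w z) \<partial>lborel)" by (rule nn_integral_cmult) measurable
    also have "\<dots> \<le> ennreal B * (ennreal C * A)" by (intro mult_left_mono C(2) V VA) auto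
    also have "\<dots> = ennreal (B * C) * A" using B(1) C(1) by (simp add: ennreal_mult mult.assoc)
    finally show ?thesis .
  qed
  with B(1) C(1) show thesis using that[of "B * C"] by simp
qed

text \<open>
  The exponents \<open>p < 1\<close> need the a priori growth bound: the inequality
  \<open>\<bar>g\<bar> \<le> (weighted sup of \<bar>g\<bar>)\<^sup>1\<^sup>-\<^sup>p \<integral> \<bar>g\<bar>\<^sup>p \<bar>\<eta>\<bar>\<close> can only be divided through if the supremum is finite.
  The resulting constant depends on the growth exponent \<open>a\<close>, hence it is applied twice, the second time with \<open>a = 0\<close>.
\<close>

lemma piece_bound:
  assumes p: "0 < p"
  obtains C where "C > 0"
    "\<And>T j N y. T \<in> tempered_distributions \<Longrightarrow> N > 0 \<Longrightarrow>
      cube_mean_le j (ennreal (N powr p)) (\<lambda>z. ennreal (norm (piece T j z) powr p)) \<Longrightarrow>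
      norm (piece T j y) \<le> C * N"
proof -
  obtain \<gamma> where \<gamma>: "\<gamma> \<noteq> 0"
    and rep: "\<And>T j y. T \<in> tempered_distributions \<Longrightarrow>
      \<gamma> * piece T j y = (\<integral>z. piece T j z * kern (low (Suc j)) (z - y) \<partial>lborel)"
    by (rule sum_pieces_tendsto_and_reproducing, rule that) assumption+
  have \<gamma>0: "norm \<gamma> > 0" using \<gamma> by simp
  have ineq: "ennreal (norm \<gamma> * norm (piece T j y)) \<le> (\<integral>\<^sup>+z. ennreal (norm (piece T j z) * norm (kern (low (Suc j)) (z - y))) \<partial>lborel)"
    if "T \<in> tempered_distributions" for T j y
  proof -
    have "ennreal (norm (\<integral>z. piece T j z * kern (low (Suc j)) (z - y) \<partial>lborel)) \<le> (\<integral>\<^sup>+z. ennreal (norm (piece T j z * kern (low (Suc j)) (z - y))) \<partial>lborel)"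
    \<comment> \<open>A Bochner integral that does not exist has the value 0, so the bound holds
      without any integrability.\<close>
    proof (cases "integrable lborel (\<lambda>z. piece T j z * kern (low (Suc j)) (z - y))")
      case True then show ?thesis by (rule integral_norm_bound_ennreal)
    next
      case False then show ?thesis by (simp add: not_integrable_integral_eq)
    qed
    then show ?thesis unfolding rep[OF that, symmetric] by (simp only: norm_mult)
  qed
  obtain K where K: "\<And>a. K a > (0::real)"
    "\<And>a (V :: real^'n \<Rightarrow> ennreal) j A y. V \<in> borel_measurable borel \<Longrightarrow>
      cube_mean_le j A V \<Longrightarrow>
      (\<integral>\<^sup>+z. V z * ennreal ((1 + norm (z - y)) ^ a * norm (kern (low (Suc j)) (z - y))) \<partial>lborel) \<le> ennreal (K a) * A"
  proof -
    have "\<forall>a. \<exists>K>(0::real). \<forall>(V :: real^'n \<Rightarrow> ennreal) j A y. V \<in> borel_measurable borel \<longrightarrow>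
      cube_mean_le j A V \<longrightarrow>
      (\<integral>\<^sup>+z. V z * ennreal ((1 + norm (z - y)) ^ a * norm (kern (low (Suc j)) (z - y))) \<partial>lborel) \<le> ennreal K * A"
    proof
      fix a
      obtain K :: real where "K > 0" "\<And>(V :: real^'n \<Rightarrow> ennreal) j A y. V \<in> borel_measurable borel \<Longrightarrow>
        cube_mean_le j A V \<Longrightarrow>
        (\<integral>\<^sup>+z. V z * ennreal ((1 + norm (z - y)) ^ a * norm (kern (low (Suc j)) (z - y))) \<partial>lborel) \<le> ennreal K * A"
        using nn_integral_kern_low[of a] by blast
      then show "\<exists>K>(0::real). \<forall>(V :: real^'n \<Rightarrow> ennreal) j A y. V \<in> borel_measurable borel \<longrightarrow>
        cube_mean_le j A V \<longrightarrow>
        (\<integral>\<^sup>+z. V z * ennreal ((1 + norm (z - y)) ^ a * norm (kern (low (Suc j)) (z - y))) \<partial>lborel) \<le> ennreal K * A"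
        by (intro exI[of _ K]) blast
    qed
    from choice[OF this] show thesis using that by blast
  qed
  have kl [measurable]: "kern (low (Suc j)) \<in> borel_measurable borel" for j
    by (intro schwartz_borel schwartz_kern schwartz_low)
  show thesis
  proof (cases "1 \<le> p")
    case True
    show thesis
    proof (rule that[of "2 * K 0 / norm \<gamma>"])
      show "2 * K 0 / norm \<gamma> > 0" using K(1)[of 0] \<gamma>0 by simp
      fix T :: "'n functional" and j N y
      assume T: "T \<in> tempered_distributions" and N: "N > 0"
        and cubes: "cube_mean_le j (ennreal (N powr p)) (\<lambda>z. ennreal (norm (piece T j z) powr p))"
      note [measurable] = piece_borel[OF T]
      let ?F = "\<lambda>z. norm (piece T j z)" and ?E = "\<lambda>z. norm (kern (low (Suc j)) (z - y))"
      have "ennreal (norm \<gamma> * ?F y) \<le> (\<integral>\<^sup>+z. ennreal (?F z * ?E z) \<partial>lborel)" by (rule ineq[OF T])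
      \<comment> \<open>The constant part is handled as \<open>V = 1\<close>, whose cube means are
        1, and the power part by the hypothesis. Each contributes \<open>K 0 * N\<close>, whence the
        factor 2.\<close>
      also have "\<dots> \<le> (\<integral>\<^sup>+z. ennreal N * (1 * ennreal (?E z)) + ennreal (N powr (1 - p)) * (ennreal (?F z powr p) * ennreal (?E z)) \<partial>lborel)"
      proof (rule nn_integral_mono)
        fix z
        have "?F z * ?E z \<le> (N + N powr (1 - p) * ?F z powr p) * ?E z"
          by (intro mult_right_mono real_split_powr N True) auto
        then have "ennreal (?F z * ?E z) \<le> ennreal (N * ?E z + N powr (1 - p) * (?F z powr p * ?E z))"
          by (intro ennreal_leI) (simp add: algebra_simps)
        then show "ennreal (?F z * ?E z) \<le> ennreal N * (1 * ennreal (?E z)) + ennreal (N powr (1 - p)) * (ennreal (?F z powr p) * ennreal (?E z))"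
          using N by (simp add: ennreal_plus ennreal_mult)
      qed
      also have "\<dots> = ennreal N * (\<integral>\<^sup>+z. 1 * ennreal (?E z) \<partial>lborel) + ennreal (N powr (1 - p)) * (\<integral>\<^sup>+z. ennreal (?F z powr p) * ennreal (?E z) \<partial>lborel)"
        by (subst nn_integral_add, measurable, subst nn_integral_cmult, measurable, subst nn_integral_cmult) auto
      also have "\<dots> \<le> ennreal N * (ennreal (K 0) * 1) + ennreal (N powr (1 - p)) * (ennreal (K 0) * ennreal (N powr p))"
      proof (intro add_mono mult_left_mono)
        show "(\<integral>\<^sup>+z. 1 * ennreal (?E z) \<partial>lborel) \<le> ennreal (K 0) * 1"
          using K(2)[of "\<lambda>z. 1" j 1 y 0] by (simp add: cube_mean_le_def)
        show "(\<integral>\<^sup>+z. ennreal (?F z powr p) * ennreal (?E z) \<partial>lborel) \<le> ennreal (K 0) * ennreal (N powr p)"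
          using K(2)[of "\<lambda>z. ennreal (?F z powr p)" j "ennreal (N powr p)" y 0] cubes by simp
      qed auto
      also have "\<dots> = ennreal (N * K 0 + N powr (1 - p) * (K 0 * N powr p))"
        using N K(1)[of 0] by (simp add: ennreal_mult ennreal_plus)
      also have "N powr (1 - p) * (K 0 * N powr p) = N * K 0"
      proof -
        have "N powr (1 - p) * N powr p = N" using N by (simp flip: powr_add)
        then show ?thesis by (metis mult.assoc mult.commute)
      qed
      finally have "norm \<gamma> * ?F y \<le> 2 * K 0 * N"
        using N K(1)[of 0] by (subst (asm) ennreal_le_iff) (auto simp: mult_ac)
      then show "norm (piece T j y) \<le> 2 * K 0 / norm \<gamma> * N"
        using \<gamma>0 by (simp add: pos_le_divide_eq mult.commute)
    qed
  next
    case False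
    \<comment> \<open>The value that solves \<open>M powr p = K a / norm \<gamma> * N powr p\<close>
      for \<open>M\<close>, up to the factor \<open>N\<close>.\<close>
    define C where "C a = (K a / norm \<gamma>) powr (1 / p)" for a
    have growth: "norm (piece T j x0) \<le> C a * N"
      if T: "T \<in> tempered_distributions" and N: "N > 0"
        and cubes: "cube_mean_le j (ennreal (N powr p)) (\<lambda>z. ennreal (norm (piece T j z) powr p))"
        and B: "B \<ge> 0" "\<And>y. norm (piece T j y) \<le> B * (1 + norm y) ^ a"
      for T j N x0 B a
    proof -
      note [measurable] = piece_borel[OF T]
      let ?F = "\<lambda>z. norm (piece T j z)"
      \<comment> \<open>Centred at \<open>x0\<close>, the weight is 1 there, so \<open>M\<close>
        bounds the value at \<open>x0\<close> and the final constant does not depend on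
        \<open>x0\<close>.\<close>
      define w where "w y = (1 + norm (y - x0)) ^ a" for y
      have w: "w y \<ge> 1" for y unfolding w_def by simp
      have w0: "w y > 0" for y using w[of y] by linarith
      define M where "M = (SUP y. ?F y / w y)"
      have "?F y / w y \<le> B * (1 + norm x0) ^ a" for y
      proof -
        have "?F y \<le> B * ((1 + norm x0) ^ a * w y)"
          unfolding w_def using B by (intro order_trans[OF B(2)] mult_left_mono weight_power_le) auto
        then show ?thesis using w0[of y] by (simp add: pos_divide_le_eq mult.assoc)
      qed
      then have bdd: "bdd_above (range (\<lambda>y. ?F y / w y))" by (auto simp: bdd_above_def)
      have FM: "?F y \<le> M * w y" for y
      proof -
        have "?F y / w y \<le> M" unfolding M_def by (intro cSUP_upper bdd) auto
        then show ?thesis using w0[of y] by (simp add: pos_divide_le_eq)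
      qed
      have Fx: "?F x0 \<le> M" using FM[of x0] by (simp add: w_def)
      show ?thesis
      proof (cases "M > 0")
        case False
        then have "?F x0 \<le> 0" using Fx by linarith
        then show ?thesis using N by (simp add: C_def)
      next
        case True
        have "?F y / w y \<le> M powr (1 - p) * (K a * N powr p) / norm \<gamma>" for y
        proof -
          let ?E = "\<lambda>z. (1 + norm (z - y)) ^ a * norm (kern (low (Suc j)) (z - y))"
          have "ennreal (norm \<gamma> * ?F y) \<le> (\<integral>\<^sup>+z. ennreal (?F z * norm (kern (low (Suc j)) (z - y))) \<partial>lborel)"
            by (rule ineq[OF T])
          also have "\<dots> \<le> (\<integral>\<^sup>+z. ennreal (M powr (1 - p) * w y) * (ennreal (?F z powr p) * ennreal (?E z)) \<partial>lborel)"
          proof (rule nn_integral_mono)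
            fix z
            \<comment> \<open>Only the power \<open>p\<close> of the piece is kept in the integral.
              In the remaining factor \<open>w z powr (1 - p) \<le> w z\<close> as
              \<open>w z \<ge> 1\<close>, and Peetre's inequality moves this weight from
              \<open>z\<close> to \<open>y\<close>, at the price of a weight in \<open>z - y\<close>
              that the kernel absorbs.\<close>
            have "?F z powr (1 - p) \<le> (M * w z) powr (1 - p)"
              using FM[of z] \<open>\<not> 1 \<le> p\<close> by (intro powr_mono2) auto
            also have "\<dots> = M powr (1 - p) * w z powr (1 - p)" using True w0[of z] by (simp add: powr_mult)
            also have "w z powr (1 - p) \<le> w z powr 1" using w p by (intro powr_mono) auto
            also have "w z powr 1 = w z" using w0[of z] by simp
            also have "w z \<le> w y * (1 + norm (z - y)) ^ a"
              unfolding w_def using weight_power_le[of "z - x0" a "y - x0"] by simp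
            finally have le: "?F z powr (1 - p) \<le> M powr (1 - p) * (w y * (1 + norm (z - y)) ^ a)"
              by (simp add: mult_left_mono)
            have "?F z = ?F z powr p * ?F z powr (1 - p)" by (simp flip: powr_add)
            also have "\<dots> \<le> ?F z powr p * (M powr (1 - p) * (w y * (1 + norm (z - y)) ^ a))"
              by (intro mult_left_mono le) auto
            finally have "?F z * norm (kern (low (Suc j)) (z - y))
                \<le> ?F z powr p * (M powr (1 - p) * (w y * (1 + norm (z - y)) ^ a)) * norm (kern (low (Suc j)) (z - y))"
              by (rule mult_right_mono) auto
            also have "\<dots> = (M powr (1 - p) * w y) * (?F z powr p * ?E z)" by (simp only: mult_ac)
            finally have "ennreal (?F z * norm (kern (low (Suc j)) (z - y))) \<le> ennreal ((M powr (1 - p) * w y) * (?F z powr p * ?E z))"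
              by (rule ennreal_leI)
            also have "\<dots> = ennreal (M powr (1 - p) * w y) * (ennreal (?F z powr p) * ennreal (?E z))"
              using w0[of y] by (subst ennreal_mult; simp add: ennreal_mult)
            finally show "ennreal (?F z * norm (kern (low (Suc j)) (z - y))) \<le> ennreal (M powr (1 - p) * w y) * (ennreal (?F z powr p) * ennreal (?E z))" .
          qed
          also have "\<dots> = ennreal (M powr (1 - p) * w y) * (\<integral>\<^sup>+z. ennreal (?F z powr p) * ennreal (?E z) \<partial>lborel)"
            by (rule nn_integral_cmult) measurable
          also have "\<dots> \<le> ennreal (M powr (1 - p) * w y) * (ennreal (K a) * ennreal (N powr p))"
            by (intro mult_left_mono K(2) cubes) auto
          also have "\<dots> = ennreal (M powr (1 - p) * w y * (K a * N powr p))"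
            using K(1)[of a] w0[of y] by (simp add: ennreal_mult)
          finally have "norm \<gamma> * ?F y \<le> M powr (1 - p) * w y * (K a * N powr p)"
            using K(1)[of a] w0[of y] by (subst (asm) ennreal_le_iff) auto
          then have "?F y \<le> M powr (1 - p) * w y * (K a * N powr p) / norm \<gamma>"
            using \<gamma>0 by (simp add: pos_le_divide_eq mult.commute)
          then have "?F y / w y \<le> M powr (1 - p) * w y * (K a * N powr p) / norm \<gamma> / w y"
            using w0[of y] by (intro divide_right_mono) auto
          also have "\<dots> = M powr (1 - p) * (K a * N powr p) / norm \<gamma>" using w0[of y] by simp
          finally show ?thesis .
        qed
        then have "M \<le> M powr (1 - p) * (K a * N powr p) / norm \<gamma>"
          unfolding M_def[symmetric] by (subst M_def, intro cSUP_least) auto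
        then have "M powr (p - 1) * M \<le> M powr (p - 1) * (M powr (1 - p) * (K a * N powr p) / norm \<gamma>)"
          by (intro mult_left_mono) auto
        also have "M powr (p - 1) * M = M powr p" using True by (simp add: powr_diff)
        also have "M powr (p - 1) * (M powr (1 - p) * (K a * N powr p) / norm \<gamma>) = M powr ((p - 1) + (1 - p)) * (K a * N powr p / norm \<gamma>)"
          unfolding powr_add by simp
        also have "\<dots> = K a / norm \<gamma> * N powr p" using True by simp
        finally have "(M powr p) powr (1 / p) \<le> (K a / norm \<gamma> * N powr p) powr (1 / p)"
          using p by (intro powr_mono2) auto
        then have "M \<le> C a * N"
          using True p N K(1)[of a] \<gamma>0
          by (subst (asm) powr_mult) (auto simp: powr_powr C_def)
        then show ?thesis using Fx by linarith
      qed
    qed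
    show thesis
    proof (rule that[of "C 0"])
      show "C 0 > 0" using K(1)[of 0] \<gamma>0 by (simp add: C_def)
      fix T :: "'n functional" and j N y
      assume T: "T \<in> tempered_distributions" and N: "N > 0"
        and cubes: "cube_mean_le j (ennreal (N powr p)) (\<lambda>z. ennreal (norm (piece T j z) powr p))"
      obtain B m where "B > 0" "\<And>y. norm (piece T j y) \<le> B * (1 + norm y) ^ m"
        using piece_growth[OF T] by metis
      then have "norm (piece T j z) \<le> C m * N" for z
        using growth[OF T N cubes] by (meson less_imp_le)
      then show "norm (piece T j y) \<le> C 0 * N"
        using growth[OF T N cubes, of "C m * N" 0 y] N by (simp add: C_def)
    qed
  qed
qed

end

section \<open>Morrey norms\<close>

lemma ennreal_powr_ennreal: "0 \<le> r \<Longrightarrow> ennreal_powr (ennreal r) a = ennreal (r powr a)"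
  by (simp add: ennreal_powr_def)

lemma ennreal_powr_mono: "0 \<le> a \<Longrightarrow> x \<le> y \<Longrightarrow> ennreal_powr x a \<le> ennreal_powr y a"
  unfolding ennreal_powr_def
  by (auto simp: top_unique less_top intro!: ennreal_leI powr_mono2 enn2real_mono)

lemma ennreal_powr_measurable [measurable]: "(\<lambda>x. ennreal_powr x a) \<in> borel_measurable borel"
  unfolding ennreal_powr_def by measurable

text \<open>The Morrey bound raised to the power \<open>p\<close>, which removes the outer root and
  leaves an inequality linear in the integral.\<close>

lemma morrey_norm_cube:
  assumes "0 < p" "0 \<le> N" "morrey_norm u p G \<le> ennreal N" "Q \<in> dyadic_cubes"
  shows "ennreal (measure lebesgue Q powr (p / u - 1)) * (\<integral>\<^sup>+y\<in>Q. ennreal_powr (G y) p \<partial>lborel) \<le> ennreal (N powr p)"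
proof -
  let ?m = "measure lebesgue Q"
  define X where "X = (\<integral>\<^sup>+y\<in>Q. ennreal_powr (G y) p \<partial>lborel)"
  have X: "ennreal (?m powr (1 / u - 1 / p)) * ennreal_powr X (1 / p) \<le> ennreal N"
    using order_trans[OF SUP_upper[OF assms(4)] assms(3)[unfolded morrey_norm_def]]
    unfolding X_def by (simp add: nn_integral_completion)
  have m: "?m > 0" using assms(4) by (auto simp: dyadic_cubes_def measure_dyadic_cube)
  have "X \<noteq> \<infinity>"
  proof
    assume "X = \<infinity>"
    then have "ennreal (?m powr (1 / u - 1 / p)) * \<infinity> \<le> ennreal N" using X by (simp add: ennreal_powr_def)
    then show False using m by (simp add: ennreal_mult_top top_unique)
  qed
  then obtain r where r: "X = ennreal r" "r \<ge> 0" by (cases X) auto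
  have "ennreal (?m powr (1 / u - 1 / p) * r powr (1 / p)) \<le> ennreal N"
    using X r by (simp add: ennreal_powr_ennreal ennreal_mult)
  then have "?m powr (1 / u - 1 / p) * r powr (1 / p) \<le> N" using assms(2) by simp
  then have "(?m powr (1 / u - 1 / p) * r powr (1 / p)) powr p \<le> N powr p"
    using assms(1) by (intro powr_mono2) auto
  also have "(?m powr (1 / u - 1 / p) * r powr (1 / p)) powr p = ?m powr ((1 / u - 1 / p) * p) * r"
    using assms(1) r(2) by (simp add: powr_mult powr_powr)
  also have "(1 / u - 1 / p) * p = p / u - 1" using assms(1) by (simp add: field_simps)
  finally show ?thesis unfolding X_def[symmetric] r(1) using r(2)
    by (simp add: ennreal_mult[symmetric] ennreal_leI)
qed

context resolution_setup
begin

definition sup_fun :: "real \<Rightarrow> 'n functional \<Rightarrow> real^'n \<Rightarrow> ennreal" where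
  "sup_fun s T x = (SUP j. ennreal (2 powr (real j * s) * norm (piece T j x)))"

lemma sup_fun_borel [measurable]:
  assumes "T \<in> tempered_distributions"
  shows "sup_fun s T \<in> borel_measurable borel"
proof -
  note [measurable] = piece_borel[OF assms]
  show ?thesis unfolding sup_fun_def[abs_def] by measurable
qed

lemma piece_le_sup_fun: "ennreal (2 powr (real j * s) * norm (piece T j x)) \<le> sup_fun s T x"
  unfolding sup_fun_def by (rule SUP_upper) simp

text \<open>A single term is at most the sum of the series, and the root of order
  \<open>1 / q\<close> is monotone. From here on \<open>q\<close> no longer occurs.\<close>

lemma sup_fun_le_lq:
  assumes T: "T \<in> tempered_distributions" and q: "0 < q"
  shows "sup_fun s T x \<le> tlm_lq_function \<phi> s q T x"
proof (cases "q = \<infinity>")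
  case True
  then show ?thesis by (simp add: sup_fun_def tlm_lq_function_def lp_piece_eq[OF T])
next
  case False
  define r where "r = enn2real q"
  have r: "r > 0" using False q by (simp add: r_def enn2real_positive_iff less_top)
  let ?t = "\<lambda>j. ennreal (2 powr (real j * s * r) * norm (piece T j x) powr r)"
  show ?thesis unfolding sup_fun_def
  proof (rule SUP_least)
    fix j
    have "2 powr (real j * s) * norm (piece T j x) = (2 powr (real j * s * r) * norm (piece T j x) powr r) powr (1 / r)"
    proof -
      have "(2 powr (real j * s * r) * norm (piece T j x) powr r) powr (1 / r)
          = (2 powr (real j * s * r)) powr (1 / r) * (norm (piece T j x) powr r) powr (1 / r)"
        by (rule powr_mult)
      also have "\<dots> = 2 powr (real j * s) * norm (piece T j x)"
        unfolding powr_powr using r by simp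
      finally show ?thesis by (rule sym)
    qed
    then have "ennreal (2 powr (real j * s) * norm (piece T j x)) = ennreal_powr (?t j) (1 / r)"
      by (subst ennreal_powr_ennreal) auto
    also have "\<dots> \<le> ennreal_powr (\<Sum>j. ?t j) (1 / r)"
    proof (rule ennreal_powr_mono)
      have "b j \<le> (\<Sum>j. b j)" for b :: "nat \<Rightarrow> ennreal"
        using sum_le_suminf[of b "{j}"] by simp
      then show "?t j \<le> (\<Sum>j. ?t j)" .
    qed (use r in auto)
    finally show "ennreal (2 powr (real j * s) * norm (piece T j x)) \<le> tlm_lq_function \<phi> s q T x"
      unfolding tlm_lq_function_def lp_piece_eq[OF T] r_def using False by (simp only: if_False)
  qed
qed

end

section \<open>The embedding\<close>

context resolution_setup
begin

text \<open>The smoothness \<open>d / u\<close> is critical: at scale \<open>j\<close> the factor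
  \<open>2 powr (j * d / u)\<close> equals the power \<open>- 1 / u\<close> of the measure of the
  cube. Replacing the piece by \<open>sup_fun\<close> thus produces exactly the Morrey factor, and
  the mean is bounded by \<open>N powr p\<close> uniformly in \<open>j\<close>.\<close>

lemma cube_bound_piece:
  assumes T: "T \<in> tempered_distributions" and p: "0 < p" and u: "0 < u"
    and G: "\<And>Q. Q \<in> dyadic_cubes \<Longrightarrow>
      ennreal (measure lebesgue Q powr (p / u - 1)) * (\<integral>\<^sup>+y\<in>Q. ennreal_powr (sup_fun (real CARD('n) / u) T y) p \<partial>lborel) \<le> ennreal (N powr p)"
  shows "cube_mean_le j (ennreal (N powr p)) (\<lambda>z. ennreal (norm (piece T j z) powr p))"
  unfolding cube_mean_le_def
proof
  fix k :: "int^'n"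
  let ?d = "CARD('n)" and ?Q = "dyadic_cube (int j) k :: (real^'n) set"
  define s where "s = real ?d / u"
  define m where "m = measure lebesgue ?Q"
  note [measurable] = sup_fun_borel[OF T, of s]
  have m_eq: "m = 2 powr (- (real j * real ?d))"
  proof -
    have "m = 1 / 2 powr (real (j * ?d))"
      by (simp add: m_def measure_dyadic_cube power_one_over power_mult powr_realpow del: of_nat_mult)
    then show ?thesis by (simp add: powr_minus divide_inverse)
  qed
  have m0: "m > 0" by (simp add: m_eq)
  have em: "emeasure lborel ?Q = ennreal m"
    by (simp add: m_def measure_dyadic_cube emeasure_dyadic_cube)
  have Q: "?Q \<in> dyadic_cubes" by (auto simp: dyadic_cubes_def)
  let ?X = "\<integral>\<^sup>+y\<in>?Q. ennreal_powr (sup_fun s T y) p \<partial>lborel"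
  have pt: "ennreal (norm (piece T j z) powr p) \<le> ennreal (m powr (p / u)) * ennreal_powr (sup_fun s T z) p" for z
  proof -
    let ?b = "2 powr (real j * s) * norm (piece T j z)"
    have mp: "m powr (p / u) = 2 powr (- (real j * s * p))"
      unfolding m_eq powr_powr by (simp add: s_def)
    have "?b powr p = 2 powr (real j * s * p) * norm (piece T j z) powr p"
      unfolding powr_mult powr_powr ..
    then have "m powr (p / u) * ?b powr p = (2 powr (- (real j * s * p)) * 2 powr (real j * s * p)) * norm (piece T j z) powr p"
      by (simp only: mp mult.assoc)
    also have "\<dots> = norm (piece T j z) powr p" by (simp add: powr_add[symmetric])
    finally have "ennreal (norm (piece T j z) powr p) = ennreal (m powr (p / u)) * ennreal (?b powr p)"
      by (simp add: ennreal_mult[symmetric])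
    also have "ennreal (?b powr p) = ennreal_powr (ennreal ?b) p" by (simp add: ennreal_powr_ennreal)
    also have "ennreal (m powr (p / u)) * \<dots> \<le> ennreal (m powr (p / u)) * ennreal_powr (sup_fun s T z) p"
      using p by (intro mult_left_mono ennreal_powr_mono piece_le_sup_fun) auto
    finally show ?thesis .
  qed
  have "(\<integral>\<^sup>+z\<in>?Q. ennreal (norm (piece T j z) powr p) \<partial>lborel)
      \<le> (\<integral>\<^sup>+z. ennreal (m powr (p / u)) * (ennreal_powr (sup_fun s T z) p * indicator ?Q z) \<partial>lborel)"
    using pt by (intro nn_integral_mono) (auto simp: indicator_def)
  also have "\<dots> = ennreal (m powr (p / u)) * ?X" by (rule nn_integral_cmult) measurable
  also have "m powr (p / u) = m * m powr (p / u - 1)" using m0 by (simp add: powr_diff)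
  also have "ennreal (m * m powr (p / u - 1)) * ?X = ennreal m * (ennreal (m powr (p / u - 1)) * ?X)"
    using m0 by (simp add: ennreal_mult mult.assoc)
  also have "\<dots> \<le> ennreal m * ennreal (N powr p)"
    unfolding m_def s_def by (intro mult_left_mono G Q) auto
  finally show "(\<integral>\<^sup>+z\<in>?Q. ennreal (norm (piece T j z) powr p) \<partial>lborel) \<le> ennreal (N powr p) * emeasure lborel ?Q"
    unfolding em by (simp only: mult.commute)
qed

text \<open>The function \<open>h T\<close> is fixed before \<open>N\<close>, so that
  \<open>N\<close> can later decrease to the norm of \<open>T\<close>; asking for
  \<open>N > 0\<close> permits division by \<open>N\<close> also when the norm is 0.\<close>

lemma tempered_in_orlicz_morrey:
  assumes p: "0 < p" and u: "0 < u"
  obtains K h where "K > 0" "\<And>T. T \<in> tempered_distributions \<Longrightarrow> h T \<in> borel_measurable borel"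
    "\<And>T N. T \<in> tempered_distributions \<Longrightarrow> N > 0 \<Longrightarrow>
      (\<And>Q. Q \<in> dyadic_cubes \<Longrightarrow>
        ennreal (measure lebesgue Q powr (p / u - 1)) * (\<integral>\<^sup>+y\<in>Q. ennreal_powr (sup_fun (real CARD('n) / u) T y) p \<partial>lborel) \<le> ennreal (N powr p)) \<Longrightarrow>
      represents (h T) T \<and> orlicz_morrey_norm (u / p) (Phi_p1 p) (h T) \<le> ennreal (K * N)"
proof -
  let ?d = "CARD('n)"
  define s where "s = real ?d / u"
  obtain \<gamma> where \<gamma>: "\<gamma> \<noteq> 0"
    and lim: "\<And>T \<psi>. T \<in> tempered_distributions \<Longrightarrow> \<psi> \<in> schwartz \<Longrightarrow>
      (\<lambda>J. \<Sum>j\<le>J. \<integral>y. piece T j y * \<psi> y \<partial>lborel) \<longlonglongrightarrow> \<gamma> * T \<psi>"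
    by (rule sum_pieces_tendsto_and_reproducing, rule that) assumption+
  have \<gamma>0: "norm \<gamma> > 0" using \<gamma> by simp
  obtain C where C: "C > 0"
    "\<And>T j N y. T \<in> tempered_distributions \<Longrightarrow> N > 0 \<Longrightarrow>
      cube_mean_le j (ennreal (N powr p)) (\<lambda>z. ennreal (norm (piece T j z) powr p)) \<Longrightarrow>
      norm (piece T j y) \<le> C * N"
    using piece_bound[OF p] by blast
  define \<rho> where "\<rho> = 2 powr (- s)"
  have s: "s > 0" using u by (simp add: s_def)
  have \<rho>: "0 < \<rho>" "\<rho> < 1" using s by (auto simp: \<rho>_def powr_less_one)
  have \<rho>pow: "\<rho> ^ j * 2 powr (real j * s) = 1" for j
  proof -
    have "\<rho> ^ j = 2 powr (- (real j * s))" unfolding \<rho>_def by (simp add: powr_power mult.commute)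
    then show ?thesis by (simp add: powr_add[symmetric])
  qed
  obtain \<Lambda> where \<Lambda>: "\<Lambda> > 0"
    "\<And>t a. 0 \<le> t \<Longrightarrow> (\<And>j. 0 \<le> a j \<and> a j \<le> C \<and> a j \<le> \<rho> ^ j * t) \<Longrightarrow>
      summable a \<and> Phi_p1 p (suminf a / \<Lambda>) \<le> t powr p"
  proof (rule Phi_p1_truncated_geometric_sum[OF \<rho> less_imp_le[OF C(1)] p])
    fix \<Lambda> assume A: "\<Lambda> > 0" and B: "\<And>t a. 0 \<le> t \<Longrightarrow> (\<And>j. 0 \<le> a j \<and> a j \<le> C \<and> a j \<le> \<rho> ^ j * t) \<Longrightarrow>
      summable a \<and> Phi_p1 p (suminf a / \<Lambda>) \<le> t powr p"
    show thesis by (rule that[OF A B])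
  qed
  obtain C' :: real where C': "C' > 0"
    "\<And>(V :: real^'n \<Rightarrow> ennreal) j A y. V \<in> borel_measurable borel \<Longrightarrow>
      cube_mean_le j A V \<Longrightarrow>
      (\<integral>\<^sup>+z. V z * ennreal (2 ^ (j * ?d) / (1 + 2 ^ j * norm (z - y)) ^ (?d + 1)) \<partial>lborel) \<le> ennreal C' * A"
    using nn_integral_dyadic_weight[where 'n = 'n] by blast
  \<comment> \<open>Division by \<open>\<gamma>\<close> corrects the limit
    \<open>\<gamma> * T \<psi>\<close> of the partial sums, and the same division in
    \<open>K\<close> makes \<open>h T x / (K * N)\<close> agree in modulus with the sum of the
    pieces over \<open>\<Lambda> * N\<close>.\<close>
  define h where "h T x = (\<Sum>j. piece T j x) / \<gamma>" for T x
  define K where "K = \<Lambda> / norm \<gamma>"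
  have K: "K > 0" using \<Lambda>(1) \<gamma>0 by (simp add: K_def)
  have hm: "h T \<in> borel_measurable borel" if "T \<in> tempered_distributions" for T
  proof -
    note [measurable] = piece_borel[OF that]
    show ?thesis unfolding h_def[abs_def] by measurable
  qed
  have main: "represents (h T) T \<and> orlicz_morrey_norm (u / p) (Phi_p1 p) (h T) \<le> ennreal (K * N)"
    if T: "T \<in> tempered_distributions" and N: "N > 0"
      and G: "\<And>Q. Q \<in> dyadic_cubes \<Longrightarrow>
        ennreal (measure lebesgue Q powr (p / u - 1)) * (\<integral>\<^sup>+y\<in>Q. ennreal_powr (sup_fun s T y) p \<partial>lborel) \<le> ennreal (N powr p)"
    for T N
  proof -
    note [measurable] = piece_borel[OF T] sup_fun_borel[OF T] hm[OF T]
    define W where "W x = 1 / (1 + norm x) ^ (?d + 1)" for x :: "real^'n"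
    have W0: "W x > 0" for x unfolding W_def by (intro divide_pos_pos zero_less_power add_pos_nonneg) auto
    have [measurable]: "W \<in> borel_measurable borel" unfolding W_def[abs_def] by measurable
    have Wi: "integrable lborel W" unfolding W_def[abs_def] using integrable_weight[where 'a = "real^'n"] by simp
    define t where "t x = enn2real (sup_fun s T x) / N" for x
    have [measurable]: "t \<in> borel_measurable borel" unfolding t_def[abs_def] by measurable
    have t0: "t x \<ge> 0" for x using N by (simp add: t_def)
    have GW: "(\<integral>\<^sup>+x. ennreal_powr (sup_fun s T x) p * ennreal (W x) \<partial>lborel) \<le> ennreal C' * ennreal (N powr p)"
    proof -
      \<comment> \<open>Cubes of scale 0 have measure 1, so there the Morrey factor is 1 and the
        hypothesis is already a bound for means.\<close>
      have "cube_mean_le 0 (ennreal (N powr p)) (\<lambda>x. ennreal_powr (sup_fun s T x) p)"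
        unfolding cube_mean_le_def
      proof
        fix k
        show "(\<integral>\<^sup>+x\<in>dyadic_cube (int 0) k. ennreal_powr (sup_fun s T x) p \<partial>lborel)
            \<le> ennreal (N powr p) * emeasure lborel (dyadic_cube (int 0) k :: (real^'n) set)"
          using G[of "dyadic_cube 0 k"] by (auto simp: dyadic_cubes_def measure_dyadic_cube emeasure_dyadic_cube)
      qed
      from C'(2)[of "\<lambda>x. ennreal_powr (sup_fun s T x) p" 0 "ennreal (N powr p)" 0, OF _ this]
      show ?thesis by (simp add: W_def)
    qed
    have fin: "AE x in lborel. sup_fun s T x < \<infinity>"
    proof -
      have "(\<integral>\<^sup>+x. ennreal_powr (sup_fun s T x) p * ennreal (W x) \<partial>lborel) \<noteq> \<infinity>"
        using le_less_trans[OF GW] by (simp add: ennreal_mult_less_top less_top)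
      then have "AE x in lborel. ennreal_powr (sup_fun s T x) p * ennreal (W x) \<noteq> \<infinity>"
        by (intro nn_integral_PInf_AE) auto
      then show ?thesis
      proof eventually_elim
        case (elim x)
        then have "ennreal_powr (sup_fun s T x) p \<noteq> \<infinity>" using W0[of x] by (auto simp: ennreal_top_mult)
        then show ?case by (auto simp: ennreal_powr_def less_top split: if_splits)
      qed
    qed
    have pw: "summable (\<lambda>j. norm (piece T j x)) \<and> Phi_p1 p ((\<Sum>j. norm (piece T j x)) / (\<Lambda> * N)) \<le> t x powr p"
      if x: "sup_fun s T x < \<infinity>" for x
    proof -
      define a where "a j = norm (piece T j x) / N" for j
      have a: "0 \<le> a j \<and> a j \<le> C \<and> a j \<le> \<rho> ^ j * t x" for j
      proof (intro conjI)
        show "0 \<le> a j" using N by (simp add: a_def)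
        have "norm (piece T j x) \<le> C * N"
          by (rule C(2)[OF T N cube_bound_piece[OF T p u]]) (use G in \<open>simp add: s_def\<close>)
        then show "a j \<le> C" using N by (simp add: a_def pos_divide_le_eq)
        have "2 powr (real j * s) * norm (piece T j x) \<le> enn2real (sup_fun s T x)"
          using enn2real_mono[OF piece_le_sup_fun[of j s T x]] x by simp
        then have "\<rho> ^ j * (2 powr (real j * s) * norm (piece T j x)) \<le> \<rho> ^ j * enn2real (sup_fun s T x)"
          using \<rho> by (intro mult_left_mono) auto
        then have "norm (piece T j x) \<le> \<rho> ^ j * enn2real (sup_fun s T x)"
          by (simp only: mult.assoc[symmetric] \<rho>pow mult_1_left)
        then show "a j \<le> \<rho> ^ j * t x" using N by (simp add: a_def t_def divide_right_mono)
      qed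
      from \<Lambda>(2)[OF t0 this] have sa: "summable a" and Pa: "Phi_p1 p (suminf a / \<Lambda>) \<le> t x powr p" by auto
      have e: "(\<lambda>j. norm (piece T j x)) = (\<lambda>j. N * a j)" using N by (simp add: a_def)
      have "(\<Sum>j. norm (piece T j x)) = N * suminf a" unfolding e by (rule suminf_mult[OF sa])
      then show ?thesis using Pa N unfolding e by (simp add: sa summable_mult mult.commute)
    qed
    \<comment> \<open>From \<open>y \<le> 1 + Phi_p1 p y\<close> the Orlicz bound becomes a bound
      for the sum itself. Only the power \<open>p\<close> of \<open>t\<close> enters, hence
      \<open>D\<close> is integrable against \<open>W\<close> even for \<open>p < 1\<close>.\<close>
    define D where "D x = \<Lambda> * N * (1 + t x powr p)" for x
    have D: "(\<Sum>j. norm (piece T j x)) \<le> D x" if x: "sup_fun s T x < \<infinity>" for x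
    proof -
      define y where "y = (\<Sum>j. norm (piece T j x)) / (\<Lambda> * N)"
      have y: "y \<ge> 0" using pw[OF x] \<Lambda>(1) N by (auto simp: y_def intro!: divide_nonneg_nonneg suminf_nonneg)
      have "y \<le> 1 + Phi_p1 p y"
      proof (cases "y \<le> 1")
        case True then show ?thesis using y by (simp add: Phi_p1_def add_increasing2)
      next
        case False
        have "y \<le> 1 * exp y" using exp_ge_add_one_self[of y] by linarith
        also have "\<dots> \<le> y powr p * exp y" using False p by (intro mult_right_mono ge_one_powr_ge_zero) auto
        finally show ?thesis by (simp add: Phi_p1_def)
      qed
      also have "\<dots> \<le> 1 + t x powr p" using pw[OF x] by (simp add: y_def)
      finally show ?thesis using \<Lambda>(1) N by (simp add: y_def D_def pos_divide_le_eq mult.commute)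
    qed
    have [measurable]: "D \<in> borel_measurable borel" unfolding D_def[abs_def] by measurable
    have D0: "D x \<ge> 0" for x using \<Lambda>(1) N by (simp add: D_def)
    have DW: "integrable lborel (\<lambda>x. D x * W x)"
    proof -
      have "integrable lborel (\<lambda>x. enn2real (sup_fun s T x) powr p * W x)"
      proof (rule integrableI_nonneg)
        show "(\<lambda>x. enn2real (sup_fun s T x) powr p * W x) \<in> borel_measurable lborel" by measurable
        show "AE x in lborel. 0 \<le> enn2real (sup_fun s T x) powr p * W x"
          by (intro AE_I2 mult_nonneg_nonneg less_imp_le[OF W0]) simp
        have "(\<integral>\<^sup>+x. ennreal (enn2real (sup_fun s T x) powr p * W x) \<partial>lborel) \<le> (\<integral>\<^sup>+x. ennreal_powr (sup_fun s T x) p * ennreal (W x) \<partial>lborel)"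
        proof (rule nn_integral_mono)
          fix x
          have "ennreal (enn2real (sup_fun s T x) powr p * W x) = ennreal (enn2real (sup_fun s T x) powr p) * ennreal (W x)"
            using W0[of x] by (intro ennreal_mult) auto
          also have "\<dots> \<le> ennreal_powr (sup_fun s T x) p * ennreal (W x)"
            by (intro mult_right_mono) (auto simp: ennreal_powr_def)
          finally show "ennreal (enn2real (sup_fun s T x) powr p * W x) \<le> ennreal_powr (sup_fun s T x) p * ennreal (W x)" .
        qed
        also note GW
        finally show "(\<integral>\<^sup>+x. ennreal (enn2real (sup_fun s T x) powr p * W x) \<partial>lborel) < \<infinity>"
          by (rule le_less_trans) (simp add: ennreal_mult_less_top)
      qed
      then have "integrable lborel (\<lambda>x. \<Lambda> * N * W x + \<Lambda> * N / N powr p * (enn2real (sup_fun s T x) powr p * W x))"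
        using Wi by simp
      also have "(\<lambda>x. \<Lambda> * N * W x + \<Lambda> * N / N powr p * (enn2real (sup_fun s T x) powr p * W x)) = (\<lambda>x. D x * W x)"
        using N by (simp add: D_def t_def powr_divide algebra_simps)
      finally show ?thesis .
    qed
    have hD: "AE x in lborel. norm (h T x) \<le> D x / norm \<gamma>"
      using fin
    proof eventually_elim
      case (elim x)
      have "norm (\<Sum>j. piece T j x) \<le> D x"
        using summable_norm[of "\<lambda>j. piece T j x"] pw[OF elim] D[OF elim] by linarith
      then show ?case using \<gamma>0 by (simp add: h_def norm_divide divide_right_mono)
    qed
    \<comment> \<open>Covers both uses of \<open>D\<close> below: indicators of compact sets and
      moduli of test functions are bounded by multiples of \<open>W\<close>.\<close>
    have bnd: "integrable lborel (\<lambda>x. D x * f x)"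
      if [measurable]: "f \<in> borel_measurable borel" and f: "\<And>x. 0 \<le> f x \<and> f x \<le> A * W x" for f A
    proof (rule Bochner_Integration.integrable_bound[OF integrable_mult_right[OF DW, of A]])
      show "AE x in lborel. norm (D x * f x) \<le> norm (A * (D x * W x))"
      proof (rule AE_I2)
        fix x
        have "D x * f x \<le> D x * (A * W x)" using f D0 by (intro mult_left_mono) auto
        then have "D x * f x \<le> A * (D x * W x)" by (simp only: mult_ac)
        moreover have "0 \<le> D x * f x" using f D0 by simp
        ultimately show "norm (D x * f x) \<le> norm (A * (D x * W x))" by simp
      qed
    qed measurable
    have rep: "represents (h T) T"
      unfolding represents_def
    proof (intro conjI allI impI ballI)
      fix S :: "(real^'n) set" assume S: "compact S"
      then obtain R where R: "\<And>x. x \<in> S \<Longrightarrow> norm x \<le> R" by (meson bounded_iff compact_imp_bounded)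
      have [measurable]: "S \<in> sets borel" using S by (intro borel_compact)
      have "integrable lborel (\<lambda>x. D x * indicator S x)"
      proof (rule bnd[where A = "(1 + \<bar>R\<bar>) ^ (?d + 1)"])
        fix x
        have "1 \<le> (1 + \<bar>R\<bar>) ^ (?d + 1) * W x" if "x \<in> S"
        proof -
          have "(1 + norm x) ^ (?d + 1) \<le> (1 + \<bar>R\<bar>) ^ (?d + 1)" using R[OF that] by (intro power_mono) auto
          moreover have "0 < (1 + norm x) ^ (?d + 1)" by (intro zero_less_power add_pos_nonneg) auto
          ultimately show ?thesis unfolding W_def by (simp only: times_divide_eq_right mult_1_right pos_le_divide_eq mult_1_left)
        qed
        moreover have "0 \<le> (1 + \<bar>R\<bar>) ^ (?d + 1) * W x" using W0[of x] by (intro mult_nonneg_nonneg) auto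
        ultimately show "0 \<le> (indicator S x :: real) \<and> indicator S x \<le> (1 + \<bar>R\<bar>) ^ (?d + 1) * W x"
          by (simp add: indicator_def)
      qed measurable
      then have "integrable lborel (\<lambda>x. D x * indicator S x / norm \<gamma>)" by simp
      then have "integrable lborel (\<lambda>x. indicator S x *\<^sub>R h T x)"
        by (rule Bochner_Integration.integrable_bound)
           (use hD D0 in \<open>auto elim!: eventually_mono simp: indicator_def abs_of_nonneg\<close>)
      then show "h T absolutely_integrable_on S"
        unfolding set_integrable_def by (subst integrable_completion) auto
    next
      fix \<psi> :: "real^'n \<Rightarrow> complex" assume \<psi>t: "\<psi> \<in> test_functions"
      then have \<psi>: "\<psi> \<in> schwartz" by (rule test_function_schwartz)
      note [measurable] = schwartz_borel[OF \<psi>]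
      obtain A where A: "A \<ge> 0" "\<And>x. norm (\<psi> x) \<le> A / (1 + norm x) ^ (?d + 1)"
        using rapid_divide[OF schwartz_rapid[OF \<psi>]] by metis
      have w: "integrable lborel (\<lambda>x. D x * norm (\<psi> x))"
        by (rule bnd[where A = A]) (use A in \<open>auto simp: W_def\<close>)
      \<comment> \<open>The tested partial sums converge to the integral of the sum because
        \<open>D\<close> dominates them, and to \<open>\<gamma> * T \<psi>\<close> by
        \<open>lim\<close>; uniqueness of the limit gives the representation.\<close>
      have "(\<lambda>J. \<integral>x. (\<Sum>j\<le>J. piece T j x) * \<psi> x \<partial>lborel) \<longlonglongrightarrow> (\<integral>x. (\<Sum>j. piece T j x) * \<psi> x \<partial>lborel)"
      proof (rule integral_dominated_convergence[OF _ _ w])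
        show "AE x in lborel. (\<lambda>J. (\<Sum>j\<le>J. piece T j x) * \<psi> x) \<longlonglongrightarrow> (\<Sum>j. piece T j x) * \<psi> x"
          using fin
        proof eventually_elim
          case (elim x)
          have "summable (\<lambda>j. piece T j x)"
            by (rule summable_norm_cancel[OF conjunct1[OF pw[OF elim]]])
          then show ?case by (intro tendsto_mult tendsto_const summable_LIMSEQ')
        qed
        show "AE x in lborel. norm ((\<Sum>j\<le>J. piece T j x) * \<psi> x) \<le> D x * norm (\<psi> x)" for J
          using fin
        proof eventually_elim
          case (elim x)
          have "norm (\<Sum>j\<le>J. piece T j x) \<le> (\<Sum>j\<le>J. norm (piece T j x))" by (rule norm_sum)
          also have "\<dots> \<le> (\<Sum>j. norm (piece T j x))" using pw[OF elim] by (intro sum_le_suminf) auto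
          also have "\<dots> \<le> D x" by (rule D[OF elim])
          finally show ?case unfolding norm_mult by (rule mult_right_mono) auto
        qed
      qed measurable
      moreover have "(\<integral>x. (\<Sum>j\<le>J. piece T j x) * \<psi> x \<partial>lborel) = (\<Sum>j\<le>J. \<integral>x. piece T j x * \<psi> x \<partial>lborel)" for J
        unfolding sum_distrib_right
        by (intro Bochner_Integration.integral_sum continuous_test_integrable piece_continuous T \<psi>t)
      ultimately have "(\<lambda>J. \<Sum>j\<le>J. \<integral>x. piece T j x * \<psi> x \<partial>lborel) \<longlonglongrightarrow> (\<integral>x. (\<Sum>j. piece T j x) * \<psi> x \<partial>lborel)"
        by simp
      then have "\<gamma> * T \<psi> = (\<integral>x. (\<Sum>j. piece T j x) * \<psi> x \<partial>lborel)"
        using lim[OF T \<psi>] LIMSEQ_unique by blast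
      also have "(\<lambda>x. (\<Sum>j. piece T j x) * \<psi> x) = (\<lambda>x. \<gamma> * (h T x * \<psi> x))"
        using \<gamma> by (simp add: h_def)
      finally have "\<gamma> * T \<psi> = \<gamma> * (\<integral>x. h T x * \<psi> x \<partial>lborel)" by simp
      then have "T \<psi> = (\<integral>x. h T x * \<psi> x \<partial>lborel)" using \<gamma> by simp
      also have "\<dots> = (\<integral>x. h T x * \<psi> x \<partial>lebesgue)" by (subst integral_completion) auto
      finally show "T \<psi> = (\<integral>x. h T x * \<psi> x \<partial>lebesgue)" .
    qed
    have "orlicz_cube_norm (u / p) (Phi_p1 p) Q (h T) \<le> ennreal (K * N)" if Q: "Q \<in> dyadic_cubes" for Q
    proof -
      have [measurable]: "Q \<in> sets borel" using Q by (auto simp: dyadic_cubes_def)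
      have "(\<integral>\<^sup>+x\<in>Q. ennreal (Phi_p1 p (cmod (h T x) / (K * N))) \<partial>lborel)
          \<le> (\<integral>\<^sup>+x. ennreal (1 / N powr p) * (ennreal_powr (sup_fun s T x) p * indicator Q x) \<partial>lborel)"
      proof (rule nn_integral_mono_AE)
        show "AE x in lborel. ennreal (Phi_p1 p (cmod (h T x) / (K * N))) * indicator Q x
          \<le> ennreal (1 / N powr p) * (ennreal_powr (sup_fun s T x) p * indicator Q x)"
          using fin
        proof eventually_elim
          case (elim x)
          have "norm (\<Sum>j. piece T j x) \<le> (\<Sum>j. norm (piece T j x))"
            using pw[OF elim] by (intro summable_norm) auto
          then have "norm (\<Sum>j. piece T j x) / (\<Lambda> * N) \<le> (\<Sum>j. norm (piece T j x)) / (\<Lambda> * N)"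
            using \<Lambda>(1) N by (intro divide_right_mono) auto
          moreover have "cmod (h T x) / (K * N) = norm (\<Sum>j. piece T j x) / (\<Lambda> * N)"
            using \<gamma>0 by (simp add: h_def K_def norm_divide)
          ultimately have "Phi_p1 p (cmod (h T x) / (K * N)) \<le> Phi_p1 p ((\<Sum>j. norm (piece T j x)) / (\<Lambda> * N))"
            using \<Lambda>(1) N by (intro Phi_p1_mono p) auto
          also have "\<dots> \<le> t x powr p" using pw[OF elim] by blast
          also have "\<dots> = 1 / N powr p * enn2real (sup_fun s T x) powr p" using N by (simp add: t_def powr_divide)
          finally have "ennreal (Phi_p1 p (cmod (h T x) / (K * N))) \<le> ennreal (1 / N powr p * enn2real (sup_fun s T x) powr p)"
            by (rule ennreal_leI)
          also have "\<dots> = ennreal (1 / N powr p) * ennreal_powr (sup_fun s T x) p"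
            using elim by (subst ennreal_mult) (auto simp: ennreal_powr_def)
          finally show ?case by (simp add: indicator_def)
        qed
      qed
      also have "\<dots> = ennreal (1 / N powr p) * (\<integral>\<^sup>+x\<in>Q. ennreal_powr (sup_fun s T x) p \<partial>lborel)"
        by (rule nn_integral_cmult) measurable
      finally have "ennreal (measure lebesgue Q powr (p / u - 1)) * (\<integral>\<^sup>+x\<in>Q. ennreal (Phi_p1 p (cmod (h T x) / (K * N))) \<partial>lborel)
          \<le> ennreal (measure lebesgue Q powr (p / u - 1)) * (ennreal (1 / N powr p) * (\<integral>\<^sup>+x\<in>Q. ennreal_powr (sup_fun s T x) p \<partial>lborel))"
        by (intro mult_left_mono) auto
      also have "\<dots> = ennreal (1 / N powr p) * (ennreal (measure lebesgue Q powr (p / u - 1)) * (\<integral>\<^sup>+x\<in>Q. ennreal_powr (sup_fun s T x) p \<partial>lborel))"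
        by (simp only: mult_ac)
      also have "\<dots> \<le> ennreal (1 / N powr p) * ennreal (N powr p)" by (intro mult_left_mono G Q) auto
      also have "\<dots> = 1" using N by (simp add: ennreal_mult[symmetric])
      \<comment> \<open>With \<open>r = u / p\<close> the Orlicz--Morrey exponent
        \<open>1 / r - 1\<close> is \<open>p / u - 1\<close>, the exponent in the Morrey bound
        raised to the power \<open>p\<close>.\<close>
      finally have "ennreal (measure lebesgue Q powr (1 / (u / p) - 1)) * (\<integral>\<^sup>+x\<in>Q. ennreal (Phi_p1 p (cmod (h T x) / (K * N))) \<partial>lebesgue) \<le> 1"
        by (simp add: nn_integral_completion)
      then show ?thesis unfolding orlicz_cube_norm_def using K N by (intro INF_lower) auto
    qed
    then have "orlicz_morrey_norm (u / p) (Phi_p1 p) (h T) \<le> ennreal (K * N)"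
      unfolding orlicz_morrey_norm_def by (rule SUP_least)
    with rep show ?thesis by blast
  qed
  show thesis by (rule that[of K h]) (use K hm main in \<open>auto simp: s_def\<close>)
qed

end

theorem corollary4p6:
  fixes p u :: real and q :: ennreal and \<phi> :: "real^'n \<Rightarrow> complex"
  assumes "0 < p" and "p \<le> u" and "0 < q"
    and "resolution_generator \<phi>"
  shows "continuously_embedded
           (tlm_space \<phi> (real CARD('n) / u) u p q)
           (tlm_norm \<phi> (real CARD('n) / u) u p q)
           (orlicz_morrey_space (u / p) (Phi_p1 p))
           (orlicz_morrey_norm (u / p) (Phi_p1 p))"
proof -
  interpret resolution_setup \<phi> by standard (rule assms)
  let ?s = "real CARD('n) / u"
  have u: "0 < u" using assms by simp
  obtain K h where K: "K > 0" and hm: "\<And>T. T \<in> tempered_distributions \<Longrightarrow> h T \<in> borel_measurable borel"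
    and main: "\<And>T N. T \<in> tempered_distributions \<Longrightarrow> N > 0 \<Longrightarrow>
      (\<And>Q. Q \<in> dyadic_cubes \<Longrightarrow>
        ennreal (measure lebesgue Q powr (p / u - 1)) * (\<integral>\<^sup>+y\<in>Q. ennreal_powr (sup_fun ?s T y) p \<partial>lborel) \<le> ennreal (N powr p)) \<Longrightarrow>
      represents (h T) T \<and> orlicz_morrey_norm (u / p) (Phi_p1 p) (h T) \<le> ennreal (K * N)"
    using tempered_in_orlicz_morrey[OF assms(1) u] by blast
  have emb: "h T \<in> orlicz_morrey_space (u / p) (Phi_p1 p) \<and> represents (h T) T \<and>
      orlicz_morrey_norm (u / p) (Phi_p1 p) (h T) \<le> ennreal K * tlm_norm \<phi> ?s u p q T"
    if TX: "T \<in> tlm_space \<phi> ?s u p q" for T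
  proof -
    have T: "T \<in> tempered_distributions" and fin: "tlm_norm \<phi> ?s u p q T < \<infinity>"
      using TX by (auto simp: tlm_space_def)
    obtain n where n: "tlm_norm \<phi> ?s u p q T = ennreal n" "n \<ge> 0"
      using fin by (cases "tlm_norm \<phi> ?s u p q T") auto
    have bound: "represents (h T) T \<and> orlicz_morrey_norm (u / p) (Phi_p1 p) (h T) \<le> ennreal (K * N)"
      if N: "N > 0" "n \<le> N" for N
    proof (rule main[OF T N(1)])
      fix Q :: "(real^'n) set" assume Q: "Q \<in> dyadic_cubes"
      have "morrey_norm u p (tlm_lq_function \<phi> ?s q T) \<le> ennreal N"
        using n N by (simp add: tlm_norm_def ennreal_leI)
      from morrey_norm_cube[OF assms(1) less_imp_le[OF N(1)] this Q]
      have "ennreal (measure lebesgue Q powr (p / u - 1)) * (\<integral>\<^sup>+y\<in>Q. ennreal_powr (tlm_lq_function \<phi> ?s q T y) p \<partial>lborel) \<le> ennreal (N powr p)" .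
      moreover have "(\<integral>\<^sup>+y\<in>Q. ennreal_powr (sup_fun ?s T y) p \<partial>lborel) \<le> (\<integral>\<^sup>+y\<in>Q. ennreal_powr (tlm_lq_function \<phi> ?s q T y) p \<partial>lborel)"
        by (intro nn_integral_mono mult_right_mono ennreal_powr_mono sup_fun_le_lq T assms(3) less_imp_le[OF assms(1)]) auto
      ultimately show "ennreal (measure lebesgue Q powr (p / u - 1)) * (\<integral>\<^sup>+y\<in>Q. ennreal_powr (sup_fun ?s T y) p \<partial>lborel) \<le> ennreal (N powr p)"
        by (meson mult_left_mono order_trans zero_le)
    qed
    have rep: "represents (h T) T" using bound[of "n + 1"] n(2) by simp
    \<comment> \<open>Since \<open>h T\<close> does not depend on \<open>N\<close>, the bound can be
      taken along \<open>N = n + e / K\<close>, for which \<open>K * N\<close> exceeds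
      \<open>K * n\<close> by exactly \<open>e\<close>.\<close>
    have le: "orlicz_morrey_norm (u / p) (Phi_p1 p) (h T) \<le> ennreal (K * n)"
    proof (rule ennreal_le_epsilon)
      fix e :: real assume e: "0 < e"
      have "orlicz_morrey_norm (u / p) (Phi_p1 p) (h T) \<le> ennreal (K * (n + e / K))"
        using bound[of "n + e / K"] K e n(2) by (simp add: add_nonneg_pos)
      also have "K * (n + e / K) = K * n + e" using K by (simp add: distrib_left)
      also have "ennreal (K * n + e) = ennreal (K * n) + ennreal e" using K n(2) e by (simp add: ennreal_plus)
      finally show "orlicz_morrey_norm (u / p) (Phi_p1 p) (h T) \<le> ennreal (K * n) + ennreal e" .
    qed
    have "h T \<in> borel_measurable lebesgue" using hm[OF T] by (simp add: measurable_completion)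
    moreover have "orlicz_morrey_norm (u / p) (Phi_p1 p) (h T) < \<infinity>"
      using le by (rule le_less_trans) simp
    ultimately show ?thesis
      using rep le K n(2) by (simp add: orlicz_morrey_space_def n(1) ennreal_mult)
  qed
  show ?thesis unfolding continuously_embedded_def using K emb by blast
qed

end
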